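(* Let $Y=(Y_{ij})_{i\ge1,j\ge1}$ be a row-column exchangeable (RCE) matrix and let $h$ be a quadruplet kernel such that $\mathbb{E}[h(Y_{(1,2;1,2)})^2]<\infty$. Let $(U^h_N)_{N\ge1}$ be the associated sequence of $U$-statistics, $\mathcal{F}_N=\sigma\big(U^h_{k,l},\ k\ge m_N,\ l\ge n_N\big)$ and $\mathcal{F}_\infty=\bigcap_{N=1}^\infty\mathcal{F}_N$. Set $U^h_\infty=\mathbb{E}[h(Y_{(1,2;1,2)})\mid\mathcal{F}_\infty]$ and $$V=\frac{4}{c}\,\mathrm{Cov}\big(h(Y_{(1,2;1,2)}),h(Y_{(1,3;3,4)})\,\big|\,\mathcal{F}_\infty\big)+\frac{4}{1-c}\,\mathrm{Cov}\big(h(Y_{(1,2;1,2)}),h(Y_{(3,4;1,3)})\,\big|\,\mathcal{F}_\infty\big).$$ If $\mathbb{P}(V>0)>0$, then $$\sqrt{N}\,(U^h_N-U^h_\infty)\xrightarrow[N\to\infty]{\mathcal{D}}W,$$ where $W$ is a random variable with characteristic function $\phi(t)=\mathbb{E}[\exp(-\tfrac12t^2V)]$.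
   Context: RCE matrix: an infinite matrix $Y=(Y_{ij})_{i,j\ge1}$ of real random variables such that for all finite permutations $\sigma_1,\sigma_2$ of $\{1,2,\dots\}$ (permutations moving only finitely many points), $(Y_{\sigma_1(i)\sigma_2(j)})_{i,j\ge1}$ has the same distribution as $Y$. Quadruplets: $Y_{(i_1,i_2;j_1,j_2)}=\begin{pmatrix}Y_{i_1j_1}&Y_{i_1j_2}\\ Y_{i_2j_1}&Y_{i_2j_2}\end{pmatrix}$. A quadruplet kernel is a (measurable) real function $h$ of $2\times2$ real matrices that is invariant under swapping the two rows and under swapping the two columns. $U$-statistics: for $m,n\ge2$, $U^h_{m,n}=\binom m2^{-1}\binom n2^{-1}\sum_{1\le i_1<i_2\le m,\ 1\le j_1<j_2\le n}h(Y_{(i_1,i_2;j_1,j_2)})$. Dimensions: $c\in(0,1)$ is a fixed irrational number, $m_N=2+\lfloor c(N+1)\rfloor$, $n_N=2+\lfloor(1-c)(N+1)\rfloor$, and $U^h_N:=U^h_{m_N,n_N}$. The conditional covariance is $\mathrm{Cov}(A,B\mid\mathcal F)=\mathbb{E}[AB\mid\mathcal F]-\mathbb{E}[A\mid\mathcal F]\,\mathbb{E}[B\mid\mathcal F]$. *)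

theory Defs
  imports "HOL-Probability.Probability"
begin

text \<open>Rows and columns are numbered from 1, as in the mathematics: only the values \<open>Y i j\<close> with
  \<open>i, j \<ge> 1\<close> matter.\<close>

type_synonym 'a random_matrix = "nat \<Rightarrow> nat \<Rightarrow> 'a \<Rightarrow> real"

definition matrix_law :: "'a measure \<Rightarrow> 'a random_matrix \<Rightarrow> (nat \<times> nat \<Rightarrow> real) measure" where
  "matrix_law M Y =
     distr M (\<Pi>\<^sub>M p\<in>{1..} \<times> {1..}. borel) (\<lambda>\<omega>. \<lambda>(i, j)\<in>{1..} \<times> {1..}. Y i j \<omega>)"

definition finite_permutation :: "(nat \<Rightarrow> nat) \<Rightarrow> bool" where
  "finite_permutation \<sigma> \<longleftrightarrow> (\<exists>S. finite S \<and> S \<subseteq> {1..} \<and> \<sigma> permutes S)"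

definition RCE :: "'a measure \<Rightarrow> 'a random_matrix \<Rightarrow> bool" where
  "RCE M Y \<longleftrightarrow>
     (\<forall>i\<ge>1. \<forall>j\<ge>1. Y i j \<in> borel_measurable M) \<and>
     (\<forall>\<sigma>1 \<sigma>2. finite_permutation \<sigma>1 \<longrightarrow> finite_permutation \<sigma>2 \<longrightarrow>
        matrix_law M (\<lambda>i j. Y (\<sigma>1 i) (\<sigma>2 j)) = matrix_law M Y)"

definition quadruplet ::
    "'a random_matrix \<Rightarrow> nat \<Rightarrow> nat \<Rightarrow> nat \<Rightarrow> nat \<Rightarrow> 'a \<Rightarrow> real^2^2" where
  "quadruplet Y i1 i2 j1 j2 \<omega> =
     vector [vector [Y i1 j1 \<omega>, Y i1 j2 \<omega>],
             vector [Y i2 j1 \<omega>, Y i2 j2 \<omega>]]"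

text \<open>The second condition swaps the two rows, the third the two columns.\<close>

definition quadruplet_kernel :: "(real^2^2 \<Rightarrow> real) \<Rightarrow> bool" where
  "quadruplet_kernel h \<longleftrightarrow>
     h \<in> borel_measurable borel \<and>
     (\<forall>A. h (vector [A $ 2, A $ 1]) = h A) \<and>
     (\<forall>A. h (\<chi> i. vector [A $ i $ 2, A $ i $ 1]) = h A)"

definition U_stat ::
    "(real^2^2 \<Rightarrow> real) \<Rightarrow> 'a random_matrix \<Rightarrow> nat \<Rightarrow> nat \<Rightarrow> 'a \<Rightarrow> real" where
  "U_stat h Y m n \<omega> =
     inverse (real (m choose 2)) * inverse (real (n choose 2)) *
     (\<Sum>(i1, i2, j1, j2)\<in>{(i1, i2, j1, j2). 1 \<le> i1 \<and> i1 < i2 \<and> i2 \<le> m \<and>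
                                            1 \<le> j1 \<and> j1 < j2 \<and> j2 \<le> n}.
        h (quadruplet Y i1 i2 j1 j2 \<omega>))"

definition row_dim :: "real \<Rightarrow> nat \<Rightarrow> nat" where
  "row_dim c N = 2 + nat \<lfloor>c * (real N + 1)\<rfloor>"

definition col_dim :: "real \<Rightarrow> nat \<Rightarrow> nat" where
  "col_dim c N = 2 + nat \<lfloor>(1 - c) * (real N + 1)\<rfloor>"

definition U_seq ::
    "(real^2^2 \<Rightarrow> real) \<Rightarrow> 'a random_matrix \<Rightarrow> real \<Rightarrow> nat \<Rightarrow> 'a \<Rightarrow> real" where
  "U_seq h Y c N = U_stat h Y (row_dim c N) (col_dim c N)"

text \<open>Only the \<open>\<sigma>\<close>-algebras of the following two measures are relevant; the measure of every set
  is 0.\<close>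

definition U_filtration ::
    "'a measure \<Rightarrow> (real^2^2 \<Rightarrow> real) \<Rightarrow> 'a random_matrix \<Rightarrow> real \<Rightarrow> nat \<Rightarrow> 'a measure" where
  "U_filtration M h Y c N =
     sigma (space M) {U_stat h Y k l -` B \<inter> space M | k l B.
       k \<ge> row_dim c N \<and> l \<ge> col_dim c N \<and> B \<in> sets borel}"

definition U_tail ::
    "'a measure \<Rightarrow> (real^2^2 \<Rightarrow> real) \<Rightarrow> 'a random_matrix \<Rightarrow> real \<Rightarrow> 'a measure" where
  "U_tail M h Y c = sigma (space M) (\<Inter>N\<in>{1..}. sets (U_filtration M h Y c N))"

text \<open>The intersection is already a \<open>\<sigma>\<close>-algebra, so that \<^const>\<open>sigma\<close> adds no set to it.\<close>

lemma space_U_filtration: "space (U_filtration M h Y c N) = space M"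
  by (simp add: U_filtration_def space_measure_of_conv)

lemma sets_U_tail: "sets (U_tail M h Y c) = (\<Inter>N\<in>{1..}. sets (U_filtration M h Y c N))"
proof -
  let ?S = "\<Inter>N\<in>{1..}. sets (U_filtration M h Y c N)"
  have sub: "?S \<subseteq> Pow (space M)"
  proof
    fix s assume "s \<in> ?S"
    then have "s \<in> sets (U_filtration M h Y c 1)" by simp
    then show "s \<in> Pow (space M)"
      using sets.sets_into_space space_U_filtration by fastforce
  qed
  have "sigma_algebra (space M) ?S"
    unfolding sigma_algebra_iff2
  proof (intro conjI ballI allI impI)
    fix s assume s: "s \<in> ?S"
    show "space M - s \<in> ?S"
    proof
      fix N :: nat assume "N \<in> {1..}"
      then have "s \<in> sets (U_filtration M h Y c N)" using s by blast
      from sets.compl_sets[OF this] show "space M - s \<in> sets (U_filtration M h Y c N)"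
        by (simp only: space_U_filtration)
    qed
  next
    fix A :: "nat \<Rightarrow> _" assume A: "range A \<subseteq> ?S"
    show "\<Union>(range A) \<in> ?S"
    proof
      fix N :: nat assume "N \<in> {1..}"
      then have "range A \<subseteq> sets (U_filtration M h Y c N)" using A by blast
      then show "\<Union>(range A) \<in> sets (U_filtration M h Y c N)"
        by (rule sets.countable_nat_UN)
    qed
  next
    show "?S \<subseteq> Pow (space M)" by (rule sub)
  next
    show "{} \<in> ?S" by simp
  qed
  then show ?thesis
    unfolding U_tail_def by (simp only: sets_measure_of[OF sub] sigma_algebra.sigma_sets_eq)
qed

definition cond_cov ::
    "'a measure \<Rightarrow> 'a measure \<Rightarrow> ('a \<Rightarrow> real) \<Rightarrow> ('a \<Rightarrow> real) \<Rightarrow> 'a \<Rightarrow> real" where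
  "cond_cov M F A B \<omega> =
     real_cond_exp M F (\<lambda>x. A x * B x) \<omega> - real_cond_exp M F A \<omega> * real_cond_exp M F B \<omega>"

definition U_infinity ::
    "'a measure \<Rightarrow> (real^2^2 \<Rightarrow> real) \<Rightarrow> 'a random_matrix \<Rightarrow> real \<Rightarrow> 'a \<Rightarrow> real" where
  "U_infinity M h Y c = real_cond_exp M (U_tail M h Y c) (\<lambda>x. h (quadruplet Y 1 2 1 2 x))"

text \<open>The first covariance is between quadruplets sharing one row, the second between quadruplets
  sharing one column.\<close>

definition asymptotic_variance ::
    "'a measure \<Rightarrow> (real^2^2 \<Rightarrow> real) \<Rightarrow> 'a random_matrix \<Rightarrow> real \<Rightarrow> 'a \<Rightarrow> real" where
  "asymptotic_variance M h Y c \<omega> =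
     4 / c * cond_cov M (U_tail M h Y c)
       (\<lambda>x. h (quadruplet Y 1 2 1 2 x)) (\<lambda>x. h (quadruplet Y 1 3 3 4 x)) \<omega> +
     4 / (1 - c) * cond_cov M (U_tail M h Y c)
       (\<lambda>x. h (quadruplet Y 1 2 1 2 x)) (\<lambda>x. h (quadruplet Y 3 4 1 3 x)) \<omega>"

end

theory Submission
  imports Defs "HOL-Real_Asymp.Real_Asymp"
begin

text \<open>The proof treats \<open>U\<^sub>N\<close> as a backward martingale. The conditional law of the array given
\<open>\<F>\<^sub>N\<close> is invariant under permutations of the first \<open>m\<^sub>N\<close> rows and the first \<open>n\<^sub>N\<close> columns, because every
\<open>U\<^sub>k\<^sub>,\<^sub>l\<close> with \<open>k \<ge> m\<^sub>N\<close>, \<open>l \<ge> n\<^sub>N\<close> is (\<open>cond_exp_U_filtration_permute\<close>). Hence all quadruplets in the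
leading block have the same conditional expectation given \<open>\<F>\<^sub>N\<close>, which must be their average. With
\<open>H(i, i'; j, j')\<close> for the kernel at the quadruplet with these rows and columns, this reads
\<open>U\<^sub>N = E[H(1, 2; 1, 2) | \<F>\<^sub>N]\<close> (\<open>U_eq_cond_exp\<close>), and \<open>U\<^sub>N\<close> converges in \<open>L\<^sup>2\<close> to \<open>U\<^sub>\<infinity>\<close>.

Write \<open>Z\<^sub>J = U\<^sub>J - U\<^sub>J\<^sub>+\<^sub>1\<close>, so that \<open>\<surd>N (U\<^sub>N - U\<^sub>\<infinity>)\<close> is the sum of \<open>\<surd>N Z\<^sub>J\<close> over \<open>J \<ge> N\<close>. Suppose that the
conditional variances \<open>E[Z\<^sub>J\<^sup>2 | \<F>\<^sub>J\<^sub>+\<^sub>1]\<close> are close, up to \<open>o(1/J\<^sup>2)\<close> in \<open>L\<^sup>1\<close>, to \<open>\<F>\<^sub>\<infinity>\<close>-measurable variables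
\<open>Q\<^sub>J \<ge> 0\<close> with \<open>N (Q\<^sub>N + Q\<^sub>N\<^sub>+\<^sub>1 + \<dots>) \<longlonglongrightarrow> V\<close>, and that the \<open>Z\<^sub>J\<close> satisfy a Lindeberg condition. Replacing one factor \<open>exp (i t \<surd>N Z\<^sub>J)\<close> after the other by
\<open>exp (- t\<^sup>2 N Q\<^sub>J / 2)\<close> costs \<open>o(N/J\<^sup>2)\<close> each, and \<open>o(1)\<close> in total; the characteristic function therefore
tends to \<open>E[exp (- t\<^sup>2 V / 2)]\<close> (\<open>backward_martingale_clt\<close>). Since each \<open>Q\<^sub>J\<close> is \<open>\<F>\<^sub>\<infinity>\<close>-measurable, it can
be carried through all the conditional expectations at once, which is why the limit is a mixture of
Gaussian laws with the random variance \<open>V\<close>.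

It remains to compute the conditional variances. As \<open>c\<close> is irrational, each step adds exactly one row or
exactly one column (\<open>dim_step\<close>); transposing the array exchanges the two cases. When a row is added to
\<open>m\<close> rows, \<open>Z\<^sub>J\<close> is \<open>2/(m - 1)\<close> times the difference of \<open>U\<^sub>J\<^sub>+\<^sub>1\<close> and the mean \<open>A\<close> of the kernel over the
quadruplets that use the new row (\<open>row_step_increment\<close>). In \<open>A\<^sup>2\<close> almost all pairs of quadruplets share
the new row and nothing else, so that \<open>E[A\<^sup>2 | \<F>\<^sub>J\<^sub>+\<^sub>1]\<close> is close to
\<open>E[H(1, 2; 1, 2) H(1, 3; 3, 4) | \<F>\<^sub>\<infinity>]\<close>. This identifies \<open>Q\<^sub>J\<close> as \<open>4 (1/m - 1/(m + 1))\<close> times the first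
conditional covariance (\<open>row_step_conditional_variance\<close>); these weights telescope, and summing them over
the row steps and the column steps produces the coefficients \<open>4/c\<close> and \<open>4/(1 - c)\<close> of \<open>V\<close>. The
Lindeberg condition needs second moments only, because the increments are averages of identically
distributed variables and the truncated square is comparable to a convex function
(\<open>lindeberg_deviation_le\<close>).\<close>

section \<open>Square-integrable functions and conditional expectation\<close>

lemma integrable_mult_of_square:
  fixes X Y :: "'a \<Rightarrow> real"
  assumes [measurable]: "X \<in> borel_measurable M" "Y \<in> borel_measurable M"
    and "integrable M (\<lambda>x. (X x)\<^sup>2)" "integrable M (\<lambda>x. (Y x)\<^sup>2)"
  shows "integrable M (\<lambda>x. X x * Y x)"
proof (rule Bochner_Integration.integrable_bound[OF Bochner_Integration.integrable_add[OF assms(3,4)]])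
  show "AE x in M. norm (X x * Y x) \<le> norm ((X x)\<^sup>2 + (Y x)\<^sup>2)"
  proof (rule AE_I2)
    fix x
    have "2 * (\<bar>X x\<bar> * \<bar>Y x\<bar>) \<le> (X x)\<^sup>2 + (Y x)\<^sup>2"
      using sum_squares_bound[of "\<bar>X x\<bar>" "\<bar>Y x\<bar>"] by simp
    moreover have "0 \<le> \<bar>X x\<bar> * \<bar>Y x\<bar>" by simp
    ultimately have "\<bar>X x\<bar> * \<bar>Y x\<bar> \<le> (X x)\<^sup>2 + (Y x)\<^sup>2" by linarith
    then show "norm (X x * Y x) \<le> norm ((X x)\<^sup>2 + (Y x)\<^sup>2)"
      by (simp add: abs_mult)
  qed
qed simp

lemma integrable_square_add:
  fixes X Y :: "'a \<Rightarrow> real"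
  assumes [measurable]: "X \<in> borel_measurable M" "Y \<in> borel_measurable M"
    and "integrable M (\<lambda>x. (X x)\<^sup>2)" "integrable M (\<lambda>x. (Y x)\<^sup>2)"
  shows "integrable M (\<lambda>x. (X x + Y x)\<^sup>2)"
  using assms integrable_mult_of_square[OF assms]
  by (auto simp: power2_sum mult.assoc intro!: Bochner_Integration.integrable_add)

lemma integrable_square_diff:
  fixes X Y :: "'a \<Rightarrow> real"
  assumes [measurable]: "X \<in> borel_measurable M" "Y \<in> borel_measurable M"
    and "integrable M (\<lambda>x. (X x)\<^sup>2)" "integrable M (\<lambda>x. (Y x)\<^sup>2)"
  shows "integrable M (\<lambda>x. (X x - Y x)\<^sup>2)"
  using assms integrable_mult_of_square[OF assms]
  by (auto simp: power2_diff mult.assoc intro!: Bochner_Integration.integrable_add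
      Bochner_Integration.integrable_diff)

lemma (in prob_space) abs_expectation_le_L2:
  fixes X :: "'a \<Rightarrow> real"
  assumes [measurable]: "X \<in> borel_measurable M" and "integrable M (\<lambda>x. (X x)\<^sup>2)"
  shows "expectation (\<lambda>x. \<bar>X x\<bar>) \<le> sqrt (expectation (\<lambda>x. (X x)\<^sup>2))"
proof -
  have i: "integrable M (\<lambda>x. \<bar>X x\<bar>)"
    using square_integrable_imp_integrable[of X] assms by auto
  have "0 \<le> variance (\<lambda>x. \<bar>X x\<bar>)" by (simp add: integral_nonneg_AE)
  also have "\<dots> = expectation (\<lambda>x. (X x)\<^sup>2) - (expectation (\<lambda>x. \<bar>X x\<bar>))\<^sup>2"
    using variance_eq[OF i] assms by simp
  finally show ?thesis by (intro real_le_rsqrt) simp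
qed

lemma (in prob_space) finite_measure_subalgebraI:
  "subalgebra M F \<Longrightarrow> finite_measure_subalgebra M F"
  by unfold_locales

lemma (in finite_measure_subalgebra) integrable_square_real_cond_exp:
  assumes [measurable]: "X \<in> borel_measurable M" and "integrable M (\<lambda>x. (X x)\<^sup>2)"
  shows "integrable M (\<lambda>x. (real_cond_exp M F X x)\<^sup>2)"
proof (rule integrable_convex_cond_exp[where I=UNIV and q="\<lambda>x. x\<^sup>2"])
  show "integrable M X" by (rule square_integrable_imp_integrable[OF assms])
qed (use assms in \<open>simp_all add: convex_power2\<close>)

lemma (in sigma_finite_subalgebra) real_cond_exp_L1_contraction:
  assumes [measurable]: "integrable M X"
  shows "(\<integral>x. \<bar>real_cond_exp M F X x\<bar> \<partial>M) \<le> (\<integral>x. \<bar>X x\<bar> \<partial>M)"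
proof -
  have "(\<integral>x. \<bar>real_cond_exp M F X x\<bar> \<partial>M) \<le> (\<integral>x. real_cond_exp M F (\<lambda>x. \<bar>X x\<bar>) x \<partial>M)"
  proof (rule integral_mono_AE)
    have "AE x in M. real_cond_exp M F X x \<le> real_cond_exp M F (\<lambda>x. \<bar>X x\<bar>) x"
      by (rule real_cond_exp_mono) (use assms in auto)
    moreover have "AE x in M. real_cond_exp M F (\<lambda>x. - 1 * X x) x \<le> real_cond_exp M F (\<lambda>x. \<bar>X x\<bar>) x"
      by (rule real_cond_exp_mono) (use assms in auto)
    moreover have "AE x in M. real_cond_exp M F (\<lambda>x. - 1 * X x) x = - 1 * real_cond_exp M F X x"
      by (rule real_cond_exp_cmult) (use assms in auto)
    ultimately show "AE x in M. \<bar>real_cond_exp M F X x\<bar> \<le> real_cond_exp M F (\<lambda>x. \<bar>X x\<bar>) x"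
      by eventually_elim auto
  qed (use assms in \<open>auto intro!: real_cond_exp_int\<close>)
  also have "\<dots> = (\<integral>x. \<bar>X x\<bar> \<partial>M)"
    by (rule real_cond_exp_int) (use assms in auto)
  finally show ?thesis .
qed

section \<open>Convergence of backward martingales\<close>

lemma subalgebra_antimono_seq:
  assumes "\<And>n. subalgebra (F n) (F (Suc n))" and "m \<le> n"
  shows "subalgebra (F m) (F n)"
  using assms(2)
proof (induction rule: dec_induct)
  case (step n)
  then show ?case using assms(1)[of n] by (auto simp: subalgebra_def)
qed (auto simp: subalgebra_def)

text \<open>The increments of the backward martingale are orthogonal, so that its second moments decrease and it is
Cauchy in \<open>L\<^sup>2\<close>. An almost everywhere limit \<open>Z\<close> of a subsequence depends only on the terms from any index
on, hence is measurable for the tail \<open>T\<close>; Fatou's lemma carries the \<open>L\<^sup>2\<close> bound to \<open>Z\<close>, and integrating over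
sets in \<open>T\<close> shows that \<open>Z\<close> is the conditional expectation given \<open>T\<close>.\<close>

lemma (in prob_space) backward_martingale_L2:
  assumes sub: "\<And>n. subalgebra M (F n)"
    and dec: "\<And>n. subalgebra (F n) (F (Suc n))"
    and T: "space T = space M" "sets T = (\<Inter>n. sets (F n))"
    and X [measurable]: "X \<in> borel_measurable M" and X2: "integrable M (\<lambda>x. (X x)\<^sup>2)"
  shows "(\<lambda>n. expectation (\<lambda>x. (real_cond_exp M (F n) X x - real_cond_exp M T X x)\<^sup>2)) \<longlonglongrightarrow> 0"
proof -
  define E where "E n = real_cond_exp M (F n) X" for n
  define e where "e n = expectation (\<lambda>x. (E n x)\<^sup>2)" for n
  have Ff: "finite_measure_subalgebra M (F n)" for n
    by (rule finite_measure_subalgebraI[OF sub])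
  have Fs: "sigma_finite_subalgebra M (F n)" for n
    by (rule finite_measure_subalgebra_is_sigma_finite[OF Ff])
  have Tsub: "subalgebra M T" using sub[of 0] T by (auto simp: subalgebra_def)
  have TF: "subalgebra (F n) T" for n using sub[of n] T by (auto simp: subalgebra_def)
  interpret T: finite_measure_subalgebra M T by (rule finite_measure_subalgebraI[OF Tsub])
  have X1: "integrable M X" using square_integrable_imp_integrable[OF X X2] .
  have EF: "E n \<in> borel_measurable (F n)" for n unfolding E_def by simp
  have E [measurable]: "E n \<in> borel_measurable M" for n unfolding E_def by simp
  have E2: "integrable M (\<lambda>x. (E n x)\<^sup>2)" for n
    unfolding E_def by (rule finite_measure_subalgebra.integrable_square_real_cond_exp[OF Ff X X2])
  have E1: "integrable M (E n)" for n using square_integrable_imp_integrable[OF E E2] .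
  have EX: "expectation (\<lambda>x. E n x * E m x) = expectation (\<lambda>x. E n x * X x)" if "m \<le> n" for m n
  proof -
    have "E n \<in> borel_measurable (F m)"
      using measurable_from_subalg[OF subalgebra_antimono_seq[of F, OF dec that] EF] .
    then show ?thesis
      unfolding E_def[of m]
      by (intro sigma_finite_subalgebra.real_cond_exp_intg[OF Fs]
          integrable_mult_of_square[OF E X E2 X2]) auto
  qed
  have orth: "expectation (\<lambda>x. (E m x - E n x)\<^sup>2) = e m - e n" if "m \<le> n" for m n
  proof -
    have "expectation (\<lambda>x. (E m x - E n x)\<^sup>2) = expectation (\<lambda>x. (E m x)\<^sup>2 + (E n x)\<^sup>2 - 2 * (E n x * E m x))"
      by (intro Bochner_Integration.integral_cong) (auto simp: power2_diff)
    also have "\<dots> = e m + e n - 2 * expectation (\<lambda>x. E n x * E m x)"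
      unfolding e_def using E2 integrable_mult_of_square[OF E E E2 E2]
      by (subst Bochner_Integration.integral_diff Bochner_Integration.integral_add; simp)+
    also have "expectation (\<lambda>x. E n x * E m x) = e n"
      using EX[OF that] EX[of n n] by (simp add: e_def power2_eq_square)
    finally show ?thesis by simp
  qed
  have "decseq e"
  proof (rule decseq_SucI)
    fix n
    have "0 \<le> expectation (\<lambda>x. (E n x - E (Suc n) x)\<^sup>2)" by simp
    then show "e (Suc n) \<le> e n" using orth[of n "Suc n"] by simp
  qed
  moreover have "0 \<le> e n" for n unfolding e_def by simp
  ultimately obtain l where l: "e \<longlonglongrightarrow> l" "\<And>n. l \<le> e n"
    using decseq_convergent[of e 0] by blast
  have orth': "expectation (\<lambda>x. (E m x - E n x)\<^sup>2) \<le> max (e m) (e n) - l" for m n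
  proof (cases "m \<le> n")
    case True then show ?thesis using orth[OF True] l(2)[of n] by linarith
  next
    case False
    have "expectation (\<lambda>x. (E m x - E n x)\<^sup>2) = expectation (\<lambda>x. (E n x - E m x)\<^sup>2)"
      by (simp add: power2_commute)
    then show ?thesis using False orth[of n m] l(2)[of m] by linarith
  qed
  have "\<exists>N. \<forall>i\<ge>N. \<forall>j\<ge>N. expectation (\<lambda>x. norm (E i x - E j x)) < d" if "d > 0" for d
  proof -
    have "eventually (\<lambda>n. e n < l + d\<^sup>2) sequentially"
      using l(1) that by (intro order_tendstoD) auto
    then obtain N where N: "\<And>n. n \<ge> N \<Longrightarrow> e n < l + d\<^sup>2"
      by (auto simp: eventually_sequentially)
    have "expectation (\<lambda>x. norm (E i x - E j x)) < d" if "i \<ge> N" "j \<ge> N" for i j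
    proof -
      have "expectation (\<lambda>x. norm (E i x - E j x)) \<le> sqrt (expectation (\<lambda>x. (E i x - E j x)\<^sup>2))"
        using abs_expectation_le_L2[of "\<lambda>x. E i x - E j x"] integrable_square_diff[OF E E E2 E2] by simp
      also have "\<dots> < sqrt (d\<^sup>2)"
        using orth'[of i j] N[OF that(1)] N[OF that(2)] by (intro real_sqrt_less_mono) linarith
      finally show ?thesis using \<open>d > 0\<close> by simp
    qed
    then show ?thesis by blast
  qed
  from cauchy_L1_AE_cauchy_subseq[OF E1 this]
  obtain r where r: "strict_mono r" "AE x in M. Cauchy (\<lambda>i. E (r i) x)" by blast
  define Z where "Z x = lim (\<lambda>i. E (r i) x)" for x
  \<comment> \<open>Dropping the first \<open>n\<close> terms of the subsequence leaves the limit unchanged.\<close>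
  have ZF: "Z \<in> borel_measurable (F n)" for n
  proof -
    have "Z = (\<lambda>x. lim (\<lambda>i. E (r (i + n)) x))"
      unfolding Z_def lim_def
      by (intro ext arg_cong[where f=The])
         (blast intro: LIMSEQ_ignore_initial_segment[where f="\<lambda>i. E (r i) _"]
            LIMSEQ_offset[where f="\<lambda>i. E (r i) _"])
    moreover have "E (r (i + n)) \<in> borel_measurable (F n)" for i
    proof (rule measurable_from_subalg[OF _ EF])
      have "n \<le> r (i + n)" using seq_suble[OF r(1), of "i + n"] by simp
      then show "subalgebra (F n) (F (r (i + n)))" by (rule subalgebra_antimono_seq[of F, OF dec])
    qed
    ultimately show ?thesis by simp
  qed
  have ZT: "Z \<in> borel_measurable T"
  proof (rule measurableI)
    fix A :: "real set" assume "A \<in> sets borel"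
    then have "Z -` A \<inter> space (F n) \<in> sets (F n)" for n
      using ZF by (rule measurable_sets[rotated])
    moreover have "space (F n) = space M" for n using sub[of n] by (simp add: subalgebra_def)
    ultimately show "Z -` A \<inter> space T \<in> sets T" using T by auto
  qed auto
  have Z [measurable]: "Z \<in> borel_measurable M" by (rule measurable_from_subalg[OF Tsub ZT])
  have fatou: "integrable M (\<lambda>x. (E n x - Z x)\<^sup>2) \<and> expectation (\<lambda>x. (E n x - Z x)\<^sup>2) \<le> e n - l" for n
  proof -
    have "(\<integral>\<^sup>+x. ennreal ((E n x - Z x)\<^sup>2) \<partial>M) = (\<integral>\<^sup>+x. liminf (\<lambda>i. ennreal ((E n x - E (r i) x)\<^sup>2)) \<partial>M)"
    proof (rule nn_integral_cong_AE)
      show "AE x in M. ennreal ((E n x - Z x)\<^sup>2) = liminf (\<lambda>i. ennreal ((E n x - E (r i) x)\<^sup>2))"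
        using r(2)
      proof eventually_elim
        case (elim x)
        then have "(\<lambda>i. E (r i) x) \<longlonglongrightarrow> Z x"
          unfolding Z_def by (simp add: Cauchy_convergent convergent_LIMSEQ_iff[symmetric])
        then have "(\<lambda>i. ennreal ((E n x - E (r i) x)\<^sup>2)) \<longlonglongrightarrow> ennreal ((E n x - Z x)\<^sup>2)"
          by (intro tendsto_intros tendsto_ennrealI)
        from lim_imp_Liminf[OF _ this] show ?case by simp
      qed
    qed
    also have "\<dots> \<le> liminf (\<lambda>i. \<integral>\<^sup>+x. ennreal ((E n x - E (r i) x)\<^sup>2) \<partial>M)"
      by (intro nn_integral_liminf) auto
    also have "\<dots> \<le> limsup (\<lambda>i. \<integral>\<^sup>+x. ennreal ((E n x - E (r i) x)\<^sup>2) \<partial>M)"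
      by (rule Liminf_le_Limsup) simp
    also have "\<dots> \<le> ennreal (e n - l)"
    proof (rule Limsup_bounded)
      have "(\<integral>\<^sup>+x. ennreal ((E n x - E (r i) x)\<^sup>2) \<partial>M) \<le> ennreal (e n - l)" if "i \<ge> n" for i
      proof -
        have "n \<le> r i" using seq_suble[OF r(1), of i] that by simp
        then have "expectation (\<lambda>x. (E n x - E (r i) x)\<^sup>2) \<le> e n - l"
          using orth l(2)[of "r i"] by simp
        then show ?thesis
          by (subst nn_integral_eq_integral[OF integrable_square_diff[OF E E E2 E2]])
             (auto intro!: ennreal_leI)
      qed
      then show "\<forall>\<^sub>F i in sequentially. (\<integral>\<^sup>+x. ennreal ((E n x - E (r i) x)\<^sup>2) \<partial>M) \<le> ennreal (e n - l)"
        by (auto simp: eventually_sequentially)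
    qed
    finally have le: "(\<integral>\<^sup>+x. ennreal ((E n x - Z x)\<^sup>2) \<partial>M) \<le> ennreal (e n - l)" .
    then have int: "integrable M (\<lambda>x. (E n x - Z x)\<^sup>2)"
      by (intro integrableI_bounded) (auto simp: top_unique less_top[symmetric])
    show ?thesis
      using le l(2)[of n] int by (auto simp: nn_integral_eq_integral ennreal_le_iff)
  qed
  have Z2: "integrable M (\<lambda>x. (Z x)\<^sup>2)"
    using integrable_square_diff[OF E _ E2, of "\<lambda>x. E 0 x - Z x" 0] fatou[of 0] by simp
  have Z1: "integrable M Z" using square_integrable_imp_integrable[OF Z Z2] .
  have lim: "(\<lambda>n. expectation (\<lambda>x. (E n x - Z x)\<^sup>2)) \<longlonglongrightarrow> 0"
  proof (rule tendsto_sandwich[of "\<lambda>_. 0" _ _ "\<lambda>n. e n - l"])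
    show "(\<lambda>n. e n - l) \<longlonglongrightarrow> 0" using l(1) by (simp add: LIM_zero)
  qed (use fatou in auto)
  have "AE x in M. real_cond_exp M T X x = Z x"
  proof (rule T.real_cond_exp_charact)
    fix A assume A: "A \<in> sets T"
    have AM [measurable]: "A \<in> sets M" using A Tsub by (auto simp: subalgebra_def)
    have "(\<integral>x\<in>A. X x \<partial>M) = (\<integral>x\<in>A. E n x \<partial>M)" for n
    proof -
      have "A \<in> sets (F n)" using A T by auto
      then show ?thesis unfolding E_def
        by (intro sigma_finite_subalgebra.real_cond_exp_intA[OF Fs X1])
    qed
    then have eq: "\<bar>(\<integral>x\<in>A. X x \<partial>M) - (\<integral>x\<in>A. Z x \<partial>M)\<bar> \<le> sqrt (expectation (\<lambda>x. (E n x - Z x)\<^sup>2))" for n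
    proof -
      have "(\<integral>x. indicator A x * (E n x - Z x) \<partial>M) = (\<integral>x\<in>A. E n x \<partial>M) - (\<integral>x\<in>A. Z x \<partial>M)"
        unfolding set_lebesgue_integral_def
        using integrable_mult_indicator[OF AM E1[of n]] integrable_mult_indicator[OF AM Z1]
        by (subst Bochner_Integration.integral_diff[symmetric]) (auto simp: algebra_simps)
      then have "\<bar>(\<integral>x\<in>A. X x \<partial>M) - (\<integral>x\<in>A. Z x \<partial>M)\<bar> = \<bar>\<integral>x. indicator A x * (E n x - Z x) \<partial>M\<bar>"
        using \<open>(\<integral>x\<in>A. X x \<partial>M) = (\<integral>x\<in>A. E n x \<partial>M)\<close> by simp
      also have "\<dots> \<le> (\<integral>x. \<bar>indicator A x * (E n x - Z x)\<bar> \<partial>M)"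
        by (rule integral_abs_bound)
      also have "\<dots> \<le> (\<integral>x. \<bar>E n x - Z x\<bar> \<partial>M)"
        using E1[of n] Z1 integrable_mult_indicator[OF AM, of "\<lambda>x. E n x - Z x"]
        by (intro integral_mono) (auto simp: indicator_def)
      also have "\<dots> \<le> sqrt (expectation (\<lambda>x. (E n x - Z x)\<^sup>2))"
        by (rule abs_expectation_le_L2) (use fatou in auto)
      finally show ?thesis .
    qed
    have "(\<lambda>n. sqrt (expectation (\<lambda>x. (E n x - Z x)\<^sup>2))) \<longlonglongrightarrow> sqrt 0"
      by (intro tendsto_real_sqrt lim)
    then have "\<bar>(\<integral>x\<in>A. X x \<partial>M) - (\<integral>x\<in>A. Z x \<partial>M)\<bar> \<le> sqrt 0"
      using eq by (intro LIMSEQ_le_const) auto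
    then show "(\<integral>x\<in>A. X x \<partial>M) = (\<integral>x\<in>A. Z x \<partial>M)" by simp
  qed (use X1 Z1 ZT in auto)
  then have "expectation (\<lambda>x. (E n x - Z x)\<^sup>2) = expectation (\<lambda>x. (E n x - real_cond_exp M T X x)\<^sup>2)" for n
    by (intro integral_cong_AE) auto
  then show ?thesis using lim by (simp add: E_def)
qed

text \<open>Truncated variables are square-integrable, and conditional expectation is a contraction of \<open>L\<^sup>1\<close>, so the
truncation error is controlled uniformly in \<open>n\<close>.\<close>

lemma (in prob_space) backward_martingale_L1:
  assumes sub: "\<And>n. subalgebra M (F n)"
    and dec: "\<And>n. subalgebra (F n) (F (Suc n))"
    and T: "space T = space M" "sets T = (\<Inter>n. sets (F n))"
    and X: "integrable M X"
  shows "(\<lambda>n. expectation (\<lambda>x. \<bar>real_cond_exp M (F n) X x - real_cond_exp M T X x\<bar>)) \<longlonglongrightarrow> 0"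
proof -
  have Fs: "sigma_finite_subalgebra M (F n)" for n
    by (rule finite_measure_subalgebra_is_sigma_finite[OF finite_measure_subalgebraI[OF sub]])
  have Tsub: "subalgebra M T" using sub[of 0] T by (auto simp: subalgebra_def)
  interpret T: finite_measure_subalgebra M T by (rule finite_measure_subalgebraI[OF Tsub])
  have Xm [measurable]: "X \<in> borel_measurable M" using X by simp
  define XB where "XB B x = max (- real B) (min (real B) (X x))" for B :: nat and x
  have XBm [measurable]: "XB B \<in> borel_measurable M" for B unfolding XB_def by measurable
  have XBb: "\<bar>XB B x\<bar> \<le> real B" for B x unfolding XB_def by auto
  have XB1: "integrable M (XB B)" for B
    by (rule integrable_const_bound[of _ "real B"]) (auto simp: XBb)
  have XB2: "integrable M (\<lambda>x. (XB B x)\<^sup>2)" for B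
    by (rule integrable_const_bound[of _ "(real B)\<^sup>2"]) (auto intro!: AE_I2 simp: XBb abs_le_square_iff[symmetric])
  have tail: "(\<lambda>B. expectation (\<lambda>x. \<bar>X x - XB B x\<bar>)) \<longlonglongrightarrow> expectation (\<lambda>x. 0)"
  proof (rule integral_dominated_convergence[where w="\<lambda>x. 2 * \<bar>X x\<bar>"])
    show "AE x in M. (\<lambda>B. \<bar>X x - XB B x\<bar>) \<longlonglongrightarrow> 0"
    proof (rule AE_I2, rule tendsto_eventually)
      fix x
      show "\<forall>\<^sub>F B in sequentially. \<bar>X x - XB B x\<bar> = 0"
        using eventually_ge_at_top[of "nat \<lceil>\<bar>X x\<bar>\<rceil>"]
        by eventually_elim (auto simp: XB_def max_def min_def; linarith)
    qed
    show "AE x in M. norm \<bar>X x - XB B x\<bar> \<le> 2 * \<bar>X x\<bar>" for B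
      by (auto simp: XB_def max_def min_def)
  qed (use X in auto)
  show ?thesis
  proof (rule LIMSEQ_I)
    fix d :: real assume "d > 0"
    then have "\<forall>\<^sub>F B in sequentially. expectation (\<lambda>x. \<bar>X x - XB B x\<bar>) < d / 4"
      using tail by (intro order_tendstoD(2)) auto
    then obtain B where B: "expectation (\<lambda>x. \<bar>X x - XB B x\<bar>) < d / 4"
      using eventually_sequentially by auto
    define D where "D n x = real_cond_exp M (F n) (XB B) x - real_cond_exp M T (XB B) x" for n x
    have Dm [measurable]: "D n \<in> borel_measurable M" for n unfolding D_def by measurable
    have D2: "integrable M (\<lambda>x. (D n x)\<^sup>2)" for n
      unfolding D_def
      by (intro integrable_square_diff T.integrable_square_real_cond_exp XB2 XBm
          finite_measure_subalgebra.integrable_square_real_cond_exp[OF finite_measure_subalgebraI[OF sub]])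
         auto
    have "(\<lambda>n. expectation (\<lambda>x. (D n x)\<^sup>2)) \<longlonglongrightarrow> 0"
      unfolding D_def by (rule backward_martingale_L2[OF sub dec T XBm XB2])
    then have "\<forall>\<^sub>F n in sequentially. expectation (\<lambda>x. (D n x)\<^sup>2) < (d/2)\<^sup>2"
      using \<open>d > 0\<close> by (intro order_tendstoD(2)) auto
    then obtain N where N: "\<And>n. n \<ge> N \<Longrightarrow> expectation (\<lambda>x. (D n x)\<^sup>2) < (d/2)\<^sup>2"
      by (auto simp: eventually_sequentially)
    have split: "(\<integral>x. \<bar>real_cond_exp M G X x - real_cond_exp M G (XB B) x\<bar> \<partial>M) < d / 4"
      if G: "subalgebra M G" for G
    proof -
      interpret G: finite_measure_subalgebra M G by (rule finite_measure_subalgebraI[OF G])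
      have "(\<integral>x. \<bar>real_cond_exp M G X x - real_cond_exp M G (XB B) x\<bar> \<partial>M)
          = (\<integral>x. \<bar>real_cond_exp M G (\<lambda>x. X x - XB B x) x\<bar> \<partial>M)"
        using G.real_cond_exp_diff[OF X XB1[of B]] by (intro integral_cong_AE) auto
      also have "\<dots> \<le> (\<integral>x. \<bar>X x - XB B x\<bar> \<partial>M)"
        by (rule G.real_cond_exp_L1_contraction) (use X XB1 in auto)
      finally show ?thesis using B by simp
    qed
    have "expectation (\<lambda>x. \<bar>real_cond_exp M (F n) X x - real_cond_exp M T X x\<bar>) < d" if "n \<ge> N" for n
    proof -
      interpret Fn: finite_measure_subalgebra M "F n" by (rule finite_measure_subalgebraI[OF sub])
      note i = Fn.real_cond_exp_int(1)[OF X] T.real_cond_exp_int(1)[OF X]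
        Fn.real_cond_exp_int(1)[OF XB1[of B]] T.real_cond_exp_int(1)[OF XB1[of B]]
      have "expectation (\<lambda>x. \<bar>real_cond_exp M (F n) X x - real_cond_exp M T X x\<bar>)
          \<le> expectation (\<lambda>x. \<bar>real_cond_exp M (F n) X x - real_cond_exp M (F n) (XB B) x\<bar>
               + \<bar>D n x\<bar> + \<bar>real_cond_exp M T X x - real_cond_exp M T (XB B) x\<bar>)"
        using i by (intro integral_mono) (auto simp: D_def)
      also have "\<dots> = expectation (\<lambda>x. \<bar>real_cond_exp M (F n) X x - real_cond_exp M (F n) (XB B) x\<bar>)
               + expectation (\<lambda>x. \<bar>D n x\<bar>) + expectation (\<lambda>x. \<bar>real_cond_exp M T X x - real_cond_exp M T (XB B) x\<bar>)"
        using i by (simp add: D_def)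
      also have "expectation (\<lambda>x. \<bar>D n x\<bar>) < d / 2"
      proof -
        have "expectation (\<lambda>x. \<bar>D n x\<bar>) \<le> sqrt (expectation (\<lambda>x. (D n x)\<^sup>2))"
          by (rule abs_expectation_le_L2[OF Dm D2])
        also have "\<dots> < sqrt ((d/2)\<^sup>2)" using N[OF that] by (intro real_sqrt_less_mono)
        finally show ?thesis using \<open>d > 0\<close> by simp
      qed
      finally show ?thesis using split[OF sub[of n]] split[OF Tsub] by linarith
    qed
    then show "\<exists>N. \<forall>n\<ge>N. norm (expectation (\<lambda>x. \<bar>real_cond_exp M (F n) X x - real_cond_exp M T X x\<bar>) - 0) < d"
      by (intro exI[of _ N]) (auto simp: abs_less_iff intro: less_le_trans[OF _ integral_nonneg_AE])
  qed
qed

section \<open>A central limit theorem for backward martingales\<close>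

text \<open>The factor \<open>min 1 \<bar>x\<bar>\<close> combines the cubic Taylor remainder for small \<open>x\<close> with a quadratic bound for large
\<open>x\<close>, so that only second moments of \<open>x\<close> are ever required.\<close>

lemma cmod_iexp_taylor2:
  fixes t x :: real
  shows "cmod (iexp (t * x) - (1 + \<i> * (t * x) - (t * x)\<^sup>2 / 2)) \<le> t\<^sup>2 * (1 + \<bar>t\<bar>) * (x\<^sup>2 * min 1 \<bar>x\<bar>)"
proof -
  have s: "(\<Sum>k\<le>2. (\<i> * complex_of_real y) ^ k / fact k) = 1 + \<i> * y - y\<^sup>2 / 2" for y :: real
    by (simp add: numeral_2_eq_2 power_mult_distrib)
  have "cmod (iexp (t * x) - (1 + \<i> * (t * x) - (t * x)\<^sup>2 / 2)) \<le> \<bar>t * x\<bar> ^ 3"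
  proof -
    have "cmod (iexp (t * x) - (1 + \<i> * (t * x) - (t * x)\<^sup>2 / 2)) \<le> \<bar>t * x\<bar> ^ 3 / fact 3"
      using iexp_approx1[of "t * x" 2, unfolded s] by simp
    also have "\<dots> \<le> \<bar>t * x\<bar> ^ 3 / 1"
      by (intro divide_left_mono) auto
    finally show ?thesis by simp
  qed
  moreover have "cmod (iexp (t * x) - (1 + \<i> * (t * x) - (t * x)\<^sup>2 / 2)) \<le> (t * x)\<^sup>2"
    using iexp_approx2[of "t * x" 2] unfolding s by simp
  ultimately have "cmod (iexp (t * x) - (1 + \<i> * (t * x) - (t * x)\<^sup>2 / 2)) \<le> t\<^sup>2 * (x\<^sup>2 * min 1 (\<bar>t\<bar> * \<bar>x\<bar>))"
    by (simp add: min_def power_mult_distrib abs_mult power3_eq_cube power2_eq_square mult_ac)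
  also have "\<dots> \<le> t\<^sup>2 * (x\<^sup>2 * ((1 + \<bar>t\<bar>) * min 1 \<bar>x\<bar>))"
    by (intro mult_left_mono) (auto simp: min_def algebra_simps mult_left_le_one_le
        intro: order_trans[OF mult_left_mono[of 1 "\<bar>x\<bar>" "\<bar>t\<bar>"]])
  finally show ?thesis by (simp add: mult_ac)
qed

lemma abs_exp_minus_taylor1:
  fixes u :: real
  assumes "0 \<le> u"
  shows "\<bar>exp (- u) - 1 + u\<bar> \<le> u * min 1 u"
proof -
  have "exp (- u) \<le> 1 / (1 + u)"
    using exp_ge_add_one_self[of u] assms by (simp add: exp_minus field_simps)
  also have "\<dots> = 1 - u / (1 + u)" using assms by (simp add: field_simps)
  finally have "exp (- u) - 1 + u \<le> u - u / (1 + u)" by simp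
  also have "\<dots> \<le> u * u" using assms by (simp add: field_simps)
  finally have "exp (- u) - 1 + u \<le> u * u" .
  moreover have "exp (- u) - 1 + u \<le> u" using assms by simp
  moreover have "0 \<le> exp (- u) - 1 + u" using exp_ge_add_one_self[of "- u"] by simp
  ultimately show ?thesis by (auto simp: min_def)
qed

lemma (in finite_measure_subalgebra) complex_cond_exp_intg:
  fixes G :: "'a \<Rightarrow> complex" and W :: "'a \<Rightarrow> real"
  assumes G: "G \<in> borel_measurable F" and G1: "\<And>x. cmod (G x) \<le> 1" and W: "integrable M W"
  shows "(CLINT x|M. G x * of_real (W x)) = (CLINT x|M. G x * of_real (real_cond_exp M F W x))"
proof -
  have [measurable]: "G \<in> borel_measurable M" by (rule measurable_from_subalg[OF subalg G])
  have int: "integrable M (\<lambda>x. G x * of_real (V x))" if "integrable M V" for V :: "'a \<Rightarrow> real"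
    using that by (intro Bochner_Integration.integrable_bound[OF that])
      (auto simp: norm_mult intro!: AE_I2 mult_left_le_one_le G1)
  have "integrable M (\<lambda>x. Re (G x) * W x)" "integrable M (\<lambda>x. Im (G x) * W x)"
    using integrable_Re[OF int[OF W]] integrable_Im[OF int[OF W]] by auto
  moreover have "(\<lambda>x. Re (G x)) \<in> borel_measurable F" "(\<lambda>x. Im (G x)) \<in> borel_measurable F"
    using G by measurable
  ultimately have "(\<integral>x. Re (G x) * W x \<partial>M) = (\<integral>x. Re (G x) * real_cond_exp M F W x \<partial>M)"
    "(\<integral>x. Im (G x) * W x \<partial>M) = (\<integral>x. Im (G x) * real_cond_exp M F W x \<partial>M)"
    using W by (simp_all add: real_cond_exp_intg(2))
  then show ?thesis
    using integral_Re[OF int[OF W]] integral_Im[OF int[OF W]]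
      integral_Re[OF int[OF real_cond_exp_int(1)[OF W]]] integral_Im[OF int[OF real_cond_exp_int(1)[OF W]]]
    by (intro complex_eqI) auto
qed

text \<open>The three summands bound the Taylor remainder of the complex exponential, the coefficient of the variance
discrepancy, and the Taylor remainder of \<open>exp (- t\<^sup>2 q / 2)\<close>.\<close>

definition clt_const :: "real \<Rightarrow> real" where
  "clt_const t = t\<^sup>2 * (1 + \<bar>t\<bar>) + t\<^sup>2 / 2 + t\<^sup>2 / 2 * (1 + t\<^sup>2 / 2)"

lemma clt_const_nonneg: "0 \<le> clt_const t"
  by (auto simp: clt_const_def intro!: add_nonneg_nonneg mult_nonneg_nonneg)

text \<open>Expand \<open>exp (i t X)\<close> to second order and \<open>exp (- t\<^sup>2 q / 2)\<close> to first order in \<open>q\<close>. The constants agree, the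
term linear in \<open>X\<close> vanishes after conditioning, the quadratic term sees \<open>X\<^sup>2\<close> only through its conditional
expectation, and the two remainders are the first and the last summand of the bound.\<close>

lemma (in finite_measure_subalgebra) martingale_increment_char_bound:
  fixes G :: "'a \<Rightarrow> complex" and X q :: "'a \<Rightarrow> real"
  assumes G: "G \<in> borel_measurable F" and G1: "\<And>x. cmod (G x) \<le> 1"
    and X [measurable]: "X \<in> borel_measurable M" and X2: "integrable M (\<lambda>x. (X x)\<^sup>2)"
    and X0: "AE x in M. real_cond_exp M F X x = 0"
    and q: "q \<in> borel_measurable F" "\<And>x. 0 \<le> q x" "integrable M q"
  shows "cmod (CLINT x|M. G x * (iexp (t * X x) - exp (- (t\<^sup>2 / 2) * q x)))
     \<le> clt_const t * ((\<integral>x. (X x)\<^sup>2 * min 1 \<bar>X x\<bar> \<partial>M)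
          + (\<integral>x. \<bar>real_cond_exp M F (\<lambda>x. (X x)\<^sup>2) x - q x\<bar> \<partial>M) + (\<integral>x. q x * min 1 (q x) \<partial>M))"
proof -
  have Gm [measurable]: "G \<in> borel_measurable M" by (rule measurable_from_subalg[OF subalg G])
  have qm [measurable]: "q \<in> borel_measurable M" by (rule measurable_from_subalg[OF subalg q(1)])
  define s where "s = t\<^sup>2 / 2"
  have s0: "0 \<le> s" by (simp add: s_def)
  have X1: "integrable M X" by (rule square_integrable_imp_integrable[OF X X2])
  define L where "L x = (X x)\<^sup>2 * min 1 \<bar>X x\<bar>" for x
  define P where "P x = q x * min 1 (q x)" for x
  have [measurable]: "L \<in> borel_measurable M" "P \<in> borel_measurable M"
    unfolding L_def P_def by measurable
  have L: "integrable M L"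
    by (rule Bochner_Integration.integrable_bound[OF X2]) (auto simp: L_def intro!: mult_left_le)
  have P: "integrable M P"
    by (rule Bochner_Integration.integrable_bound[OF q(3)])
       (auto simp: P_def q(2) abs_mult intro!: mult_left_le)
  define R1 where "R1 x = iexp (t * X x) - (1 + \<i> * (t * X x) - (t * X x)\<^sup>2 / 2)" for x
  define R2 where "R2 x = exp (- s * q x) - 1 + s * q x" for x
  have [measurable]: "R1 \<in> borel_measurable M" "R2 \<in> borel_measurable M"
    unfolding R1_def R2_def by measurable
  have R1b: "cmod (R1 x) \<le> t\<^sup>2 * (1 + \<bar>t\<bar>) * L x" for x
    unfolding R1_def L_def by (rule cmod_iexp_taylor2)
  have R2b: "\<bar>R2 x\<bar> \<le> s * (1 + s) * P x" for x
  proof -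
    have "\<bar>R2 x\<bar> \<le> s * q x * min 1 (s * q x)"
      using abs_exp_minus_taylor1[of "s * q x"] s0 q(2)[of x] by (simp add: R2_def)
    also have "\<dots> \<le> s * q x * ((1 + s) * min 1 (q x))"
      using s0 q(2)[of x]
      by (intro mult_left_mono) (auto simp: min_def algebra_simps mult_left_le_one_le
        intro: order_trans[OF mult_left_mono[of 1 "q x" s]])
    finally show ?thesis by (simp add: P_def mult_ac)
  qed
  have gb: "integrable M (\<lambda>x. G x * f x)" "cmod (CLINT x|M. G x * f x) \<le> (\<integral>x. g x \<partial>M)"
    if "f \<in> borel_measurable M" "integrable M g" "\<And>x. cmod (f x) \<le> g x" for f :: "'a \<Rightarrow> complex" and g
  proof -
    note [measurable] = that(1)
    have b: "cmod (G x * f x) \<le> g x" for x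
      using mult_mono[OF G1[of x] that(3)[of x]] by (simp add: norm_mult)
    show i: "integrable M (\<lambda>x. G x * f x)"
      by (rule Bochner_Integration.integrable_bound[OF that(2)])
         (use b in \<open>auto intro: order_trans[OF _ abs_ge_self]\<close>)
    show "cmod (CLINT x|M. G x * f x) \<le> (\<integral>x. g x \<partial>M)"
      by (rule order_trans[OF integral_norm_bound integral_mono[OF integrable_norm[OF i] that(2) b]])
  qed
  define D where "D x = (X x)\<^sup>2 - q x" for x
  have D: "integrable M D" unfolding D_def using X2 q(3) by simp
  have [measurable]: "D \<in> borel_measurable M" using D by simp
  have D_eq: "AE x in M. real_cond_exp M F D x = real_cond_exp M F (\<lambda>x. (X x)\<^sup>2) x - q x"
    using real_cond_exp_diff[OF X2 q(3)] real_cond_exp_F_meas[OF q(3,1)] unfolding D_def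
    by eventually_elim auto
  have expansion: "iexp (t * X x) - exp (- s * q x) = R1 x + \<i> * t * X x - s * D x - R2 x" for x
    by (simp add: R1_def R2_def D_def s_def power_mult_distrib diff_divide_distrib algebra_simps exp_of_real[symmetric])
  have "(CLINT x|M. G x * (iexp (t * X x) - exp (- s * q x)))
     = (CLINT x|M. G x * R1 x + (\<i> * t) * (G x * X x) - s * (G x * D x) - G x * R2 x)"
    unfolding expansion by (intro Bochner_Integration.integral_cong) (auto simp: algebra_simps)
  also have "\<dots> = (CLINT x|M. G x * R1 x) + \<i> * t * (CLINT x|M. G x * X x) - s * (CLINT x|M. G x * D x)
       - (CLINT x|M. G x * R2 x)"
  proof -
    have i1: "integrable M (\<lambda>x. G x * R1 x)"
      by (rule gb(1)[OF _ integrable_mult_right[OF L] R1b]) simp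
    have i2: "integrable M (\<lambda>x. G x * of_real (X x))"
      by (rule gb(1)[of _ "\<lambda>x. \<bar>X x\<bar>"]) (use X1 in auto)
    have i3: "integrable M (\<lambda>x. G x * of_real (D x))"
      by (rule gb(1)[of _ "\<lambda>x. \<bar>D x\<bar>"]) (use D in auto)
    have i4: "integrable M (\<lambda>x. G x * of_real (R2 x))"
      by (rule gb(1)[OF _ integrable_mult_right[OF P]]) (use R2b in auto)
    show ?thesis using i1 i2 i3 i4 by simp
  qed
  also have "(CLINT x|M. G x * X x) = 0"
  proof -
    have "(CLINT x|M. G x * X x) = (CLINT x|M. G x * real_cond_exp M F X x)"
      by (rule complex_cond_exp_intg[OF G G1 X1])
    also have "\<dots> = (CLINT x|M. 0)"
      using X0 by (intro integral_cong_AE) auto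
    finally show ?thesis by simp
  qed
  finally have "cmod (CLINT x|M. G x * (iexp (t * X x) - exp (- s * q x)))
      \<le> cmod (CLINT x|M. G x * R1 x) + s * cmod (CLINT x|M. G x * D x) + cmod (CLINT x|M. G x * R2 x)"
    using s0 norm_triangle_ineq4[of "(CLINT x|M. G x * R1 x) - s * (CLINT x|M. G x * D x)" "CLINT x|M. G x * R2 x"]
      norm_triangle_ineq4[of "CLINT x|M. G x * R1 x" "s * (CLINT x|M. G x * D x)"]
    by (simp add: norm_mult)
  also have "\<dots> \<le> t\<^sup>2 * (1 + \<bar>t\<bar>) * (\<integral>x. L x \<partial>M)
      + s * (\<integral>x. \<bar>real_cond_exp M F (\<lambda>x. (X x)\<^sup>2) x - q x\<bar> \<partial>M) + s * (1 + s) * (\<integral>x. P x \<partial>M)"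
  proof (intro add_mono mult_left_mono s0)
    show "cmod (CLINT x|M. G x * R1 x) \<le> t\<^sup>2 * (1 + \<bar>t\<bar>) * (\<integral>x. L x \<partial>M)"
      using gb(2)[OF _ integrable_mult_right[OF L] R1b] by simp
    show "cmod (CLINT x|M. G x * R2 x) \<le> s * (1 + s) * (\<integral>x. P x \<partial>M)"
      using gb(2)[OF _ integrable_mult_right[OF P], of "\<lambda>x. of_real (R2 x)"] R2b by simp
    have "(CLINT x|M. G x * D x) = (CLINT x|M. G x * real_cond_exp M F D x)"
      by (rule complex_cond_exp_intg[OF G G1 D])
    also have "cmod \<dots> \<le> (\<integral>x. \<bar>real_cond_exp M F D x\<bar> \<partial>M)"
      by (rule gb(2)) (use real_cond_exp_int(1)[OF D] in auto)
    also have "\<dots> = (\<integral>x. \<bar>real_cond_exp M F (\<lambda>x. (X x)\<^sup>2) x - q x\<bar> \<partial>M)"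
      using D_eq by (intro integral_cong_AE) auto
    finally show "cmod (CLINT x|M. G x * D x) \<le> (\<integral>x. \<bar>real_cond_exp M F (\<lambda>x. (X x)\<^sup>2) x - q x\<bar> \<partial>M)" .
  qed
  also have "\<dots> \<le> clt_const t * (\<integral>x. L x \<partial>M)
      + clt_const t * (\<integral>x. \<bar>real_cond_exp M F (\<lambda>x. (X x)\<^sup>2) x - q x\<bar> \<partial>M) + clt_const t * (\<integral>x. P x \<partial>M)"
    by (intro add_mono mult_right_mono integral_nonneg_AE AE_I2)
       (auto simp: clt_const_def s_def L_def P_def q(2) intro!: add_nonneg_nonneg mult_nonneg_nonneg)
  finally show ?thesis by (simp add: s_def L_def P_def algebra_simps)
qed

text \<open>Errors of order \<open>N/J\<^sup>2\<close> at the steps \<open>J \<ge> N\<close> therefore add up to at most twice the largest coefficient.\<close>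

lemma sum_inverse_squares_tail_le:
  fixes N L :: nat
  assumes "1 \<le> N" "N \<le> L"
  shows "(\<Sum>J\<in>{N..<L}. 1 / (real J)\<^sup>2) \<le> 2 / real N - 2 / real L"
  using assms(2)
proof (induction rule: dec_induct)
  case (step L)
  then have "1 \<le> real L" using assms(1) by simp
  then have "1 / (real L)\<^sup>2 = 2 / (real L * (2 * real L))"
    by (simp add: power2_eq_square)
  also have "\<dots> \<le> 2 / (real L * (real L + 1))"
    using \<open>1 \<le> real L\<close> by (intro divide_left_mono mult_left_mono) auto
  also have "\<dots> = 2 / real L - 2 / real (Suc L)"
    using \<open>1 \<le> real L\<close> by (simp add: field_simps)
  finally have "1 / (real L)\<^sup>2 \<le> 2 / real L - 2 / real (Suc L)" .
  then show ?case using step by simp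
qed simp

text \<open>The quantity \<open>T N J\<close> of the proof interpolates between the characteristic function (\<open>J = N\<close>) and the
expectation of \<open>exp (- t\<^sup>2 N (Q\<^sub>N + Q\<^sub>N\<^sub>+\<^sub>1 + \<dots>) / 2)\<close> (\<open>J\<close> to infinity): the increments with index below \<open>J\<close> have
been replaced by Gaussian factors. One step changes it by the expectation of an \<open>F (Suc J)\<close>-measurable factor
of modulus at most 1 times \<open>exp (i t \<surd>N Z\<^sub>J) - exp (- t\<^sup>2 N Q\<^sub>J / 2)\<close>. Nonnegativity of \<open>Q\<close> keeps the factor
bounded, and measurability of \<open>Q\<close> for every \<open>F n\<close> makes it \<open>F (Suc J)\<close>-measurable.\<close>

theorem (in prob_space) backward_martingale_clt:
  fixes U :: "nat \<Rightarrow> 'a \<Rightarrow> real" and Uinf :: "'a \<Rightarrow> real" and Q S :: "nat \<Rightarrow> 'a \<Rightarrow> real" and V :: "'a \<Rightarrow> real"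
  assumes sub: "\<And>n. subalgebra M (F n)"
    and dec: "\<And>n. subalgebra (F n) (F (Suc n))"
    and U: "\<And>n. U n \<in> borel_measurable (F n)" and U2: "\<And>n. integrable M (\<lambda>x. (U n x)\<^sup>2)"
    and mart: "\<And>n. AE x in M. real_cond_exp M (F (Suc n)) (U n) x = U (Suc n) x"
    and Uinf: "\<And>n. Uinf \<in> borel_measurable (F n)" "integrable M Uinf"
    and Ulim: "(\<lambda>n. expectation (\<lambda>x. \<bar>U n x - Uinf x\<bar>)) \<longlonglongrightarrow> 0"
    and Q: "\<And>j n. Q j \<in> borel_measurable (F n)" "\<And>j x. 0 \<le> Q j x" "\<And>j. integrable M (Q j)"
    and cond_var: "(\<lambda>j. (real j)\<^sup>2 * expectation (\<lambda>x.
          \<bar>real_cond_exp M (F (Suc j)) (\<lambda>x. (U j x - U (Suc j) x)\<^sup>2) x - Q j x\<bar>)) \<longlonglongrightarrow> 0"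
    and lindeberg: "(\<lambda>j. (real j)\<^sup>2 * expectation (\<lambda>x.
          (U j x - U (Suc j) x)\<^sup>2 * min 1 (sqrt (real j) * \<bar>U j x - U (Suc j) x\<bar>))) \<longlonglongrightarrow> 0"
    and Qsmall: "(\<lambda>j. (real j)\<^sup>2 * expectation (\<lambda>x. Q j x * min 1 (real j * Q j x))) \<longlonglongrightarrow> 0"
    and S: "\<And>N x. 1 \<le> N \<Longrightarrow> x \<in> space M \<Longrightarrow> (\<lambda>L. \<Sum>j\<in>{N..<L}. Q j x) \<longlonglongrightarrow> S N x"
    and V: "\<And>x. x \<in> space M \<Longrightarrow> (\<lambda>N. real N * S N x) \<longlonglongrightarrow> V x"
    and Sm [measurable]: "\<And>N. S N \<in> borel_measurable M" and Vm [measurable]: "V \<in> borel_measurable M"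
  shows "(\<lambda>N. char (distr M borel (\<lambda>x. sqrt (real N) * (U N x - Uinf x))) t)
     \<longlonglongrightarrow> complex_of_real (expectation (\<lambda>x. exp (- (1 / 2) * t\<^sup>2 * V x)))"
proof -
  define s where "s = t\<^sup>2 / 2"
  have s0: "0 \<le> s" by (simp add: s_def)
  have Um [measurable]: "U n \<in> borel_measurable M" for n by (rule measurable_from_subalg[OF sub U])
  have Uim [measurable]: "Uinf \<in> borel_measurable M" by (rule measurable_from_subalg[OF sub[of 0] Uinf(1)])
  have Qm [measurable]: "Q j \<in> borel_measurable M" for j by (rule measurable_from_subalg[OF sub[of 0] Q(1)])
  have U1: "integrable M (U n)" for n by (rule square_integrable_imp_integrable[OF Um U2])
  define Z where "Z j x = U j x - U (Suc j) x" for j x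
  have Zm [measurable]: "Z j \<in> borel_measurable M" for j unfolding Z_def by measurable
  have Z2: "integrable M (\<lambda>x. (Z j x)\<^sup>2)" for j
    unfolding Z_def by (rule integrable_square_diff[OF Um Um U2 U2])
  have Z1: "integrable M (Z j)" for j by (rule square_integrable_imp_integrable[OF Zm Z2])
  define e where "e j = expectation (\<lambda>x. (Z j x)\<^sup>2 * min 1 (sqrt (real j) * \<bar>Z j x\<bar>))
     + expectation (\<lambda>x. \<bar>real_cond_exp M (F (Suc j)) (\<lambda>x. (Z j x)\<^sup>2) x - Q j x\<bar>)
     + expectation (\<lambda>x. Q j x * min 1 (real j * Q j x))" for j
  have e: "(\<lambda>j. (real j)\<^sup>2 * e j) \<longlonglongrightarrow> 0"
    using tendsto_add[OF tendsto_add[OF lindeberg cond_var] Qsmall]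
    by (simp add: e_def Z_def algebra_simps)
  define A where "A N J x = (\<Sum>j\<in>{N..<J}. Q j x)" for N J x
  have A0: "0 \<le> A N J x" for N J x unfolding A_def by (intro sum_nonneg Q(2))
  have AF: "A N J \<in> borel_measurable (F n)" for N J n unfolding A_def using Q(1) by measurable
  have [measurable]: "A N J \<in> borel_measurable M" for N J by (rule measurable_from_subalg[OF sub[of 0] AF])
  define W where "W N J x = sqrt (real N) * (U J x - Uinf x)" for N J x
  have [measurable]: "W N J \<in> borel_measurable M" for N J unfolding W_def by measurable
  define T where "T N J = (CLINT x|M. exp (- s * (real N * A N J x)) * iexp (t * W N J x))" for N J
  have expA: "norm (exp (- s * (real N * A N J x))) \<le> 1" for N J x
    using s0 A0[of N J x] by simp
  have step: "cmod (T N J - T N (Suc J)) \<le> clt_const t * (real N * e J)" if N: "1 \<le> N" "N \<le> J" for N J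
  proof -
    interpret F: finite_measure_subalgebra M "F (Suc J)" by (rule finite_measure_subalgebraI[OF sub])
    define G where "G x = exp (- s * (real N * A N J x)) * iexp (t * W N (Suc J) x)" for x
    have WF: "W N (Suc J) \<in> borel_measurable (F (Suc J))"
      unfolding W_def using U[of "Suc J"] Uinf(1)[of "Suc J"] by measurable
    have GF: "G \<in> borel_measurable (F (Suc J))"
      unfolding G_def using AF[of N J "Suc J"] WF by measurable
    have G1: "cmod (G x) \<le> 1" for x using expA[of N J x] by (simp add: G_def norm_mult)
    define X where "X x = sqrt (real N) * Z J x" for x
    define q where "q x = real N * Q J x" for x
    have [measurable]: "X \<in> borel_measurable M" "q \<in> borel_measurable M" unfolding X_def q_def by measurable
    have X2: "integrable M (\<lambda>x. (X x)\<^sup>2)" unfolding X_def using Z2[of J] by (simp add: power_mult_distrib)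
    have "AE x in M. real_cond_exp M (F (Suc J)) X x = sqrt (real N) * real_cond_exp M (F (Suc J)) (Z J) x"
      unfolding X_def by (rule F.real_cond_exp_cmult[OF Z1])
    moreover have "AE x in M. real_cond_exp M (F (Suc J)) (Z J) x
        = real_cond_exp M (F (Suc J)) (U J) x - real_cond_exp M (F (Suc J)) (U (Suc J)) x"
      unfolding Z_def by (rule F.real_cond_exp_diff[OF U1 U1])
    moreover have "AE x in M. real_cond_exp M (F (Suc J)) (U (Suc J)) x = U (Suc J) x"
      by (rule F.real_cond_exp_F_meas[OF U1 U])
    ultimately have X0: "AE x in M. real_cond_exp M (F (Suc J)) X x = 0"
      using mart[of J] by eventually_elim auto
    have bound: "cmod (CLINT x|M. G x * (iexp (t * X x) - exp (- (t\<^sup>2 / 2) * q x)))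
     \<le> clt_const t * ((\<integral>x. (X x)\<^sup>2 * min 1 \<bar>X x\<bar> \<partial>M)
          + (\<integral>x. \<bar>real_cond_exp M (F (Suc J)) (\<lambda>x. (X x)\<^sup>2) x - q x\<bar> \<partial>M) + (\<integral>x. q x * min 1 (q x) \<partial>M))"
      by (rule F.martingale_increment_char_bound[OF GF G1 _ X2 X0])
         (use Q N in \<open>auto simp: q_def\<close>)
    have "T N J - T N (Suc J) = (CLINT x|M. G x * (iexp (t * X x) - exp (- (t\<^sup>2 / 2) * q x)))"
    proof -
      have i: "integrable M (\<lambda>x. exp (- s * (real N * A N J x)) * iexp (t * W N J x))" for J
        by (rule integrable_const_bound[of _ 1]) (use expA in \<open>auto simp: norm_mult\<close>)
      have "A N (Suc J) x = A N J x + Q J x" "W N J x = W N (Suc J) x + X x" for x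
        using N by (auto simp: A_def W_def X_def Z_def algebra_simps)
      then show ?thesis
        unfolding T_def
        by (subst Bochner_Integration.integral_diff[OF i i, symmetric], intro Bochner_Integration.integral_cong)
           (auto simp: G_def q_def s_def algebra_simps exp_add[symmetric] exp_of_real[symmetric])
    qed
    also note bound
    also have "(\<integral>x. (X x)\<^sup>2 * min 1 \<bar>X x\<bar> \<partial>M)
          + (\<integral>x. \<bar>real_cond_exp M (F (Suc J)) (\<lambda>x. (X x)\<^sup>2) x - q x\<bar> \<partial>M) + (\<integral>x. q x * min 1 (q x) \<partial>M)
        \<le> real N * e J"
    proof -
      \<comment> \<open>The scale \<open>\<surd>N\<close> of the sum may be replaced by \<open>\<surd>J\<close>, since \<open>N \<le> J\<close>; this frees the bound from \<open>N\<close>.\<close>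
      have "(\<integral>x. (X x)\<^sup>2 * min 1 \<bar>X x\<bar> \<partial>M) \<le> (\<integral>x. real N * ((Z J x)\<^sup>2 * min 1 (sqrt (real J) * \<bar>Z J x\<bar>)) \<partial>M)"
      proof (rule integral_mono)
        show "integrable M (\<lambda>x. (X x)\<^sup>2 * min 1 \<bar>X x\<bar>)"
          by (rule Bochner_Integration.integrable_bound[OF X2]) (auto intro!: mult_left_le)
        show "integrable M (\<lambda>x. real N * ((Z J x)\<^sup>2 * min 1 (sqrt (real J) * \<bar>Z J x\<bar>)))"
          by (rule integrable_mult_right, rule Bochner_Integration.integrable_bound[OF Z2[of J]])
             (auto intro!: mult_left_le simp: abs_mult)
        show "(X x)\<^sup>2 * min 1 \<bar>X x\<bar> \<le> real N * ((Z J x)\<^sup>2 * min 1 (sqrt (real J) * \<bar>Z J x\<bar>))" for x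
        proof -
          have "min 1 \<bar>X x\<bar> \<le> min 1 (sqrt (real J) * \<bar>Z J x\<bar>)"
            using N by (intro min.mono) (auto simp: X_def abs_mult intro!: mult_right_mono)
          then have "(X x)\<^sup>2 * min 1 \<bar>X x\<bar> \<le> (X x)\<^sup>2 * min 1 (sqrt (real J) * \<bar>Z J x\<bar>)"
            by (intro mult_left_mono) auto
          then show ?thesis by (simp add: X_def power_mult_distrib mult.assoc)
        qed
      qed
      moreover have "(\<integral>x. \<bar>real_cond_exp M (F (Suc J)) (\<lambda>x. (X x)\<^sup>2) x - q x\<bar> \<partial>M)
          = (\<integral>x. real N * \<bar>real_cond_exp M (F (Suc J)) (\<lambda>x. (Z J x)\<^sup>2) x - Q J x\<bar> \<partial>M)"
      proof (rule integral_cong_AE)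
        have "AE x in M. real_cond_exp M (F (Suc J)) (\<lambda>x. real N * (Z J x)\<^sup>2) x
            = real N * real_cond_exp M (F (Suc J)) (\<lambda>x. (Z J x)\<^sup>2) x"
          by (rule F.real_cond_exp_cmult[OF Z2])
        then show "AE x in M. \<bar>real_cond_exp M (F (Suc J)) (\<lambda>x. (X x)\<^sup>2) x - q x\<bar>
            = real N * \<bar>real_cond_exp M (F (Suc J)) (\<lambda>x. (Z J x)\<^sup>2) x - Q J x\<bar>"
          by eventually_elim (simp add: X_def q_def power_mult_distrib right_diff_distrib[symmetric] abs_mult)
      qed auto
      moreover have "(\<integral>x. q x * min 1 (q x) \<partial>M) \<le> (\<integral>x. real N * (Q J x * min 1 (real J * Q J x)) \<partial>M)"
      proof (rule integral_mono)
        have iq: "integrable M q" unfolding q_def using Q(3) by simp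
        show "integrable M (\<lambda>x. q x * min 1 (q x))"
          by (rule Bochner_Integration.integrable_bound[OF iq])
             (auto simp: q_def Q(2) abs_mult intro!: mult_left_le)
        show "integrable M (\<lambda>x. real N * (Q J x * min 1 (real J * Q J x)))"
          by (rule integrable_mult_right, rule Bochner_Integration.integrable_bound[OF Q(3)[of J]])
             (auto simp: Q(2) abs_mult intro!: mult_left_le)
        show "q x * min 1 (q x) \<le> real N * (Q J x * min 1 (real J * Q J x))" for x
          unfolding q_def mult.assoc using N Q(2)[of J x]
          by (intro mult_left_mono min.mono mult_right_mono) auto
      qed
      ultimately show ?thesis by (simp add: e_def algebra_simps)
    qed
    finally show ?thesis by (simp add: mult_left_mono clt_const_nonneg)
  qed
  have e0: "0 \<le> e j" for j
    unfolding e_def by (intro add_nonneg_nonneg integral_nonneg_AE AE_I2) (auto simp: Q(2))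
  have tele: "cmod (T N N - T N L) \<le> 2 * clt_const t * d"
    if d: "0 \<le> d" "\<And>j. j \<ge> N \<Longrightarrow> (real j)\<^sup>2 * e j \<le> d" and N: "1 \<le> N" "N \<le> L" for N L d
  proof -
    have "cmod (T N N - T N L) \<le> (\<Sum>J\<in>{N..<L}. cmod (T N J - T N (Suc J)))"
      using N(2)
    proof (induction rule: dec_induct)
      case (step L)
      then show ?case using norm_triangle_ineq[of "T N N - T N L" "T N L - T N (Suc L)"] by simp
    qed simp
    also have "\<dots> \<le> (\<Sum>J\<in>{N..<L}. clt_const t * real N * d * (1 / (real J)\<^sup>2))"
    proof (rule sum_mono)
      fix J assume J: "J \<in> {N..<L}"
      then have "e J \<le> d * (1 / (real J)\<^sup>2)" using d(2)[of J] N by (simp add: field_simps)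
      then have "clt_const t * real N * e J \<le> clt_const t * real N * (d * (1 / (real J)\<^sup>2))"
        by (intro mult_left_mono) (auto simp: clt_const_nonneg)
      then show "cmod (T N J - T N (Suc J)) \<le> clt_const t * real N * d * (1 / (real J)\<^sup>2)"
        using step[of N J] J N by (simp add: mult.assoc)
    qed
    also have "\<dots> = clt_const t * real N * d * (\<Sum>J\<in>{N..<L}. 1 / (real J)\<^sup>2)"
      by (simp add: sum_distrib_left)
    also have "\<dots> \<le> clt_const t * real N * d * (2 / real N)"
    proof (intro mult_left_mono mult_nonneg_nonneg clt_const_nonneg d(1))
      show "(\<Sum>J\<in>{N..<L}. 1 / (real J)\<^sup>2) \<le> 2 / real N"
        using sum_inverse_squares_tail_le[OF N] by (rule order_trans) simp
    qed simp
    also have "\<dots> = 2 * clt_const t * d" using N by simp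
    finally show ?thesis .
  qed
  define B where "B N = expectation (\<lambda>x. exp (- s * (real N * S N x)))" for N
  have SF0: "0 \<le> S N x" if "1 \<le> N" "x \<in> space M" for N x
    using A0[of N _ x] unfolding A_def by (intro LIMSEQ_le_const[OF S[OF that]]) auto
  have Tlim: "T N \<longlonglongrightarrow> complex_of_real (B N)" if N: "1 \<le> N" for N
  proof -
    have "(\<lambda>L. expectation (\<lambda>x. exp (- s * (real N * A N L x)))) \<longlonglongrightarrow> B N"
      unfolding B_def
    proof (rule integral_dominated_convergence[where w="\<lambda>_. 1"])
      show "AE x in M. (\<lambda>L. exp (- s * (real N * A N L x))) \<longlonglongrightarrow> exp (- s * (real N * S N x))"
        using S[OF N] unfolding A_def by (intro AE_I2 tendsto_intros) auto
    qed (use expA in auto)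
    then have 1: "(\<lambda>L. complex_of_real (expectation (\<lambda>x. exp (- s * (real N * A N L x))))) \<longlonglongrightarrow> B N"
      by (rule tendsto_of_real)
    have "(\<lambda>L. T N L - complex_of_real (expectation (\<lambda>x. exp (- s * (real N * A N L x))))) \<longlonglongrightarrow> 0"
    proof (rule Lim_null_comparison)
      show "(\<lambda>L. (\<bar>t\<bar> * sqrt (real N)) * expectation (\<lambda>x. \<bar>U L x - Uinf x\<bar>)) \<longlonglongrightarrow> 0"
        using tendsto_mult_right_zero[OF Ulim] .
      have "cmod (T N L - complex_of_real (expectation (\<lambda>x. exp (- s * (real N * A N L x)))))
          \<le> (\<bar>t\<bar> * sqrt (real N)) * expectation (\<lambda>x. \<bar>U L x - Uinf x\<bar>)" for L
      proof -
        have i: "integrable M (\<lambda>x. exp (- s * (real N * A N L x)) * iexp (t * W N L x))"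
          by (rule integrable_const_bound[of _ 1]) (use expA in \<open>auto simp: norm_mult\<close>)
        have i': "integrable M (\<lambda>x. complex_of_real (exp (- s * (real N * A N L x))))"
          by (rule integrable_const_bound[of _ 1]) (use expA in \<open>auto simp: norm_mult\<close>)
        have "T N L - complex_of_real (expectation (\<lambda>x. exp (- s * (real N * A N L x))))
           = (CLINT x|M. exp (- s * (real N * A N L x)) * iexp (t * W N L x) - exp (- s * (real N * A N L x)))"
          unfolding T_def using i i' by simp
        also have "cmod \<dots> \<le> expectation (\<lambda>x. cmod (exp (- s * (real N * A N L x)) * iexp (t * W N L x) - exp (- s * (real N * A N L x))))"
          by (rule integral_norm_bound)
        also have "\<dots> \<le> expectation (\<lambda>x. (\<bar>t\<bar> * sqrt (real N)) * \<bar>U L x - Uinf x\<bar>)"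
        proof (rule integral_mono)
          show "integrable M (\<lambda>x. cmod (exp (- s * (real N * A N L x)) * iexp (t * W N L x) - exp (- s * (real N * A N L x))))"
            by (intro integrable_norm Bochner_Integration.integrable_diff i i')
          show "integrable M (\<lambda>x. (\<bar>t\<bar> * sqrt (real N)) * \<bar>U L x - Uinf x\<bar>)"
            using U1[of L] Uinf(2) by simp
          fix x
          have "exp (- s * (real N * A N L x)) * iexp (t * W N L x) - exp (- s * (real N * A N L x))
             = exp (- s * (real N * A N L x)) * (iexp (t * W N L x) - 1)"
            by (simp add: algebra_simps)
          also have "cmod \<dots> \<le> 1 * \<bar>t * W N L x\<bar>"
            unfolding norm_mult using iexp_approx1[of "t * W N L x" 0] expA[of N L x]
            by (intro mult_mono) auto
          finally show "cmod (exp (- s * (real N * A N L x)) * iexp (t * W N L x) - exp (- s * (real N * A N L x)))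
              \<le> (\<bar>t\<bar> * sqrt (real N)) * \<bar>U L x - Uinf x\<bar>"
            by (simp add: W_def abs_mult mult.assoc)
        qed
        finally show ?thesis by simp
      qed
      then show "\<forall>\<^sub>F L in sequentially. cmod (T N L - complex_of_real (expectation (\<lambda>x. exp (- s * (real N * A N L x)))))
          \<le> (\<bar>t\<bar> * sqrt (real N)) * expectation (\<lambda>x. \<bar>U L x - Uinf x\<bar>)" by simp
    qed
    from tendsto_add[OF this 1] show ?thesis by simp
  qed
  have Blim: "B \<longlonglongrightarrow> expectation (\<lambda>x. exp (- s * V x))"
    unfolding B_def[abs_def]
  proof (rule LIMSEQ_offset[of _ 1], rule integral_dominated_convergence[where w="\<lambda>_. 1"])
    show "AE x in M. (\<lambda>N. exp (- s * (real (N + 1) * S (N + 1) x))) \<longlonglongrightarrow> exp (- s * V x)"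
      using LIMSEQ_ignore_initial_segment[OF V, of _ 1] by (intro AE_I2 tendsto_intros) auto
    show "AE x in M. norm (exp (- s * (real (N + 1) * S (N + 1) x))) \<le> 1" for N
      using SF0[of "N + 1"] s0 by (intro AE_I2) auto
  qed auto
  have "(\<lambda>N. T N N - complex_of_real (B N)) \<longlonglongrightarrow> 0"
  proof (rule LIMSEQ_I)
    fix r :: real assume "r > 0"
    define k where "k = 2 * clt_const t + 1"
    define d where "d = r / (2 * k)"
    have k: "k > 0" "2 * clt_const t \<le> k" using clt_const_nonneg[of t] by (simp_all add: k_def)
    then have d: "d > 0" using \<open>r > 0\<close> by (simp add: d_def)
    have "2 * clt_const t * d \<le> k * d" using d k by (intro mult_right_mono) auto
    also have "\<dots> = r / 2" using k(1) by (simp add: d_def field_simps)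
    finally have dr: "2 * clt_const t * d \<le> r / 2" .
    have "\<forall>\<^sub>F j in sequentially. (real j)\<^sup>2 * e j < d"
      using e d by (intro order_tendstoD(2)) auto
    then obtain N0 where N0: "\<And>j. j \<ge> N0 \<Longrightarrow> (real j)\<^sup>2 * e j < d"
      by (auto simp: eventually_sequentially)
    have "norm (T N N - complex_of_real (B N) - 0) < r" if N: "N \<ge> max 1 N0" for N
    proof -
      have "(\<lambda>L. cmod (T N N - T N L)) \<longlonglongrightarrow> cmod (T N N - complex_of_real (B N))"
        using Tlim[of N] N by (intro tendsto_intros) auto
      moreover have "cmod (T N N - T N L) \<le> 2 * clt_const t * d" if "L \<ge> N" for L
      proof (rule tele)
        show "(real j)\<^sup>2 * e j \<le> d" if "j \<ge> N" for j
          by (rule less_imp_le[OF N0]) (use N that in auto)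
      qed (use d N that in auto)
      ultimately have "cmod (T N N - complex_of_real (B N)) \<le> 2 * clt_const t * d"
        by (intro LIMSEQ_le_const2) auto
      then show ?thesis using dr \<open>r > 0\<close> by simp
    qed
    then show "\<exists>N0. \<forall>N\<ge>N0. norm (T N N - complex_of_real (B N) - 0) < r" by blast
  qed
  from tendsto_add[OF this tendsto_of_real[OF Blim]]
  have "(\<lambda>N. T N N) \<longlonglongrightarrow> complex_of_real (expectation (\<lambda>x. exp (- s * V x)))" by simp
  moreover have "T N N = char (distr M borel (\<lambda>x. sqrt (real N) * (U N x - Uinf x))) t" for N
    unfolding T_def char_def by (subst integral_distr) (auto simp: A_def W_def)
  ultimately show ?thesis by (simp add: s_def)
qed

section \<open>Invariance of conditional laws under permutations\<close>

abbreviation matrix_space :: "(nat \<times> nat \<Rightarrow> real) measure" where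
  "matrix_space \<equiv> \<Pi>\<^sub>M p\<in>{1..} \<times> {1..}. borel"

definition matrix_of :: "'a random_matrix \<Rightarrow> 'a \<Rightarrow> nat \<times> nat \<Rightarrow> real" where
  "matrix_of Y x = (\<lambda>(i, j)\<in>{1..} \<times> {1..}. Y i j x)"

definition permute_matrix :: "(nat \<Rightarrow> nat) \<Rightarrow> (nat \<Rightarrow> nat) \<Rightarrow> (nat \<times> nat \<Rightarrow> real) \<Rightarrow> nat \<times> nat \<Rightarrow> real" where
  "permute_matrix \<sigma>1 \<sigma>2 y = (\<lambda>(i, j)\<in>{1..} \<times> {1..}. y (\<sigma>1 i, \<sigma>2 j))"

text \<open>The coordinate functions form the canonical random matrix on the space of matrices: a statistic of a
fixed matrix \<open>y\<close> is the same statistic of \<open>entry\<close> at the point \<open>y\<close>.\<close>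

definition entry :: "nat \<Rightarrow> nat \<Rightarrow> (nat \<times> nat \<Rightarrow> real) \<Rightarrow> real" where
  "entry i j y = y (i, j)"

text \<open>Averages over ordered pairs of distinct indices are visibly invariant under permutations, whereas
increasing pairs would have to be sorted again.\<close>

definition ordered_pairs :: "nat \<Rightarrow> (nat \<times> nat) set" where
  "ordered_pairs n = (SIGMA a:{1..n}. {1..n} - {a})"

lemma finite_ordered_pairs [simp]: "finite (ordered_pairs n)"
  by (simp add: ordered_pairs_def)

lemma card_ordered_pairs: "card (ordered_pairs n) = n * (n - 1)"
  by (simp add: ordered_pairs_def card_SigmaI)

lemma real_card_ordered_pairs: "real (card (ordered_pairs n)) = real n * (real n - 1)"
  by (cases n) (simp_all add: card_ordered_pairs algebra_simps)

lemma real_choose_2: "real (n choose 2) = real n * (real n - 1) / 2"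
proof (induction n)
  case (Suc n)
  have "real (Suc n choose 2) = real n + real (n choose 2)"
    by (simp add: numeral_2_eq_2)
  then show ?case using Suc by (simp add: field_simps)
qed (simp add: numeral_2_eq_2)

lemma sum_ordered_pairs_symmetric:
  fixes f :: "nat \<Rightarrow> nat \<Rightarrow> real"
  assumes "\<And>a b. f a b = f b a"
  shows "(\<Sum>(a, b)\<in>ordered_pairs n. f a b) = 2 * (\<Sum>(a, b)\<in>{(a, b). 1 \<le> a \<and> a < b \<and> b \<le> n}. f a b)"
proof -
  let ?L = "{(a, b). 1 \<le> a \<and> a < b \<and> b \<le> n}" and ?G = "{(a, b). 1 \<le> b \<and> b < a \<and> a \<le> n}"
  have fin: "finite ?L" "finite ?G"
    by (rule finite_subset[of _ "{1..n} \<times> {1..n}"]; auto)+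
  have "ordered_pairs n = ?L \<union> ?G" by (auto simp: ordered_pairs_def)
  moreover have "?L \<inter> ?G = {}" by auto
  moreover have "(\<Sum>(a, b)\<in>?G. f a b) = (\<Sum>(a, b)\<in>?L. f a b)"
    by (rule sum.reindex_bij_witness[of _ prod.swap prod.swap]) (use assms in auto)
  ultimately show ?thesis using fin by (simp add: sum.union_disjoint)
qed

lemma sum_ordered_pairs_permute:
  fixes f :: "nat \<Rightarrow> nat \<Rightarrow> real"
  assumes "\<sigma> permutes {1..n}"
  shows "(\<Sum>(a, b)\<in>ordered_pairs n. f (\<sigma> a) (\<sigma> b)) = (\<Sum>(a, b)\<in>ordered_pairs n. f a b)"
proof (rule sum.reindex_bij_witness[of _ "map_prod (inv \<sigma>) (inv \<sigma>)" "map_prod \<sigma> \<sigma>"])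
  have i: "inv \<sigma> permutes {1..n}" by (rule permutes_inv[OF assms])
  fix p assume p: "p \<in> ordered_pairs n"
  show "map_prod (inv \<sigma>) (inv \<sigma>) (map_prod \<sigma> \<sigma> p) = p" "map_prod \<sigma> \<sigma> (map_prod (inv \<sigma>) (inv \<sigma>) p) = p"
    by (cases p; simp add: permutes_inverses[OF assms])+
  show "map_prod \<sigma> \<sigma> p \<in> ordered_pairs n"
    using p permutes_in_image[OF assms] permutes_inj[OF assms]
    by (cases p) (auto simp: ordered_pairs_def inj_eq simp del: atLeastAtMost_iff)
  show "map_prod (inv \<sigma>) (inv \<sigma>) p \<in> ordered_pairs n"
    using p permutes_in_image[OF i] permutes_inj[OF i]
    by (cases p) (auto simp: ordered_pairs_def inj_eq simp del: atLeastAtMost_iff)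
qed auto

text \<open>The complements of \<open>A\<close> and of its image in \<open>S\<close> have the same size, so any bijection between them completes
\<open>f\<close> to a permutation.\<close>

lemma exists_permutation_extending:
  assumes "finite S" "inj_on f A" "A \<subseteq> S" "f ` A \<subseteq> S"
  shows "\<exists>\<sigma>. \<sigma> permutes S \<and> (\<forall>a\<in>A. \<sigma> a = f a)"
proof -
  have "card (S - A) = card (S - f ` A)"
    using assms by (simp add: card_Diff_subset finite_subset card_image)
  then obtain g where g: "bij_betw g (S - A) (S - f ` A)"
    using assms(1) finite_same_card_bij[of "S - A" "S - f ` A"] by auto
  define \<sigma> where "\<sigma> x = (if x \<in> A then f x else if x \<in> S then g x else x)" for x
  have "bij_betw \<sigma> A (f ` A)"
    using assms(2) by (subst bij_betw_cong[of A \<sigma> f]) (auto simp: \<sigma>_def bij_betw_def)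
  moreover have "bij_betw \<sigma> (S - A) (S - f ` A)"
    using g by (subst bij_betw_cong[of "S - A" \<sigma> g]) (auto simp: \<sigma>_def)
  ultimately have "bij_betw \<sigma> (A \<union> (S - A)) (f ` A \<union> (S - f ` A))"
    by (rule bij_betw_combine) auto
  moreover have "A \<union> (S - A) = S" "f ` A \<union> (S - f ` A) = S" using assms by auto
  ultimately have "bij_betw \<sigma> S S" by simp
  then have "\<sigma> permutes S" by (rule bij_imp_permutes) (use assms(3) in \<open>auto simp: \<sigma>_def\<close>)
  then show ?thesis by (intro exI[of _ \<sigma>]) (auto simp: \<sigma>_def)
qed

lemma exists_permutation_of_list:
  assumes "distinct xs" "set xs \<subseteq> {1..n::nat}"
  shows "\<exists>\<sigma>. \<sigma> permutes {1..n} \<and> (\<forall>k\<in>{1..length xs}. \<sigma> k = xs ! (k - 1))"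
proof (rule exists_permutation_extending)
  have "length xs = card (set xs)" using assms(1) by (simp add: distinct_card)
  also have "\<dots> \<le> card {1..n}" by (rule card_mono) (use assms(2) in auto)
  finally show "{1..length xs} \<subseteq> {1..n}" by auto
  show "inj_on (\<lambda>k. xs ! (k - 1)) {1..length xs}"
    using assms(1) by (auto simp: inj_on_def nth_eq_iff_index_eq)
  have "xs ! (k - 1) \<in> set xs" if "k \<in> {1..length xs}" for k
    using that by (intro nth_mem) auto
  then show "(\<lambda>k. xs ! (k - 1)) ` {1..length xs} \<subseteq> {1..n}" using assms(2) by blast
qed simp

lemma permutes_ge_1:
  assumes "\<sigma> permutes {1..n::nat}" "1 \<le> i"
  shows "1 \<le> \<sigma> i"
  using assms permutes_in_image[OF assms(1), of i] permutes_not_in[OF assms(1), of i]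
  by (cases "i \<in> {1..n}") auto

lemma matrix_of_permute:
  assumes "\<sigma>1 permutes {1..m}" "\<sigma>2 permutes {1..n}"
  shows "matrix_of (\<lambda>i j. Y (\<sigma>1 i) (\<sigma>2 j)) x = permute_matrix \<sigma>1 \<sigma>2 (matrix_of Y x)"
  by (auto simp: matrix_of_def permute_matrix_def fun_eq_iff permutes_ge_1[OF assms(1), simplified]
      permutes_ge_1[OF assms(2), simplified])

lemma matrix_of_entry:
  assumes "y \<in> space matrix_space"
  shows "matrix_of entry y = y"
  using assms by (auto simp: matrix_of_def entry_def fun_eq_iff space_PiM PiE_def extensional_def restrict_def)

lemma entry_measurable [measurable]:
  "1 \<le> i \<Longrightarrow> 1 \<le> j \<Longrightarrow> entry i j \<in> borel_measurable matrix_space"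
  unfolding entry_def[abs_def] by (rule measurable_component_singleton) simp

lemma matrix_of_measurable:
  assumes "\<And>i j. 1 \<le> i \<Longrightarrow> 1 \<le> j \<Longrightarrow> Y i j \<in> borel_measurable M"
  shows "matrix_of Y \<in> measurable M matrix_space"
  unfolding matrix_of_def by (rule measurable_restrict) (use assms in auto)

lemma quadruplet_measurable:
  assumes "\<And>i j. i \<in> {i1, i2} \<Longrightarrow> j \<in> {j1, j2} \<Longrightarrow> Y i j \<in> borel_measurable M"
  shows "quadruplet Y i1 i2 j1 j2 \<in> borel_measurable M"
proof (subst borel_measurable_euclidean_space, rule ballI)
  fix b :: "real^2^2" assume "b \<in> Basis"
  then obtain i j where b: "b = axis i (axis j 1)"
    by (auto simp: Basis_vec_def)
  have "(\<lambda>x. quadruplet Y i1 i2 j1 j2 x \<bullet> b) = (\<lambda>x. quadruplet Y i1 i2 j1 j2 x $ i $ j)"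
    by (simp add: b inner_axis)
  moreover have "\<forall>i j. (\<lambda>x. quadruplet Y i1 i2 j1 j2 x $ i $ j) \<in> borel_measurable M"
    unfolding forall_2 quadruplet_def using assms by simp
  ultimately show "(\<lambda>x. quadruplet Y i1 i2 j1 j2 x \<bullet> b) \<in> borel_measurable M" by simp
qed

lemma quadruplet_matrix_of:
  assumes "1 \<le> i1" "1 \<le> i2" "1 \<le> j1" "1 \<le> j2"
  shows "quadruplet entry i1 i2 j1 j2 (matrix_of Y x) = quadruplet Y i1 i2 j1 j2 x"
  using assms by (simp add: quadruplet_def entry_def matrix_of_def)

lemma quadruplet_kernel_swap_rows:
  assumes "quadruplet_kernel h"
  shows "h (quadruplet Y i2 i1 j1 j2 x) = h (quadruplet Y i1 i2 j1 j2 x)"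
proof -
  have "quadruplet Y i2 i1 j1 j2 x = vector [quadruplet Y i1 i2 j1 j2 x $ 2, quadruplet Y i1 i2 j1 j2 x $ 1]"
    by (simp add: quadruplet_def)
  then show ?thesis using assms by (simp add: quadruplet_kernel_def)
qed

lemma quadruplet_kernel_swap_cols:
  assumes "quadruplet_kernel h"
  shows "h (quadruplet Y i1 i2 j2 j1 x) = h (quadruplet Y i1 i2 j1 j2 x)"
proof -
  have "quadruplet Y i1 i2 j2 j1 x
      = (\<chi> i. vector [quadruplet Y i1 i2 j1 j2 x $ i $ 2, quadruplet Y i1 i2 j1 j2 x $ i $ 1])"
    by (simp add: quadruplet_def vec_eq_iff forall_2)
  then show ?thesis using assms by (simp add: quadruplet_kernel_def)
qed

text \<open>By the two symmetries of the kernel each quadruplet of increasing pairs is counted four times.\<close>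

lemma U_stat_eq_ordered_mean:
  assumes "quadruplet_kernel h"
  shows "U_stat h Y m n x =
     (\<Sum>(i1, i2)\<in>ordered_pairs m. \<Sum>(j1, j2)\<in>ordered_pairs n. h (quadruplet Y i1 i2 j1 j2 x)) /
     (real (card (ordered_pairs m)) * real (card (ordered_pairs n)))"
proof -
  let ?L = "\<lambda>n. {(a::nat, b). 1 \<le> a \<and> a < b \<and> b \<le> n}"
  have fin: "finite (?L n)" for n by (rule finite_subset[of _ "{1..n} \<times> {1..n}"]) auto
  have "(\<Sum>(i1, i2)\<in>ordered_pairs m. \<Sum>(j1, j2)\<in>ordered_pairs n. h (quadruplet Y i1 i2 j1 j2 x))
      = 2 * (\<Sum>(i1, i2)\<in>?L m. \<Sum>(j1, j2)\<in>ordered_pairs n. h (quadruplet Y i1 i2 j1 j2 x))"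
    by (rule sum_ordered_pairs_symmetric) (simp add: quadruplet_kernel_swap_rows[OF assms])
  also have "\<dots> = 2 * (\<Sum>(i1, i2)\<in>?L m. 2 * (\<Sum>(j1, j2)\<in>?L n. h (quadruplet Y i1 i2 j1 j2 x)))"
    by (intro arg_cong[where f="\<lambda>x. 2 * x"] sum.cong refl, clarify, rule sum_ordered_pairs_symmetric)
       (simp add: quadruplet_kernel_swap_cols[OF assms])
  also have "\<dots> = 4 * (\<Sum>(i1, i2)\<in>?L m. \<Sum>(j1, j2)\<in>?L n. h (quadruplet Y i1 i2 j1 j2 x))"
    by (simp add: sum_distrib_left case_prod_beta)
  also have "(\<Sum>(i1, i2)\<in>?L m. \<Sum>(j1, j2)\<in>?L n. h (quadruplet Y i1 i2 j1 j2 x))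
      = (\<Sum>(p, q)\<in>?L m \<times> ?L n. h (quadruplet Y (fst p) (snd p) (fst q) (snd q) x))"
    by (simp add: sum.cartesian_product case_prod_beta)
  also have "\<dots> = (\<Sum>(i1, i2, j1, j2)\<in>{(i1, i2, j1, j2). 1 \<le> i1 \<and> i1 < i2 \<and> i2 \<le> m \<and>
        1 \<le> j1 \<and> j1 < j2 \<and> j2 \<le> n}. h (quadruplet Y i1 i2 j1 j2 x))"
    by (rule sum.reindex_bij_witness[of _ "\<lambda>(i1, i2, j1, j2). ((i1, i2), (j1, j2))"
          "\<lambda>((i1, i2), (j1, j2)). (i1, i2, j1, j2)"]) auto
  finally show ?thesis
    by (simp add: U_stat_def real_choose_2 real_card_ordered_pairs inverse_eq_divide)
qed

lemma U_stat_matrix_of: "U_stat h entry m n (matrix_of Y x) = U_stat h Y m n x"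
  unfolding U_stat_def by (intro arg_cong2[where f="(*)"] sum.cong refl) (auto simp: quadruplet_matrix_of)

lemma U_stat_measurable:
  assumes "quadruplet_kernel h" "\<And>i j. 1 \<le> i \<Longrightarrow> 1 \<le> j \<Longrightarrow> Y i j \<in> borel_measurable M"
  shows "U_stat h Y m n \<in> borel_measurable M"
  unfolding U_stat_def
proof (intro borel_measurable_times borel_measurable_const borel_measurable_sum)
  have h: "h \<in> borel_measurable borel" using assms(1) by (simp add: quadruplet_kernel_def)
  fix p assume "p \<in> {(i1, i2, j1, j2). 1 \<le> i1 \<and> i1 < i2 \<and> i2 \<le> m \<and> 1 \<le> j1 \<and> j1 < j2 \<and> j2 \<le> n}"
  then show "(\<lambda>x. case p of (i1, i2, j1, j2) \<Rightarrow> h (quadruplet Y i1 i2 j1 j2 x)) \<in> borel_measurable M"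
    by (cases p) (auto intro!: measurable_compose[OF quadruplet_measurable h] assms(2))
qed

lemma U_stat_permute_matrix:
  assumes "quadruplet_kernel h" "\<sigma>1 permutes {1..m}" "\<sigma>2 permutes {1..n}" "y \<in> space matrix_space"
  shows "U_stat h entry m n (permute_matrix \<sigma>1 \<sigma>2 y) = U_stat h entry m n y"
proof -
  have "U_stat h entry m n (permute_matrix \<sigma>1 \<sigma>2 y) = U_stat h (\<lambda>i j. entry (\<sigma>1 i) (\<sigma>2 j)) m n y"
    using matrix_of_permute[OF assms(2,3), of entry y] U_stat_matrix_of[of h m n "\<lambda>i j. entry (\<sigma>1 i) (\<sigma>2 j)" y]
    by (simp add: matrix_of_entry[OF assms(4)])
  also have "\<dots> = U_stat h entry m n y"
  proof -
    have "(\<Sum>(i1, i2)\<in>ordered_pairs m. \<Sum>(j1, j2)\<in>ordered_pairs n. h (quadruplet entry (\<sigma>1 i1) (\<sigma>1 i2) (\<sigma>2 j1) (\<sigma>2 j2) y))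
      = (\<Sum>(i1, i2)\<in>ordered_pairs m. \<Sum>(j1, j2)\<in>ordered_pairs n. h (quadruplet entry (\<sigma>1 i1) (\<sigma>1 i2) j1 j2 y))"
      by (intro sum.cong refl, clarify, rule sum_ordered_pairs_permute[OF assms(3)])
    also have "\<dots> = (\<Sum>(i1, i2)\<in>ordered_pairs m. \<Sum>(j1, j2)\<in>ordered_pairs n. h (quadruplet entry i1 i2 j1 j2 y))"
      by (rule sum_ordered_pairs_permute[OF assms(2)])
    finally show ?thesis
      unfolding U_stat_eq_ordered_mean[OF assms(1)] by (simp add: quadruplet_def)
  qed
  finally show ?thesis .
qed

lemma permutes_atLeastAtMost_mono:
  "\<sigma> permutes {1..m::nat} \<Longrightarrow> m \<le> n \<Longrightarrow> \<sigma> permutes {1..n}"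
  by (erule permutes_subset) simp

text \<open>The generating events \<open>U\<^sub>k\<^sub>,\<^sub>l \<in> B\<close> are preimages of permutation-invariant sets of matrices, since a
permutation of the first \<open>m\<^sub>N\<close> rows also permutes the first \<open>k \<ge> m\<^sub>N\<close> rows; preimages of invariant sets
form a \<open>\<sigma>\<close>-algebra.\<close>

lemma U_filtration_invariant_preimage:
  assumes h: "quadruplet_kernel h"
    and Y: "\<And>i j. 1 \<le> i \<Longrightarrow> 1 \<le> j \<Longrightarrow> Y i j \<in> borel_measurable M"
    and \<sigma>: "\<sigma>1 permutes {1..row_dim c N}" "\<sigma>2 permutes {1..col_dim c N}"
    and A: "A \<in> sets (U_filtration M h Y c N)"
  shows "\<exists>B\<in>sets matrix_space. A = matrix_of Y -` B \<inter> space M \<and>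
    (\<forall>y\<in>space matrix_space. permute_matrix \<sigma>1 \<sigma>2 y \<in> B \<longleftrightarrow> y \<in> B)"
proof -
  let ?S = "matrix_space"
  have mat: "matrix_of Y \<in> measurable M ?S" by (rule matrix_of_measurable[OF Y])
  have P: "permute_matrix \<sigma>1 \<sigma>2 y \<in> space ?S" for y
    by (auto simp: permute_matrix_def space_PiM)
  let ?gen = "{U_stat h Y k l -` B \<inter> space M | k l B.
       k \<ge> row_dim c N \<and> l \<ge> col_dim c N \<and> B \<in> sets (borel :: real measure)}"
  have "A \<in> sigma_sets (space M) ?gen"
    using A unfolding U_filtration_def by (subst (asm) sets_measure_of) auto
  then show ?thesis
  proof (induction rule: sigma_sets.induct)
    case (Basic A)
    then obtain k l B where kl: "k \<ge> row_dim c N" "l \<ge> col_dim c N" "B \<in> sets (borel :: real measure)"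
      "A = U_stat h Y k l -` B \<inter> space M" by blast
    let ?B = "U_stat h entry k l -` B \<inter> space ?S"
    have "?B \<in> sets ?S"
      using U_stat_measurable[OF h entry_measurable] kl(3) by (rule measurable_sets)
    moreover have "A = matrix_of Y -` ?B \<inter> space M"
      using measurable_space[OF mat] by (auto simp: kl(4) U_stat_matrix_of)
    moreover have "permute_matrix \<sigma>1 \<sigma>2 y \<in> ?B \<longleftrightarrow> y \<in> ?B" if "y \<in> space ?S" for y
      using U_stat_permute_matrix[OF h permutes_atLeastAtMost_mono[OF \<sigma>(1) kl(1)]
          permutes_atLeastAtMost_mono[OF \<sigma>(2) kl(2)] that] P[of y] that by simp
    ultimately show ?case by blast
  next
    case Empty
    then show ?case by (intro bexI[of _ "{}"]) auto
  next
    case (Compl A)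
    then obtain B where B: "B \<in> sets ?S" "A = matrix_of Y -` B \<inter> space M"
      "\<forall>y\<in>space ?S. permute_matrix \<sigma>1 \<sigma>2 y \<in> B \<longleftrightarrow> y \<in> B" by blast
    show ?case
    proof (intro bexI[of _ "space ?S - B"] conjI ballI)
      show "space M - A = matrix_of Y -` (space ?S - B) \<inter> space M"
        using measurable_space[OF mat] B(2) by auto
    qed (use B P in auto)
  next
    case (Union A)
    from Union.IH have "\<forall>i. \<exists>B. B \<in> sets ?S \<and> A i = matrix_of Y -` B \<inter> space M \<and>
      (\<forall>y\<in>space ?S. permute_matrix \<sigma>1 \<sigma>2 y \<in> B \<longleftrightarrow> y \<in> B)"
      unfolding Bex_def by (rule allI)
    from choice[OF this] obtain B where B: "\<And>i::nat. B i \<in> sets ?S" "\<And>i. A i = matrix_of Y -` B i \<inter> space M"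
      "\<And>i y. y \<in> space ?S \<Longrightarrow> permute_matrix \<sigma>1 \<sigma>2 y \<in> B i \<longleftrightarrow> y \<in> B i" by blast
    show ?case
    proof (intro bexI[of _ "\<Union>i. B i"] conjI ballI)
      show "(\<Union>i. A i) = matrix_of Y -` (\<Union>i. B i) \<inter> space M" unfolding B(2) by blast
      show "(\<Union>i. B i) \<in> sets ?S" using B(1) by blast
    qed (simp only: UN_iff B(3))
  qed
qed

lemma finite_permutation_permutes: "\<sigma> permutes {1..n} \<Longrightarrow> finite_permutation \<sigma>"
  unfolding finite_permutation_def by (intro exI[of _ "{1..n}"]) auto

lemma RCE_integral_permute:
  fixes f :: "(nat \<times> nat \<Rightarrow> real) \<Rightarrow> real"
  assumes "RCE M Y" "\<sigma>1 permutes {1..m}" "\<sigma>2 permutes {1..n}" and [measurable]: "f \<in> borel_measurable matrix_space"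
  shows "(\<integral>x. f (matrix_of (\<lambda>i j. Y (\<sigma>1 i) (\<sigma>2 j)) x) \<partial>M) = (\<integral>x. f (matrix_of Y x) \<partial>M)" (is ?eq)
    and "integrable M (\<lambda>x. f (matrix_of (\<lambda>i j. Y (\<sigma>1 i) (\<sigma>2 j)) x)) \<longleftrightarrow> integrable M (\<lambda>x. f (matrix_of Y x))" (is ?int)
proof -
  let ?Z = "\<lambda>i j. Y (\<sigma>1 i) (\<sigma>2 j)"
  have Y: "Y i j \<in> borel_measurable M" if "1 \<le> i" "1 \<le> j" for i j
    using assms(1) that by (auto simp: RCE_def)
  have Z: "?Z i j \<in> borel_measurable M" if "1 \<le> i" "1 \<le> j" for i j
    using Y permutes_ge_1 assms(2,3) that by blast
  have mY: "matrix_of Y \<in> measurable M matrix_space" by (rule matrix_of_measurable[OF Y])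
  have mZ: "matrix_of ?Z \<in> measurable M matrix_space" by (rule matrix_of_measurable[OF Z])
  have "matrix_law M ?Z = matrix_law M Y"
    using assms(1-3) finite_permutation_permutes unfolding RCE_def by blast
  then have law: "distr M matrix_space (matrix_of ?Z) = distr M matrix_space (matrix_of Y)"
    by (simp add: matrix_law_def matrix_of_def[abs_def])
  show ?eq
    using integral_distr[OF mY assms(4)] integral_distr[OF mZ assms(4)] law by simp
  show ?int
    using integrable_distr_eq[OF mY assms(4)] integrable_distr_eq[OF mZ assms(4)] law by simp
qed

lemma (in prob_space) subalgebra_U_filtration:
  assumes "quadruplet_kernel h" "\<And>i j. 1 \<le> i \<Longrightarrow> 1 \<le> j \<Longrightarrow> Y i j \<in> borel_measurable M"
  shows "subalgebra M (U_filtration M h Y c N)"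
  unfolding subalgebra_def
proof (rule conjI[OF space_U_filtration])
  show "sets (U_filtration M h Y c N) \<subseteq> sets M"
    unfolding U_filtration_def
    by (subst sets_measure_of)
       (auto intro!: sets.sigma_sets_subset measurable_sets[OF U_stat_measurable[OF assms]])
qed

text \<open>Tested on an event of the filtration, whose indicator is an invariant function of the matrix, this is the
exchangeability of the law.\<close>

lemma (in prob_space) cond_exp_U_filtration_permute:
  fixes f :: "(nat \<times> nat \<Rightarrow> real) \<Rightarrow> real"
  assumes h: "quadruplet_kernel h" and R: "RCE M Y"
    and \<sigma>: "\<sigma>1 permutes {1..row_dim c N}" "\<sigma>2 permutes {1..col_dim c N}"
    and f [measurable]: "f \<in> borel_measurable matrix_space"
    and int: "integrable M (\<lambda>x. f (matrix_of Y x))"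
  shows "AE x in M. real_cond_exp M (U_filtration M h Y c N) (\<lambda>x. f (matrix_of (\<lambda>i j. Y (\<sigma>1 i) (\<sigma>2 j)) x)) x
     = real_cond_exp M (U_filtration M h Y c N) (\<lambda>x. f (matrix_of Y x)) x"
proof -
  let ?F = "U_filtration M h Y c N" and ?Z = "\<lambda>i j. Y (\<sigma>1 i) (\<sigma>2 j)"
  have Y: "Y i j \<in> borel_measurable M" if "1 \<le> i" "1 \<le> j" for i j
    using R that by (auto simp: RCE_def)
  interpret F: finite_measure_subalgebra M ?F
    by (rule finite_measure_subalgebraI[OF subalgebra_U_filtration[OF h Y]])
  have mat: "matrix_of Y \<in> measurable M matrix_space" by (rule matrix_of_measurable[OF Y])
  show ?thesis
  proof (rule F.real_cond_exp_charact)
    fix A assume A: "A \<in> sets ?F"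
    obtain B where B [measurable]: "B \<in> sets matrix_space" and AB: "A = matrix_of Y -` B \<inter> space M"
      and inv: "\<And>y. y \<in> space matrix_space \<Longrightarrow> permute_matrix \<sigma>1 \<sigma>2 y \<in> B \<longleftrightarrow> y \<in> B"
      using U_filtration_invariant_preimage[OF h Y \<sigma> A] by blast
    have ind: "indicator A x = (indicator B (matrix_of Y x) :: real)"
      "indicator B (matrix_of ?Z x) = (indicator B (matrix_of Y x) :: real)" if "x \<in> space M" for x
      using that measurable_space[OF mat that] inv[OF measurable_space[OF mat that]]
      by (auto simp: AB indicator_def matrix_of_permute[OF \<sigma>])
    have "(\<integral>x\<in>A. f (matrix_of ?Z x) \<partial>M) = (\<integral>x. indicator B (matrix_of ?Z x) * f (matrix_of ?Z x) \<partial>M)"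
      unfolding set_lebesgue_integral_def by (intro Bochner_Integration.integral_cong) (simp_all add: ind)
    also have "\<dots> = (\<integral>x. indicator B (matrix_of Y x) * f (matrix_of Y x) \<partial>M)"
      by (rule RCE_integral_permute(1)[OF R \<sigma>, of "\<lambda>y. indicator B y * f y"])
         (intro borel_measurable_times borel_measurable_indicator B f)
    also have "\<dots> = (\<integral>x\<in>A. f (matrix_of Y x) \<partial>M)"
      unfolding set_lebesgue_integral_def by (intro Bochner_Integration.integral_cong) (simp_all add: ind)
    also have "\<dots> = (\<integral>x\<in>A. real_cond_exp M ?F (\<lambda>x. f (matrix_of Y x)) x \<partial>M)"
      by (rule F.real_cond_exp_intA[OF int A])
    finally show "(\<integral>x\<in>A. f (matrix_of ?Z x) \<partial>M) = \<dots>" .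
  qed (use int RCE_integral_permute(2)[OF R \<sigma> f] F.real_cond_exp_int(1)[OF int] in auto)
qed

section \<open>Averages, convexity and conditional expectation\<close>

text \<open>Up to the factor 2 this function bounds the truncated square \<open>x\<^sup>2 min 1 \<bar>x\<bar>\<close> from above; unlike the truncated
square it is convex, so that Jensen's inequality carries a Lindeberg bound from the terms of an average to the
average.\<close>

definition lindeberg_fun :: "real \<Rightarrow> real" where
  "lindeberg_fun x = \<bar>x\<bar> ^ 3 / (1 + \<bar>x\<bar>)"

lemma lindeberg_fun_nonneg [simp]: "0 \<le> lindeberg_fun x"
  by (simp add: lindeberg_fun_def)

lemma lindeberg_fun_minus [simp]: "lindeberg_fun (- x) = lindeberg_fun x"
  by (simp add: lindeberg_fun_def)

lemma lindeberg_fun_measurable [measurable]: "lindeberg_fun \<in> borel_measurable borel"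
  unfolding lindeberg_fun_def by measurable

lemma lindeberg_fun_eq: "lindeberg_fun x = x\<^sup>2 * (\<bar>x\<bar> / (1 + \<bar>x\<bar>))"
  by (simp add: lindeberg_fun_def power3_eq_cube power2_eq_square abs_mult_self_eq)

lemma lindeberg_fun_le_square: "lindeberg_fun x \<le> x\<^sup>2"
  unfolding lindeberg_fun_eq by (intro mult_left_le) (auto simp: field_simps)

lemma square_min_le_lindeberg_fun: "x\<^sup>2 * min 1 \<bar>x\<bar> \<le> 2 * lindeberg_fun x"
proof -
  have "min 1 \<bar>x\<bar> \<le> 2 * (\<bar>x\<bar> / (1 + \<bar>x\<bar>))"
  proof (cases "\<bar>x\<bar> \<le> 1")
    case True
    then have "\<bar>x\<bar> * (1 + \<bar>x\<bar>) \<le> \<bar>x\<bar> * 2" by (intro mult_left_mono) auto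
    then show ?thesis using True by (simp add: pos_le_divide_eq min_def)
  next
    case False
    then show ?thesis by (simp add: pos_le_divide_eq min_def)
  qed
  then have "x\<^sup>2 * min 1 \<bar>x\<bar> \<le> x\<^sup>2 * (2 * (\<bar>x\<bar> / (1 + \<bar>x\<bar>)))" by (intro mult_left_mono) auto
  then show ?thesis by (simp add: lindeberg_fun_eq mult_ac)
qed

lemma lindeberg_fun_mono:
  assumes "\<bar>x\<bar> \<le> \<bar>y\<bar>"
  shows "lindeberg_fun x \<le> lindeberg_fun y"
proof -
  have "\<bar>x\<bar> ^ 3 \<le> \<bar>y\<bar> ^ 3" using assms by (intro power_mono) auto
  moreover have "\<bar>x\<bar> ^ 3 * \<bar>y\<bar> \<le> \<bar>y\<bar> ^ 3 * \<bar>x\<bar>"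
  proof -
    have "(\<bar>x\<bar> * \<bar>y\<bar>) * \<bar>x\<bar>\<^sup>2 \<le> (\<bar>x\<bar> * \<bar>y\<bar>) * \<bar>y\<bar>\<^sup>2"
      using assms by (intro mult_left_mono power_mono) auto
    then show ?thesis by (simp add: power3_eq_cube power2_eq_square mult_ac)
  qed
  ultimately have "\<bar>x\<bar> ^ 3 * (1 + \<bar>y\<bar>) \<le> \<bar>y\<bar> ^ 3 * (1 + \<bar>x\<bar>)"
    unfolding distrib_left mult_1_right by (rule add_mono)
  moreover have "0 < 1 + \<bar>x\<bar>" "0 < 1 + \<bar>y\<bar>" by auto
  ultimately show ?thesis
    unfolding lindeberg_fun_def by (simp only: pos_divide_le_eq times_divide_eq_left pos_le_divide_eq)
qed

text \<open>For \<open>x \<ge> 0\<close> the function equals \<open>x\<^sup>2 - x + 1 - 1/(1 + x)\<close>, whose derivative increases because \<open>1/(1 + x)\<^sup>2\<close>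
decreases with slope at most 2; as it is increasing there, composing it with the absolute value preserves
convexity.\<close>

lemma convex_on_lindeberg_fun: "convex_on UNIV lindeberg_fun"
proof -
  define g where "g x = x\<^sup>2 - x + 1 - 1 / (1 + x)" for x :: real
  have g: "convex_on {0..} g"
  proof (rule convex_on_realI[where f'="\<lambda>x. 2 * x - 1 + 1 / (1 + x)\<^sup>2"])
    show "(g has_real_derivative 2 * x - 1 + 1 / (1 + x)\<^sup>2) (at x)" if "x \<in> {0..}" for x
      unfolding g_def using that
      by (auto intro!: derivative_eq_intros simp: power2_eq_square)
    fix x y :: real assume xy: "x \<in> {0..}" "y \<in> {0..}" "x \<le> y"
    define a b where "a = 1 / (1 + x)" and "b = 1 / (1 + y)"
    have ab: "0 \<le> a" "0 \<le> b" "a \<le> 1" "b \<le> 1" "b \<le> a"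
      using xy by (auto simp: a_def b_def field_simps)
    have "a - b = (y - x) * (a * b)"
      using xy by (simp add: a_def b_def field_simps)
    also have "\<dots> \<le> (y - x) * 1"
      using xy ab by (intro mult_left_mono mult_le_one) auto
    finally have "a - b \<le> y - x" by simp
    then have "(a - b) * (a + b) \<le> (y - x) * 2"
      using ab by (intro mult_mono) auto
    then have "a\<^sup>2 - b\<^sup>2 \<le> (y - x) * 2" by (simp add: power2_eq_square algebra_simps)
    then show "2 * x - 1 + 1 / (1 + x)\<^sup>2 \<le> 2 * y - 1 + 1 / (1 + y)\<^sup>2"
      by (simp add: a_def b_def power_divide)
  qed (rule connected_Ici)
  have eq: "lindeberg_fun x = g \<bar>x\<bar>" for x
  proof -
    have "1 + \<bar>x\<bar> \<noteq> 0" by simp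
    then show ?thesis
      unfolding lindeberg_fun_def g_def by (simp add: field_simps power2_eq_square power3_eq_cube)
  qed
  show ?thesis
  proof (rule convex_onI)
    fix t x y :: real assume t: "0 < t" "t < 1"
    have "lindeberg_fun ((1 - t) *\<^sub>R x + t *\<^sub>R y) \<le> lindeberg_fun ((1 - t) * \<bar>x\<bar> + t * \<bar>y\<bar>)"
      using t by (intro lindeberg_fun_mono) (auto intro!: order_trans[OF abs_triangle_ineq] simp: abs_mult)
    also have "\<dots> = g ((1 - t) *\<^sub>R \<bar>x\<bar> + t *\<^sub>R \<bar>y\<bar>)"
      using t by (simp add: eq)
    also have "\<dots> \<le> (1 - t) * g \<bar>x\<bar> + t * g \<bar>y\<bar>"
      using t by (intro convex_onD[OF g]) auto
    finally show "lindeberg_fun ((1 - t) *\<^sub>R x + t *\<^sub>R y) \<le> (1 - t) * lindeberg_fun x + t * lindeberg_fun y"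
      by (simp add: eq)
  qed simp
qed

lemma convex_on_average:
  fixes f :: "'i \<Rightarrow> real"
  assumes "convex_on UNIV g" "finite S" "S \<noteq> {}"
  shows "g ((\<Sum>s\<in>S. f s) / real (card S)) \<le> (\<Sum>s\<in>S. g (f s)) / real (card S)"
proof -
  have "g (\<Sum>s\<in>S. (1 / real (card S)) *\<^sub>R f s) \<le> (\<Sum>s\<in>S. (1 / real (card S)) * g (f s))"
    using assms by (intro convex_on_sum[OF assms(2,3,1)]) auto
  then show ?thesis by (simp add: sum_divide_distrib)
qed

lemma (in prob_space) expectation_convex_average_le:
  fixes f :: "'i \<Rightarrow> 'a \<Rightarrow> real"
  assumes g: "convex_on UNIV g" "\<And>x. 0 \<le> g x" and gm [measurable]: "g \<in> borel_measurable borel"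
    and S: "finite S" "S \<noteq> {}"
    and fm [measurable]: "\<And>s. s \<in> S \<Longrightarrow> f s \<in> borel_measurable M"
    and int: "\<And>s. s \<in> S \<Longrightarrow> integrable M (\<lambda>x. g (f s x))"
    and b: "\<And>s. s \<in> S \<Longrightarrow> expectation (\<lambda>x. g (f s x)) \<le> b"
  shows "integrable M (\<lambda>x. g ((\<Sum>s\<in>S. f s x) / real (card S)))"
    and "expectation (\<lambda>x. g ((\<Sum>s\<in>S. f s x) / real (card S))) \<le> b"
proof -
  have avg: "integrable M (\<lambda>x. (\<Sum>s\<in>S. g (f s x)) / real (card S))"
    using int by auto
  have le: "g ((\<Sum>s\<in>S. f s x) / real (card S)) \<le> (\<Sum>s\<in>S. g (f s x)) / real (card S)" for x
    by (rule convex_on_average[OF g(1) S])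
  have m: "(\<lambda>x. (\<Sum>s\<in>S. f s x) / real (card S)) \<in> borel_measurable M"
    by (intro borel_measurable_divide borel_measurable_sum fm) auto
  show i: "integrable M (\<lambda>x. g ((\<Sum>s\<in>S. f s x) / real (card S)))"
    by (rule Bochner_Integration.integrable_bound[OF avg measurable_compose[OF m gm]])
       (intro AE_I2, simp add: g(2), rule order_trans[OF le abs_ge_self, simplified])
  have "expectation (\<lambda>x. g ((\<Sum>s\<in>S. f s x) / real (card S))) \<le> expectation (\<lambda>x. (\<Sum>s\<in>S. g (f s x)) / real (card S))"
    by (rule integral_mono[OF i avg le])
  also have "\<dots> = (\<Sum>s\<in>S. expectation (\<lambda>x. g (f s x))) / real (card S)"
    using int by simp
  also have "\<dots> \<le> (\<Sum>s\<in>S. b) / real (card S)"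
    by (intro divide_right_mono sum_mono b) auto
  also have "\<dots> = b" using S by simp
  finally show "expectation (\<lambda>x. g ((\<Sum>s\<in>S. f s x) / real (card S))) \<le> b" .
qed

lemma (in prob_space) expectation_abs_mult_le:
  fixes X Y :: "'a \<Rightarrow> real"
  assumes [measurable]: "X \<in> borel_measurable M" "Y \<in> borel_measurable M"
    and X2: "integrable M (\<lambda>x. (X x)\<^sup>2)" and Y2: "integrable M (\<lambda>x. (Y x)\<^sup>2)"
  shows "expectation (\<lambda>x. \<bar>X x * Y x\<bar>) \<le> sqrt (expectation (\<lambda>x. (X x)\<^sup>2)) * sqrt (expectation (\<lambda>x. (Y x)\<^sup>2))"
proof -
  have XY: "integrable M (\<lambda>x. \<bar>X x * Y x\<bar>)"
    using integrable_mult_of_square[OF assms] by auto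
  have "(\<integral>\<^sup>+x. ennreal \<bar>X x\<bar> * ennreal \<bar>Y x\<bar> \<partial>M)\<^sup>2
      \<le> (\<integral>\<^sup>+x. (ennreal \<bar>X x\<bar>)\<^sup>2 \<partial>M) * (\<integral>\<^sup>+x. (ennreal \<bar>Y x\<bar>)\<^sup>2 \<partial>M)"
    by (rule Cauchy_Schwarz_nn_integral) auto
  moreover have "(\<integral>\<^sup>+x. ennreal \<bar>X x\<bar> * ennreal \<bar>Y x\<bar> \<partial>M) = ennreal (expectation (\<lambda>x. \<bar>X x * Y x\<bar>))"
    by (subst nn_integral_eq_integral[OF XY, symmetric]) (auto simp: abs_mult ennreal_mult)
  moreover have "(\<integral>\<^sup>+x. (ennreal \<bar>X x\<bar>)\<^sup>2 \<partial>M) = ennreal (expectation (\<lambda>x. (X x)\<^sup>2))"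
    by (subst nn_integral_eq_integral[OF X2, symmetric]) (auto simp: ennreal_power)
  moreover have "(\<integral>\<^sup>+x. (ennreal \<bar>Y x\<bar>)\<^sup>2 \<partial>M) = ennreal (expectation (\<lambda>x. (Y x)\<^sup>2))"
    by (subst nn_integral_eq_integral[OF Y2, symmetric]) (auto simp: ennreal_power)
  ultimately have "ennreal ((expectation (\<lambda>x. \<bar>X x * Y x\<bar>))\<^sup>2) \<le> ennreal (expectation (\<lambda>x. (X x)\<^sup>2) * expectation (\<lambda>x. (Y x)\<^sup>2))"
    by (simp add: ennreal_power ennreal_mult)
  then have "(expectation (\<lambda>x. \<bar>X x * Y x\<bar>))\<^sup>2 \<le> expectation (\<lambda>x. (X x)\<^sup>2) * expectation (\<lambda>x. (Y x)\<^sup>2)"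
    by (subst (asm) ennreal_le_iff) auto
  then show ?thesis
    by (subst real_sqrt_mult[symmetric], intro real_le_rsqrt)
qed

lemma (in finite_measure_subalgebra) real_cond_exp_square_le:
  assumes [measurable]: "X \<in> borel_measurable M" and "integrable M (\<lambda>x. (X x)\<^sup>2)"
  shows "(\<integral>x. (real_cond_exp M F X x)\<^sup>2 \<partial>M) \<le> (\<integral>x. (X x)\<^sup>2 \<partial>M)"
proof -
  have X1: "integrable M X" by (rule square_integrable_imp_integrable[OF assms])
  have "AE x in M. (real_cond_exp M F X x)\<^sup>2 \<le> real_cond_exp M F (\<lambda>x. (X x)\<^sup>2) x"
    using X1 assms(2)
    by (intro real_cond_exp_jensens_inequality(2)[where I=UNIV and q="\<lambda>x. x\<^sup>2"]) (simp_all add: convex_power2)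
  then have "(\<integral>x. (real_cond_exp M F X x)\<^sup>2 \<partial>M) \<le> (\<integral>x. real_cond_exp M F (\<lambda>x. (X x)\<^sup>2) x \<partial>M)"
    using assms by (intro integral_mono_AE integrable_square_real_cond_exp real_cond_exp_int(1)) auto
  also have "\<dots> = (\<integral>x. (X x)\<^sup>2 \<partial>M)" by (rule real_cond_exp_int(2)[OF assms(2)])
  finally show ?thesis .
qed

lemma (in sigma_finite_subalgebra) real_cond_exp_average:
  fixes f :: "'i \<Rightarrow> 'a \<Rightarrow> real"
  assumes "finite S" "\<And>s. s \<in> S \<Longrightarrow> integrable M (f s)"
  shows "AE x in M. real_cond_exp M F (\<lambda>x. (\<Sum>s\<in>S. f s x) / real (card S)) x
    = (\<Sum>s\<in>S. real_cond_exp M F (f s) x) / real (card S)"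
proof -
  define f' where "f' s = (if s \<in> S then f s else (\<lambda>_. 0))" for s
  have i: "integrable M (f' s)" for s using assms by (auto simp: f'_def)
  have "AE x in M. real_cond_exp M F (\<lambda>x. (\<Sum>s\<in>S. f' s x) / real (card S)) x
      = real_cond_exp M F (\<lambda>x. \<Sum>s\<in>S. f' s x) x / real (card S)"
    using i by (intro real_cond_exp_cdiv) auto
  moreover have "AE x in M. real_cond_exp M F (\<lambda>x. \<Sum>s\<in>S. f' s x) x = (\<Sum>s\<in>S. real_cond_exp M F (f' s) x)"
    by (rule real_cond_exp_sum[OF i])
  ultimately show ?thesis
    by eventually_elim (simp add: f'_def)
qed

lemma (in sigma_finite_subalgebra) real_cond_exp_average_eq:
  fixes f :: "'i \<Rightarrow> 'a \<Rightarrow> real"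
  assumes S: "finite S" "S \<noteq> {}" and f: "\<And>s. s \<in> S \<Longrightarrow> integrable M (f s)"
    and g: "\<And>s. s \<in> S \<Longrightarrow> AE x in M. real_cond_exp M F (f s) x = g x"
  shows "AE x in M. real_cond_exp M F (\<lambda>x. (\<Sum>s\<in>S. f s x) / real (card S)) x = g x"
proof -
  have "AE x in M. \<forall>s\<in>S. real_cond_exp M F (f s) x = g x"
    using S(1) g by (simp add: AE_ball_countable uncountable_infinite countable_finite)
  moreover have "AE x in M. real_cond_exp M F (\<lambda>x. (\<Sum>s\<in>S. f s x) / real (card S)) x
      = (\<Sum>s\<in>S. real_cond_exp M F (f s) x) / real (card S)"
    by (rule real_cond_exp_average[OF S(1) f])
  ultimately show ?thesis
    by eventually_elim (use S in simp)
qed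

text \<open>Terms in \<open>G\<close> have the conditional expectation \<open>g\<close>; every other term is off by at most \<open>b\<close> in \<open>L\<^sup>1\<close>, since
conditional expectation is a contraction.\<close>

lemma (in sigma_finite_subalgebra) real_cond_exp_average_approx:
  fixes f :: "'i \<Rightarrow> 'a \<Rightarrow> real"
  assumes S: "finite S" "S \<noteq> {}" and f: "\<And>s. s \<in> S \<Longrightarrow> integrable M (f s)" and gi: "integrable M g"
    and G: "G \<subseteq> S" and g: "\<And>s. s \<in> G \<Longrightarrow> AE x in M. real_cond_exp M F (f s) x = g x"
    and b: "\<And>s. s \<in> S \<Longrightarrow> (\<integral>x. \<bar>f s x\<bar> \<partial>M) + (\<integral>x. \<bar>g x\<bar> \<partial>M) \<le> b"
  shows "(\<integral>x. \<bar>real_cond_exp M F (\<lambda>x. (\<Sum>s\<in>S. f s x) / real (card S)) x - g x\<bar> \<partial>M)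
    \<le> b * (1 - real (card G) / real (card S))"
proof -
  have pos: "0 < real (card S)" using S by (simp add: card_gt_0_iff)
  have fin: "finite G" using S(1) G by (rule rev_finite_subset)
  note Ei = real_cond_exp_int(1)[OF f]
  have avg: "AE x in M. real_cond_exp M F (\<lambda>x. (\<Sum>s\<in>S. f s x) / real (card S)) x
      = (\<Sum>s\<in>S. real_cond_exp M F (f s) x) / real (card S)"
    by (rule real_cond_exp_average[OF S(1) f])
  have di: "integrable M (\<lambda>x. \<bar>real_cond_exp M F (f s) x - g x\<bar>)" if "s \<in> S" for s
    using Ei[OF that] gi by auto
  have fi: "integrable M (\<lambda>x. (\<Sum>s\<in>S. f s x) / real (card S))" using f by auto
  have "(\<integral>x. \<bar>real_cond_exp M F (\<lambda>x. (\<Sum>s\<in>S. f s x) / real (card S)) x - g x\<bar> \<partial>M)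
      \<le> (\<integral>x. (\<Sum>s\<in>S. \<bar>real_cond_exp M F (f s) x - g x\<bar>) / real (card S) \<partial>M)"
  proof (rule integral_mono_AE)
    show "AE x in M. \<bar>real_cond_exp M F (\<lambda>x. (\<Sum>s\<in>S. f s x) / real (card S)) x - g x\<bar>
        \<le> (\<Sum>s\<in>S. \<bar>real_cond_exp M F (f s) x - g x\<bar>) / real (card S)"
      using avg
    proof eventually_elim
      case (elim x)
      have "(\<Sum>s\<in>S. real_cond_exp M F (f s) x) / real (card S) - g x
          = (\<Sum>s\<in>S. real_cond_exp M F (f s) x - g x) / real (card S)"
        using pos by (simp add: sum_subtractf field_simps)
      then show ?case
        unfolding elim using pos by (simp add: divide_right_mono sum_abs)
    qed
  qed (use fi gi di in \<open>auto intro!: real_cond_exp_int(1)\<close>)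
  also have "\<dots> = (\<Sum>s\<in>S. \<integral>x. \<bar>real_cond_exp M F (f s) x - g x\<bar> \<partial>M) / real (card S)"
    using di by simp
  also have "(\<Sum>s\<in>S. \<integral>x. \<bar>real_cond_exp M F (f s) x - g x\<bar> \<partial>M) \<le> (\<Sum>s\<in>S. if s \<in> G then 0 else b)"
  proof (rule sum_mono)
    fix s assume s: "s \<in> S"
    show "(\<integral>x. \<bar>real_cond_exp M F (f s) x - g x\<bar> \<partial>M) \<le> (if s \<in> G then 0 else b)"
    proof (cases "s \<in> G")
      case True
      have "(\<integral>x. \<bar>real_cond_exp M F (f s) x - g x\<bar> \<partial>M) = (\<integral>x. 0 \<partial>M)"
        using g[OF True] di[OF s] borel_measurable_integrable[OF di[OF s]] by (intro integral_cong_AE) auto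
      then show ?thesis using True by simp
    next
      case False
      have "(\<integral>x. \<bar>real_cond_exp M F (f s) x - g x\<bar> \<partial>M) \<le> (\<integral>x. \<bar>real_cond_exp M F (f s) x\<bar> + \<bar>g x\<bar> \<partial>M)"
        using di[OF s] Ei[OF s] gi by (intro integral_mono) auto
      also have "\<dots> = (\<integral>x. \<bar>real_cond_exp M F (f s) x\<bar> \<partial>M) + (\<integral>x. \<bar>g x\<bar> \<partial>M)"
        using Ei[OF s] gi by simp
      also have "\<dots> \<le> b" using real_cond_exp_L1_contraction[OF f[OF s]] b[OF s] by linarith
      finally show ?thesis using False by simp
    qed
  qed
  also have "(\<Sum>s\<in>S. if s \<in> G then 0 else b) = b * (real (card S) - real (card G))"
  proof -
    have "(\<Sum>s\<in>S. if s \<in> G then 0 else b) = (\<Sum>s\<in>S - G. b)"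
      using S(1) by (intro sum.mono_neutral_cong_right) auto
    then show ?thesis
      using card_Diff_subset[OF fin G] card_mono[OF S(1) G] by (simp add: of_nat_diff)
  qed
  finally show ?thesis using pos by (simp add: divide_right_mono field_simps)
qed

section \<open>Growth of the dimensions\<close>

lemma col_dim_eq_row_dim: "col_dim c N = row_dim (1 - c) N"
  by (simp add: col_dim_def row_dim_def)

lemma real_row_dim:
  assumes "0 < c"
  shows "real (row_dim c N) = 2 + of_int \<lfloor>c * (real N + 1)\<rfloor>"
  using assms by (simp add: row_dim_def)

lemma row_dim_bounds:
  assumes "0 < c"
  shows "1 + c * (real N + 1) \<le> real (row_dim c N)" "real (row_dim c N) \<le> 2 + c * (real N + 1)"
  unfolding real_row_dim[OF assms] by linarith+

lemma row_dim_mono: "0 < c \<Longrightarrow> N \<le> N' \<Longrightarrow> row_dim c N \<le> row_dim c N'"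
  unfolding row_dim_def by (intro add_left_mono nat_mono floor_mono mult_left_mono) auto

text \<open>The integer \<open>N + 1\<close> is split into \<open>c (N + 1)\<close> and \<open>(1 - c) (N + 1)\<close>. Irrationality of \<open>c\<close> makes both parts
non-integral, so that their floors add up to exactly \<open>N\<close>.\<close>

lemma row_dim_plus_col_dim:
  assumes "0 < c" "c < 1" "c \<notin> \<rat>"
  shows "row_dim c N + col_dim c N = N + 4"
proof -
  let ?x = "real N + 1" and ?a = "\<lfloor>c * (real N + 1)\<rfloor>"
  have "c * ?x \<noteq> of_int ?a"
  proof
    assume "c * ?x = of_int ?a"
    then have "c = of_int ?a / ?x" by (simp add: field_simps)
    also have "\<dots> = of_int ?a / of_nat (Suc N)" by (simp add: add.commute)
    also have "\<dots> \<in> \<rat>" by (intro Rats_divide) auto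
    finally show False using assms(3) by simp
  qed
  then have "of_int ?a < c * ?x" "c * ?x < of_int ?a + 1" by linarith+
  then have "\<lfloor>(1 - c) * ?x\<rfloor> = int N - ?a"
    by (intro floor_unique) (simp_all add: algebra_simps)
  moreover have "0 \<le> ?a" "0 \<le> \<lfloor>(1 - c) * ?x\<rfloor>" using assms by simp_all
  ultimately show ?thesis unfolding row_dim_def col_dim_def by linarith
qed

lemma dim_step:
  assumes "0 < c" "c < 1" "c \<notin> \<rat>"
  shows "row_dim c (Suc N) = Suc (row_dim c N) \<and> col_dim c (Suc N) = col_dim c N \<or>
     row_dim c (Suc N) = row_dim c N \<and> col_dim c (Suc N) = Suc (col_dim c N)"
  using row_dim_plus_col_dim[OF assms, of N] row_dim_plus_col_dim[OF assms, of "Suc N"]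
    row_dim_mono[OF assms(1), of N "Suc N"] row_dim_mono[of "1 - c" N "Suc N"] assms(2)
  by (simp add: col_dim_eq_row_dim) linarith

lemma row_dim_at_top:
  assumes "0 < c"
  shows "filterlim (row_dim c) at_top sequentially"
proof -
  have "filterlim (\<lambda>N. 1 + c * (real N + 1)) at_top sequentially"
    using assms by real_asymp
  then have "filterlim (\<lambda>N. real (row_dim c N)) at_top sequentially"
    by (rule filterlim_at_top_mono) (use row_dim_bounds(1)[OF assms] in auto)
  then show ?thesis by (simp add: filterlim_sequentially_iff_filterlim_real)
qed

lemma row_dim_ratio:
  assumes "0 < c"
  shows "(\<lambda>N. real N / real (row_dim c N)) \<longlonglongrightarrow> 1 / c"
proof (rule tendsto_sandwich)
  show "(\<lambda>N. real N / (2 + c * (real N + 1))) \<longlonglongrightarrow> 1 / c"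
    using assms by (real_asymp simp: inverse_eq_divide)
  show "(\<lambda>N. real N / (1 + c * (real N + 1))) \<longlonglongrightarrow> 1 / c"
    using assms by (real_asymp simp: inverse_eq_divide)
  have pos: "0 < 1 + c * (real N + 1)" for N using assms by (simp add: add_pos_nonneg)
  have r: "0 < real (row_dim c N)" for N by (simp add: row_dim_def)
  show "\<forall>\<^sub>F N in sequentially. real N / (2 + c * (real N + 1)) \<le> real N / real (row_dim c N)"
    using row_dim_bounds(2)[OF assms] r
    by (intro always_eventually allI divide_left_mono mult_pos_pos add_pos_nonneg) (use assms in auto)
  show "\<forall>\<^sub>F N in sequentially. real N / real (row_dim c N) \<le> real N / (1 + c * (real N + 1))"
    using row_dim_bounds(1)[OF assms] r pos
    by (intro always_eventually allI divide_left_mono mult_pos_pos) auto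
qed

section \<open>Exchangeable arrays and their U-statistics\<close>

lemma kernel_measurable: "quadruplet_kernel h \<Longrightarrow> h \<in> borel_measurable borel"
  by (simp add: quadruplet_kernel_def)

lemma kernel_entry_measurable:
  assumes "quadruplet_kernel h" "1 \<le> i1" "1 \<le> i2" "1 \<le> j1" "1 \<le> j2"
  shows "(\<lambda>y. h (quadruplet entry i1 i2 j1 j2 y)) \<in> borel_measurable matrix_space"
proof (rule measurable_compose[OF quadruplet_measurable kernel_measurable[OF assms(1)]])
  fix i j assume "i \<in> {i1, i2}" "j \<in> {j1, j2}"
  then show "entry i j \<in> borel_measurable matrix_space"
    using assms by (intro entry_measurable) auto
qed

locale rce_statistic = prob_space M for M :: "'a measure" +
  fixes Y :: "'a random_matrix" and h :: "real^2^2 \<Rightarrow> real" and c :: real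
  assumes c_pos: "0 < c" and c_less_1: "c < 1" and c_irrational: "c \<notin> \<rat>"
    and rce: "RCE M Y" and kernel: "quadruplet_kernel h"
    and square_integrable: "integrable M (\<lambda>x. (h (quadruplet Y 1 2 1 2 x))\<^sup>2)"
begin

definition H :: "nat \<Rightarrow> nat \<Rightarrow> nat \<Rightarrow> nat \<Rightarrow> 'a \<Rightarrow> real" where
  "H i1 i2 j1 j2 x = h (quadruplet Y i1 i2 j1 j2 x)"

abbreviation F :: "nat \<Rightarrow> 'a measure" where "F \<equiv> U_filtration M h Y c"
abbreviation CE :: "nat \<Rightarrow> ('a \<Rightarrow> real) \<Rightarrow> 'a \<Rightarrow> real" where "CE N \<equiv> real_cond_exp M (F N)"
abbreviation T :: "'a measure" where "T \<equiv> U_tail M h Y c"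
abbreviation U :: "nat \<Rightarrow> 'a \<Rightarrow> real" where "U \<equiv> U_seq h Y c"
abbreviation Uinf :: "'a \<Rightarrow> real" where "Uinf \<equiv> U_infinity M h Y c"

definition kappa :: real where "kappa = expectation (\<lambda>x. (H 1 2 1 2 x)\<^sup>2)"

lemma kappa_nonneg: "0 \<le> kappa"
  by (simp add: kappa_def)

lemma Y_measurable: "1 \<le> i \<Longrightarrow> 1 \<le> j \<Longrightarrow> Y i j \<in> borel_measurable M"
  using rce by (auto simp: RCE_def)

lemma H_measurable:
  assumes "1 \<le> i1" "1 \<le> i2" "1 \<le> j1" "1 \<le> j2"
  shows "H i1 i2 j1 j2 \<in> borel_measurable M"
  unfolding H_def[abs_def]
  by (rule measurable_compose[OF quadruplet_measurable kernel_measurable[OF kernel]])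
     (use assms in \<open>auto intro: Y_measurable\<close>)

lemma H_swap_rows: "H i2 i1 j1 j2 = H i1 i2 j1 j2"
  by (simp add: H_def fun_eq_iff quadruplet_kernel_swap_rows[OF kernel])

lemma subalgebra_F: "subalgebra M (F N)"
  by (rule subalgebra_U_filtration[OF kernel Y_measurable])

lemma F_decreasing: "subalgebra (F N) (F (Suc N))"
  unfolding subalgebra_def space_U_filtration
proof (rule conjI[OF refl])
  have "row_dim c N \<le> row_dim c (Suc N)" "col_dim c N \<le> col_dim c (Suc N)"
    using c_pos c_less_1 by (auto simp: col_dim_eq_row_dim intro!: row_dim_mono)
  then show "sets (F (Suc N)) \<subseteq> sets (F N)"
    unfolding U_filtration_def
    by (subst (1 2) sets_measure_of) (auto intro!: sigma_sets_mono' dest: order_trans)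
qed

lemma space_T: "space T = space M"
  by (simp add: U_tail_def space_measure_of_conv)

lemma sets_T: "sets T = (\<Inter>n. sets (F n))"
proof -
  have "sets (F 1) \<subseteq> sets (F 0)" using F_decreasing[of 0] by (simp add: subalgebra_def)
  then have "(\<Inter>n\<in>{1..}. sets (F n)) \<subseteq> sets (F n)" for n by (cases n) auto
  then show ?thesis unfolding sets_U_tail by blast
qed

lemma subalgebra_T: "subalgebra M T"
  using subalgebra_F[of 0] space_T sets_T by (auto simp: subalgebra_def)

lemma subalgebra_F_T: "subalgebra (F N) T"
  using space_T sets_T by (auto simp: subalgebra_def space_U_filtration)

sublocale F: finite_measure_subalgebra M "F N" for N
  by (rule finite_measure_subalgebraI[OF subalgebra_F])

sublocale T: finite_measure_subalgebra M T
  by (rule finite_measure_subalgebraI[OF subalgebra_T])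

lemma H_identically_distributed:
  assumes g: "g \<in> borel_measurable borel" and ij: "i1 \<noteq> i2" "j1 \<noteq> j2" "1 \<le> i1" "1 \<le> i2" "1 \<le> j1" "1 \<le> j2"
  shows "expectation (\<lambda>x. g (H i1 i2 j1 j2 x)) = (expectation (\<lambda>x. g (H 1 2 1 2 x)) :: real)"
    and "integrable M (\<lambda>x. g (H i1 i2 j1 j2 x)) \<longleftrightarrow> integrable M (\<lambda>x. g (H 1 2 1 2 x))"
proof -
  obtain \<sigma>1 where \<sigma>1: "\<sigma>1 permutes {1..i1 + i2}" "\<sigma>1 1 = i1" "\<sigma>1 2 = i2"
    using exists_permutation_of_list[of "[i1, i2]" "i1 + i2"] ij by (auto simp: nth_Cons')
  obtain \<sigma>2 where \<sigma>2: "\<sigma>2 permutes {1..j1 + j2}" "\<sigma>2 1 = j1" "\<sigma>2 2 = j2"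
    using exists_permutation_of_list[of "[j1, j2]" "j1 + j2"] ij by (auto simp: nth_Cons')
  let ?f = "\<lambda>y. g (h (quadruplet entry 1 2 1 2 y))"
  have f: "?f \<in> borel_measurable matrix_space"
    by (rule measurable_compose[OF kernel_entry_measurable[OF kernel] g]) simp_all
  have "?f (matrix_of Y x) = g (H 1 2 1 2 x)" for x
    by (simp add: quadruplet_matrix_of H_def)
  moreover have "?f (matrix_of (\<lambda>i j. Y (\<sigma>1 i) (\<sigma>2 j)) x) = g (H i1 i2 j1 j2 x)" for x
    using \<sigma>1(2,3) \<sigma>2(2,3) by (simp add: quadruplet_matrix_of H_def) (simp add: quadruplet_def)
  ultimately show "expectation (\<lambda>x. g (H i1 i2 j1 j2 x)) = expectation (\<lambda>x. g (H 1 2 1 2 x))"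
    and "integrable M (\<lambda>x. g (H i1 i2 j1 j2 x)) \<longleftrightarrow> integrable M (\<lambda>x. g (H 1 2 1 2 x))"
    using RCE_integral_permute[OF rce \<sigma>1(1) \<sigma>2(1) f] by simp_all
qed

lemma H_square:
  assumes "i1 \<noteq> i2" "j1 \<noteq> j2" "1 \<le> i1" "1 \<le> i2" "1 \<le> j1" "1 \<le> j2"
  shows "integrable M (\<lambda>x. (H i1 i2 j1 j2 x)\<^sup>2)" "expectation (\<lambda>x. (H i1 i2 j1 j2 x)\<^sup>2) = kappa"
  using H_identically_distributed[of "\<lambda>x. x\<^sup>2", OF _ assms] square_integrable
  by (simp_all add: kappa_def H_def)

lemma H_integrable:
  assumes "i1 \<noteq> i2" "j1 \<noteq> j2" "1 \<le> i1" "1 \<le> i2" "1 \<le> j1" "1 \<le> j2"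
  shows "integrable M (H i1 i2 j1 j2)"
  using square_integrable_imp_integrable[OF H_measurable H_square(1)] assms by blast

lemma H_mult_integrable:
  assumes "i1 \<noteq> i2" "j1 \<noteq> j2" "1 \<le> i1" "1 \<le> i2" "1 \<le> j1" "1 \<le> j2"
    and "i3 \<noteq> i4" "j3 \<noteq> j4" "1 \<le> i3" "1 \<le> i4" "1 \<le> j3" "1 \<le> j4"
  shows "integrable M (\<lambda>x. H i1 i2 j1 j2 x * H i3 i4 j3 j4 x)"
    and "expectation (\<lambda>x. \<bar>H i1 i2 j1 j2 x * H i3 i4 j3 j4 x\<bar>) \<le> kappa"
proof -
  have m: "H i1 i2 j1 j2 \<in> borel_measurable M" "H i3 i4 j3 j4 \<in> borel_measurable M"
    using assms by (auto intro: H_measurable)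
  show "integrable M (\<lambda>x. H i1 i2 j1 j2 x * H i3 i4 j3 j4 x)"
    by (rule integrable_mult_of_square[OF m]) (use assms H_square in auto)
  show "expectation (\<lambda>x. \<bar>H i1 i2 j1 j2 x * H i3 i4 j3 j4 x\<bar>) \<le> kappa"
    using expectation_abs_mult_le[OF m H_square(1)[OF assms(1-6)] H_square(1)[OF assms(7-12)]]
    unfolding H_square(2)[OF assms(1-6)] H_square(2)[OF assms(7-12)] using kappa_nonneg by simp
qed

lemma cond_H:
  assumes i: "i1 \<noteq> i2" "{i1, i2} \<subseteq> {1..row_dim c N}" and j: "j1 \<noteq> j2" "{j1, j2} \<subseteq> {1..col_dim c N}"
  shows "AE x in M. CE N (H i1 i2 j1 j2) x = CE N (H 1 2 1 2) x"
proof -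
  obtain \<sigma>1 where \<sigma>1: "\<sigma>1 permutes {1..row_dim c N}" "\<sigma>1 1 = i1" "\<sigma>1 2 = i2"
    using exists_permutation_of_list[of "[i1, i2]" "row_dim c N"] i by (auto simp: nth_Cons')
  obtain \<sigma>2 where \<sigma>2: "\<sigma>2 permutes {1..col_dim c N}" "\<sigma>2 1 = j1" "\<sigma>2 2 = j2"
    using exists_permutation_of_list[of "[j1, j2]" "col_dim c N"] j by (auto simp: nth_Cons')
  let ?f = "\<lambda>y. h (quadruplet entry 1 2 1 2 y)"
  have f: "?f \<in> borel_measurable matrix_space"
    by (rule kernel_entry_measurable[OF kernel]) simp_all
  have 1: "(\<lambda>x. ?f (matrix_of Y x)) = H 1 2 1 2"
    by (simp add: quadruplet_matrix_of H_def fun_eq_iff)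
  have 2: "(\<lambda>x. ?f (matrix_of (\<lambda>i j. Y (\<sigma>1 i) (\<sigma>2 j)) x)) = H i1 i2 j1 j2"
    using \<sigma>1(2,3) \<sigma>2(2,3) by (simp add: quadruplet_matrix_of H_def fun_eq_iff) (simp add: quadruplet_def)
  show ?thesis
    using cond_exp_U_filtration_permute[OF kernel rce \<sigma>1(1) \<sigma>2(1) f] H_integrable[of 1 2 1 2]
    unfolding 1 2 by simp
qed

text \<open>Given \<open>\<F>\<^sub>N\<close>, a pair of quadruplets in the leading block matters only through the pattern of its coincidences:
a permutation carries any two quadruplets that share one row and no column to the first pair in the definition of
the asymptotic variance.\<close>

lemma cond_H_mult_H:
  assumes i: "distinct [i, i1, i2]" "{i, i1, i2} \<subseteq> {1..row_dim c N}"
    and j: "distinct [j1, j2, j3, j4]" "{j1, j2, j3, j4} \<subseteq> {1..col_dim c N}"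
  shows "AE x in M. CE N (\<lambda>x. H i i1 j1 j2 x * H i i2 j3 j4 x) x
    = CE N (\<lambda>x. H 1 2 1 2 x * H 1 3 3 4 x) x"
proof -
  obtain \<sigma>1 where \<sigma>1: "\<sigma>1 permutes {1..row_dim c N}" "\<forall>k\<in>{1..length [i, i1, i2]}. \<sigma>1 k = [i, i1, i2] ! (k - 1)"
    using exists_permutation_of_list[OF i(1), of "row_dim c N"] i(2) by auto
  have s1: "\<sigma>1 1 = i" "\<sigma>1 2 = i1" "\<sigma>1 3 = i2"
    using bspec[OF \<sigma>1(2), of 1] bspec[OF \<sigma>1(2), of 2] bspec[OF \<sigma>1(2), of 3] by (simp_all add: nth_Cons')
  obtain \<sigma>2 where \<sigma>2: "\<sigma>2 permutes {1..col_dim c N}" "\<forall>k\<in>{1..length [j1, j2, j3, j4]}. \<sigma>2 k = [j1, j2, j3, j4] ! (k - 1)"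
    using exists_permutation_of_list[OF j(1), of "col_dim c N"] j(2) by auto
  have s2: "\<sigma>2 1 = j1" "\<sigma>2 2 = j2" "\<sigma>2 3 = j3" "\<sigma>2 4 = j4"
    using bspec[OF \<sigma>2(2), of 1] bspec[OF \<sigma>2(2), of 2] bspec[OF \<sigma>2(2), of 3] bspec[OF \<sigma>2(2), of 4]
    by (simp_all add: nth_Cons')
  let ?f = "\<lambda>y. h (quadruplet entry 1 2 1 2 y) * h (quadruplet entry 1 3 3 4 y)"
  have f: "?f \<in> borel_measurable matrix_space"
    by (intro borel_measurable_times kernel_entry_measurable[OF kernel]) simp_all
  have 1: "(\<lambda>x. ?f (matrix_of Y x)) = (\<lambda>x. H 1 2 1 2 x * H 1 3 3 4 x)"
    by (simp add: quadruplet_matrix_of H_def fun_eq_iff)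
  have 2: "(\<lambda>x. ?f (matrix_of (\<lambda>i j. Y (\<sigma>1 i) (\<sigma>2 j)) x)) = (\<lambda>x. H i i1 j1 j2 x * H i i2 j3 j4 x)"
    using s1 s2 by (simp add: quadruplet_matrix_of H_def fun_eq_iff) (simp add: quadruplet_def)
  show ?thesis
    using cond_exp_U_filtration_permute[OF kernel rce \<sigma>1(1) \<sigma>2(1) f]
      H_mult_integrable(1)[of 1 2 1 2 1 3 3 4]
    unfolding 1 2 by simp
qed

lemma U_measurable_F: "U N \<in> borel_measurable (F N)"
proof (rule measurableI)
  fix A :: "real set" assume "A \<in> sets borel"
  then have "U_stat h Y (row_dim c N) (col_dim c N) -` A \<inter> space M
      \<in> {U_stat h Y k l -` B \<inter> space M | k l B. k \<ge> row_dim c N \<and> l \<ge> col_dim c N \<and> B \<in> sets borel}"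
    by blast
  then show "U N -` A \<inter> space (F N) \<in> sets (F N)"
    unfolding space_U_filtration unfolding U_filtration_def U_seq_def[abs_def]
    by (subst sets_measure_of) auto
qed auto

lemma U_measurable [measurable]: "U N \<in> borel_measurable M"
  by (rule measurable_from_subalg[OF subalgebra_F U_measurable_F])

definition quads :: "nat \<Rightarrow> nat \<Rightarrow> ((nat \<times> nat) \<times> (nat \<times> nat)) set" where
  "quads m n = ordered_pairs m \<times> ordered_pairs n"

definition Hq :: "(nat \<times> nat) \<times> (nat \<times> nat) \<Rightarrow> 'a \<Rightarrow> real" where
  "Hq s = H (fst (fst s)) (snd (fst s)) (fst (snd s)) (snd (snd s))"

lemma quads_finite [simp]: "finite (quads m n)"
  by (simp add: quads_def)

lemma quads_nonempty:
  assumes "2 \<le> m" "2 \<le> n"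
  shows "quads m n \<noteq> {}"
proof -
  have "((1, 2), (1, 2)) \<in> quads m n" using assms by (simp add: quads_def ordered_pairs_def)
  then show ?thesis by blast
qed

lemma dims_ge_2: "2 \<le> row_dim c N" "2 \<le> col_dim c N"
  by (simp_all add: row_dim_def col_dim_def)

lemma U_eq_average: "U N x = (\<Sum>s\<in>quads (row_dim c N) (col_dim c N). Hq s x) /
    real (card (quads (row_dim c N) (col_dim c N)))"
  unfolding U_seq_def U_stat_eq_ordered_mean[OF kernel] quads_def Hq_def H_def
  by (simp add: sum.cartesian_product case_prod_beta card_cartesian_product)

lemma quads_index:
  assumes "s \<in> quads m n"
  obtains i1 i2 j1 j2 where "Hq s = H i1 i2 j1 j2" "i1 \<noteq> i2" "j1 \<noteq> j2" "1 \<le> i1" "1 \<le> i2" "1 \<le> j1" "1 \<le> j2"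
    "{i1, i2} \<subseteq> {1..m}" "{j1, j2} \<subseteq> {1..n}"
  using assms by (intro that[of "fst (fst s)" "snd (fst s)" "fst (snd s)" "snd (snd s)"])
    (auto simp: quads_def ordered_pairs_def Hq_def)

lemma U_square_integrable: "integrable M (\<lambda>x. (U N x)\<^sup>2)"
  and U_square_le: "expectation (\<lambda>x. (U N x)\<^sup>2) \<le> kappa"
proof -
  note avg = expectation_convex_average_le[where g="\<lambda>x. x\<^sup>2" and f=Hq and b=kappa
      and S="quads (row_dim c N) (col_dim c N)"]
  have "integrable M (\<lambda>x. (U N x)\<^sup>2) \<and> expectation (\<lambda>x. (U N x)\<^sup>2) \<le> kappa"
    unfolding U_eq_average
    by (intro conjI avg convex_power2 quads_finite quads_nonempty dims_ge_2)
       (auto elim!: quads_index simp: H_square H_measurable)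
  then show "integrable M (\<lambda>x. (U N x)\<^sup>2)" "expectation (\<lambda>x. (U N x)\<^sup>2) \<le> kappa" by auto
qed

lemma U_integrable: "integrable M (U N)"
  by (rule square_integrable_imp_integrable[OF U_measurable U_square_integrable])

text \<open>\<open>U\<^sub>N\<close> is measurable for \<open>\<F>\<^sub>N\<close> and is an average of terms with one common conditional expectation.\<close>

lemma U_eq_cond_exp: "AE x in M. CE N (H 1 2 1 2) x = U N x"
proof -
  have "AE x in M. CE N (U N) x = CE N (H 1 2 1 2) x"
    unfolding U_eq_average[abs_def]
  proof (rule F.real_cond_exp_average_eq)
    fix s assume "s \<in> quads (row_dim c N) (col_dim c N)"
    then obtain i1 i2 j1 j2 where s: "Hq s = H i1 i2 j1 j2" "i1 \<noteq> i2" "j1 \<noteq> j2" "1 \<le> i1" "1 \<le> i2" "1 \<le> j1" "1 \<le> j2"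
      "{i1, i2} \<subseteq> {1..row_dim c N}" "{j1, j2} \<subseteq> {1..col_dim c N}"
      by (rule quads_index)
    show "integrable M (Hq s)" using s by (simp add: H_integrable)
    show "AE x in M. CE N (Hq s) x = CE N (H 1 2 1 2) x"
      unfolding s(1) using s by (intro cond_H) auto
  qed (use quads_nonempty dims_ge_2 in auto)
  moreover have "AE x in M. CE N (U N) x = U N x"
    by (rule F.real_cond_exp_F_meas[OF U_integrable U_measurable_F])
  ultimately show ?thesis by eventually_elim auto
qed

lemma U_backward_martingale: "AE x in M. CE (Suc N) (U N) x = U (Suc N) x"
proof -
  have Hi: "integrable M (H 1 2 1 2)" by (rule H_integrable) auto
  have "AE x in M. CE (Suc N) (CE N (H 1 2 1 2)) x
      = CE (Suc N) (H 1 2 1 2) x"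
    by (rule F.real_cond_exp_nested_subalg[OF subalgebra_F F_decreasing Hi])
  moreover have "AE x in M. CE (Suc N) (CE N (H 1 2 1 2)) x
      = CE (Suc N) (U N) x"
    by (rule F.real_cond_exp_cong[OF U_eq_cond_exp]) auto
  ultimately show ?thesis using U_eq_cond_exp[of "Suc N"] by eventually_elim auto
qed

lemma Uinf_eq: "Uinf = real_cond_exp M T (H 1 2 1 2)"
  by (simp add: U_infinity_def H_def[abs_def])

lemma Uinf_measurable_T: "Uinf \<in> borel_measurable T"
  unfolding Uinf_eq by simp

lemma Uinf_measurable [measurable]: "Uinf \<in> borel_measurable M"
  unfolding Uinf_eq by simp

lemma Uinf_square_integrable: "integrable M (\<lambda>x. (Uinf x)\<^sup>2)"
  and Uinf_square_le: "expectation (\<lambda>x. (Uinf x)\<^sup>2) \<le> kappa"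
proof -
  have m: "H 1 2 1 2 \<in> borel_measurable M" "integrable M (\<lambda>x. (H 1 2 1 2 x)\<^sup>2)"
    by (rule H_measurable H_square; simp)+
  show "integrable M (\<lambda>x. (Uinf x)\<^sup>2)" "expectation (\<lambda>x. (Uinf x)\<^sup>2) \<le> kappa"
    unfolding Uinf_eq kappa_def
    by (rule T.integrable_square_real_cond_exp[OF m] T.real_cond_exp_square_le[OF m])+
qed

lemma Uinf_integrable: "integrable M Uinf"
  by (rule square_integrable_imp_integrable[OF Uinf_measurable Uinf_square_integrable])

lemma U_L2_convergence: "(\<lambda>N. expectation (\<lambda>x. (U N x - Uinf x)\<^sup>2)) \<longlonglongrightarrow> 0"
proof -
  have "(\<lambda>N. expectation (\<lambda>x. (CE N (H 1 2 1 2) x - real_cond_exp M T (H 1 2 1 2) x)\<^sup>2)) \<longlonglongrightarrow> 0"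
    by (rule backward_martingale_L2[OF subalgebra_F F_decreasing space_T sets_T])
       (rule H_measurable H_square; simp)+
  moreover have "expectation (\<lambda>x. (CE N (H 1 2 1 2) x - real_cond_exp M T (H 1 2 1 2) x)\<^sup>2)
      = expectation (\<lambda>x. (U N x - Uinf x)\<^sup>2)" for N
    using U_eq_cond_exp[of N] by (intro integral_cong_AE) (auto simp: Uinf_eq)
  ultimately show ?thesis by simp
qed

lemma U_L1_convergence: "(\<lambda>N. expectation (\<lambda>x. \<bar>U N x - Uinf x\<bar>)) \<longlonglongrightarrow> 0"
proof (rule Lim_null_comparison)
  show "(\<lambda>N. sqrt (expectation (\<lambda>x. (U N x - Uinf x)\<^sup>2))) \<longlonglongrightarrow> 0"
    using tendsto_real_sqrt[OF U_L2_convergence] by simp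
  show "\<forall>\<^sub>F N in sequentially. norm (expectation (\<lambda>x. \<bar>U N x - Uinf x\<bar>)) \<le> sqrt (expectation (\<lambda>x. (U N x - Uinf x)\<^sup>2))"
    using abs_expectation_le_L2[OF _ integrable_square_diff[OF U_measurable Uinf_measurable U_square_integrable Uinf_square_integrable]]
    by (intro always_eventually allI) (auto simp: integral_nonneg_AE)
qed

text \<open>Factor \<open>U\<^sub>N\<^sup>2 - U\<^sub>\<infinity>\<^sup>2\<close> and apply the Cauchy-Schwarz inequality.\<close>

lemma U_square_L1_convergence: "(\<lambda>N. expectation (\<lambda>x. \<bar>(U N x)\<^sup>2 - (Uinf x)\<^sup>2\<bar>)) \<longlonglongrightarrow> 0"
proof (rule Lim_null_comparison)
  show "(\<lambda>N. sqrt (expectation (\<lambda>x. (U N x - Uinf x)\<^sup>2)) * sqrt (4 * kappa)) \<longlonglongrightarrow> 0"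
    using tendsto_mult_left_zero[OF tendsto_real_sqrt[OF U_L2_convergence, simplified]] .
  have "expectation (\<lambda>x. \<bar>(U N x)\<^sup>2 - (Uinf x)\<^sup>2\<bar>) \<le> sqrt (expectation (\<lambda>x. (U N x - Uinf x)\<^sup>2)) * sqrt (4 * kappa)" for N
  proof -
    note i = U_square_integrable[of N] Uinf_square_integrable
    have "expectation (\<lambda>x. \<bar>(U N x)\<^sup>2 - (Uinf x)\<^sup>2\<bar>) = expectation (\<lambda>x. \<bar>(U N x - Uinf x) * (U N x + Uinf x)\<bar>)"
      by (intro Bochner_Integration.integral_cong) (auto simp: power2_eq_square algebra_simps)
    also have "\<dots> \<le> sqrt (expectation (\<lambda>x. (U N x - Uinf x)\<^sup>2)) * sqrt (expectation (\<lambda>x. (U N x + Uinf x)\<^sup>2))"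
      by (rule expectation_abs_mult_le) (use i in \<open>auto intro: integrable_square_diff integrable_square_add\<close>)
    also have "expectation (\<lambda>x. (U N x + Uinf x)\<^sup>2) \<le> 4 * kappa"
    proof -
      have "expectation (\<lambda>x. (U N x + Uinf x)\<^sup>2) \<le> expectation (\<lambda>x. 2 * (U N x)\<^sup>2 + 2 * (Uinf x)\<^sup>2)"
      proof (rule integral_mono)
        show "(U N x + Uinf x)\<^sup>2 \<le> 2 * (U N x)\<^sup>2 + 2 * (Uinf x)\<^sup>2" for x
          using sum_squares_bound[of "U N x" "Uinf x"] by (simp add: power2_sum)
      qed (use i in \<open>auto intro: integrable_square_add\<close>)
      also have "\<dots> = 2 * expectation (\<lambda>x. (U N x)\<^sup>2) + 2 * expectation (\<lambda>x. (Uinf x)\<^sup>2)" using i by simp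
      also have "\<dots> \<le> 4 * kappa" using U_square_le[of N] Uinf_square_le by simp
      finally show ?thesis .
    qed
    finally show ?thesis by (simp add: mult_left_mono integral_nonneg_AE)
  qed
  then show "\<forall>\<^sub>F N in sequentially. norm (expectation (\<lambda>x. \<bar>(U N x)\<^sup>2 - (Uinf x)\<^sup>2\<bar>))
      \<le> sqrt (expectation (\<lambda>x. (U N x - Uinf x)\<^sup>2)) * sqrt (4 * kappa)"
    by (intro always_eventually allI) (simp add: integral_nonneg_AE)
qed

end

section \<open>Increments of the U-statistic when a row is added\<close>

definition distinct_quads :: "nat \<Rightarrow> (nat \<times> nat \<times> nat \<times> nat) set" where
  "distinct_quads n = (SIGMA a:{1..n}. SIGMA b:{1..n} - {a}. SIGMA c:{1..n} - {a, b}. {1..n} - {a, b, c})"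

lemma card_Sigma_const:
  assumes "finite A" "\<And>a. a \<in> A \<Longrightarrow> finite (B a)" "\<And>a. a \<in> A \<Longrightarrow> card (B a) = k"
  shows "card (Sigma A B) = card A * k"
  using assms by (subst card_SigmaI) auto

lemma card_distinct_quads: "card (distinct_quads n) = n * ((n - 1) * ((n - 2) * (n - 3)))"
proof -
  have 1: "card ({1..n} - {a}) = n - 1" if "a \<in> {1..n}" for a
    using that by (subst card_Diff_subset) auto
  have 2: "card ({1..n} - {a, b}) = n - 2" if "a \<in> {1..n}" "b \<in> {1..n} - {a}" for a b
    using that by (subst card_Diff_subset) auto
  have 3: "card ({1..n} - {a, b, c}) = n - 3" if "a \<in> {1..n}" "b \<in> {1..n} - {a}" "c \<in> {1..n} - {a, b}" for a b c
    using that by (subst card_Diff_subset) auto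
  have s2: "card (SIGMA c:{1..n} - {a, b}. {1..n} - {a, b, c}) = (n - 2) * (n - 3)"
    if "a \<in> {1..n}" "b \<in> {1..n} - {a}" for a b
    unfolding 2[OF that, symmetric] by (rule card_Sigma_const[OF _ _ 3[OF that]]) auto
  have s1: "card (SIGMA b:{1..n} - {a}. SIGMA c:{1..n} - {a, b}. {1..n} - {a, b, c}) = (n - 1) * ((n - 2) * (n - 3))"
    if "a \<in> {1..n}" for a
    unfolding 1[OF that, symmetric] by (rule card_Sigma_const[OF _ _ s2[OF that]]) auto
  have "card (distinct_quads n) = card {1..n} * ((n - 1) * ((n - 2) * (n - 3)))"
    unfolding distinct_quads_def by (rule card_Sigma_const[OF _ _ s1]) auto
  then show ?thesis by simp
qed

lemma finite_distinct_quads [simp]: "finite (distinct_quads n)"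
  unfolding distinct_quads_def by (intro finite_SigmaI) auto

text \<open>A triple \<open>(i, j\<^sub>1, j\<^sub>2)\<close> stands for the quadruplet that joins row \<open>i\<close> to one fixed further row. The pairs of
triples in \<open>disjoint_row_terms\<close> are those whose quadruplets have only the fixed row in common.\<close>

definition row_terms :: "nat \<Rightarrow> nat \<Rightarrow> (nat \<times> nat \<times> nat) set" where
  "row_terms p n = {1..p} \<times> ordered_pairs n"

definition disjoint_row_terms :: "nat \<Rightarrow> nat \<Rightarrow> ((nat \<times> nat \<times> nat) \<times> (nat \<times> nat \<times> nat)) set" where
  "disjoint_row_terms p n =
     (\<lambda>((i, i'), (a, b, c, d)). ((i, a, b), (i', c, d))) ` (ordered_pairs p \<times> distinct_quads n)"

lemma finite_row_terms [simp]: "finite (row_terms p n)"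
  by (simp add: row_terms_def)

lemma row_terms_nonempty:
  assumes "1 \<le> p" "2 \<le> n"
  shows "row_terms p n \<noteq> {}"
proof -
  have "(1, 1, 2) \<in> row_terms p n" using assms by (simp add: row_terms_def ordered_pairs_def)
  then show ?thesis by blast
qed

lemma disjoint_row_terms_subset: "disjoint_row_terms p n \<subseteq> row_terms p n \<times> row_terms p n"
  by (auto simp: disjoint_row_terms_def row_terms_def ordered_pairs_def distinct_quads_def)

definition overlap_fraction :: "nat \<Rightarrow> nat \<Rightarrow> real" where
  "overlap_fraction p n = 1 - real (card (disjoint_row_terms p n)) / real (card (row_terms p n \<times> row_terms p n))"

lemma overlap_fraction_eq:
  assumes "1 \<le> p" "3 \<le> n"
  shows "overlap_fraction p n =
    1 - (real p - 1) / real p * ((real n - 2) / real n * ((real n - 3) / (real n - 1)))"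
proof -
  have "card (disjoint_row_terms p n) = card (ordered_pairs p \<times> distinct_quads n)"
    unfolding disjoint_row_terms_def by (rule card_image) (auto simp: inj_on_def)
  then have "card (disjoint_row_terms p n) = p * (p - 1) * (n * ((n - 1) * ((n - 2) * (n - 3))))"
    by (simp add: card_cartesian_product card_ordered_pairs card_distinct_quads)
  moreover have "card (row_terms p n \<times> row_terms p n) = (p * (n * (n - 1))) * (p * (n * (n - 1)))"
    by (simp add: row_terms_def card_cartesian_product card_ordered_pairs)
  ultimately have "overlap_fraction p n = 1 - (real p * (real p - 1) * (real n * ((real n - 1) * ((real n - 2) * (real n - 3))))) /
      ((real p * (real n * (real n - 1))) * (real p * (real n * (real n - 1))))"
    using assms by (simp add: overlap_fraction_def of_nat_diff)
  also have "\<dots> = 1 - (real p - 1) / real p * ((real n - 2) / real n * ((real n - 3) / (real n - 1)))"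
    using assms by (simp add: divide_simps)
  finally show ?thesis .
qed

text \<open>Coincidences between independently chosen rows or columns become rare as the numbers of rows and columns grow.\<close>

lemma overlap_fraction_tendsto:
  assumes "filterlim p at_top sequentially" "filterlim n at_top sequentially"
  shows "(\<lambda>N. overlap_fraction (p N) (n N)) \<longlonglongrightarrow> 0"
proof -
  have 1: "(\<lambda>k. (real k - 1) / real k) \<longlonglongrightarrow> 1" by real_asymp
  have 2: "(\<lambda>k. (real k - 2) / real k * ((real k - 3) / (real k - 1))) \<longlonglongrightarrow> 1" by real_asymp
  have "(\<lambda>N. 1 - (real (p N) - 1) / real (p N) * ((real (n N) - 2) / real (n N) * ((real (n N) - 3) / (real (n N) - 1))))
      \<longlonglongrightarrow> 1 - 1 * 1"
    by (intro tendsto_diff tendsto_const tendsto_mult[OF filterlim_compose[OF 1 assms(1)] filterlim_compose[OF 2 assms(2)]])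
  moreover have "\<forall>\<^sub>F N in sequentially. overlap_fraction (p N) (n N)
      = 1 - (real (p N) - 1) / real (p N) * ((real (n N) - 2) / real (n N) * ((real (n N) - 3) / (real (n N) - 1)))"
    using eventually_compose_filterlim[OF eventually_ge_at_top[of 1] assms(1)]
      eventually_compose_filterlim[OF eventually_ge_at_top[of 3] assms(2)]
    by eventually_elim (rule overlap_fraction_eq)
  ultimately show ?thesis by (simp add: tendsto_cong)
qed

lemma sum_ordered_pairs_Suc:
  fixes f :: "nat \<Rightarrow> nat \<Rightarrow> real"
  assumes "\<And>a b. f a b = f b a"
  shows "(\<Sum>(a, b)\<in>ordered_pairs (Suc m). f a b) = (\<Sum>(a, b)\<in>ordered_pairs m. f a b) + 2 * (\<Sum>a\<in>{1..m}. f (Suc m) a)"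
proof -
  let ?A = "(\<lambda>a. (Suc m, a)) ` {1..m}" and ?B = "(\<lambda>a. (a, Suc m)) ` {1..m}"
  have "ordered_pairs (Suc m) = ordered_pairs m \<union> (?A \<union> ?B)"
    by (auto simp: ordered_pairs_def image_iff)
  moreover have "ordered_pairs m \<inter> (?A \<union> ?B) = {}" "?A \<inter> ?B = {}"
    by (auto simp: ordered_pairs_def)
  moreover have "(\<Sum>(a, b)\<in>?A. f a b) = (\<Sum>a\<in>{1..m}. f (Suc m) a)"
    by (subst sum.reindex) (auto simp: inj_on_def)
  moreover have "(\<Sum>(a, b)\<in>?B. f a b) = (\<Sum>a\<in>{1..m}. f (Suc m) a)"
    by (subst sum.reindex) (auto simp: inj_on_def intro!: sum.cong assms)
  ultimately show ?thesis by (simp add: sum.union_disjoint)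
qed

context rce_statistic
begin

definition last_row_index :: "nat \<Rightarrow> (nat \<times> nat \<times> nat) set" where
  "last_row_index N = row_terms (row_dim c N - 1) (col_dim c N)"

definition last_row_term :: "nat \<Rightarrow> nat \<times> nat \<times> nat \<Rightarrow> 'a \<Rightarrow> real" where
  "last_row_term N s = H (row_dim c N) (fst s) (fst (snd s)) (snd (snd s))"

text \<open>The mean of the kernel over the quadruplets that contain the last row of the block. When that row has just been
added, the difference between this mean and the U-statistic determines the increment
(\<open>row_step_increment\<close>); the definition makes sense at every level, which permits passing to the limit along
all \<open>N\<close>.\<close>

definition last_row_mean :: "nat \<Rightarrow> 'a \<Rightarrow> real" where
  "last_row_mean N x = (\<Sum>s\<in>last_row_index N. last_row_term N s x) / real (card (last_row_index N))"

lemma last_row_indexE: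
  assumes "s \<in> last_row_index N"
  obtains i j1 j2 where "last_row_term N s = H (row_dim c N) i j1 j2" "row_dim c N \<noteq> i" "j1 \<noteq> j2"
    "1 \<le> row_dim c N" "1 \<le> i" "1 \<le> j1" "1 \<le> j2"
    "{row_dim c N, i} \<subseteq> {1..row_dim c N}" "{j1, j2} \<subseteq> {1..col_dim c N}"
proof -
  obtain i j1 j2 where s: "s = (i, j1, j2)" by (cases s)
  show ?thesis
    by (rule that[of i j1 j2]) (use assms dims_ge_2[of N] in
        \<open>auto simp: s last_row_term_def last_row_index_def row_terms_def ordered_pairs_def\<close>)
qed

lemma last_row_index_finite [simp]: "finite (last_row_index N)"
  by (simp add: last_row_index_def)

lemma last_row_index_nonempty [simp]: "last_row_index N \<noteq> {}"
  unfolding last_row_index_def using dims_ge_2[of N] by (intro row_terms_nonempty) auto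

lemma last_row_term_measurable: "s \<in> last_row_index N \<Longrightarrow> last_row_term N s \<in> borel_measurable M"
  by (erule last_row_indexE) (simp add: H_measurable)

lemma last_row_term_square:
  assumes "s \<in> last_row_index N"
  shows "integrable M (\<lambda>x. (last_row_term N s x)\<^sup>2)" "expectation (\<lambda>x. (last_row_term N s x)\<^sup>2) = kappa"
  using assms by (auto elim!: last_row_indexE simp: H_square)

lemma last_row_term_integrable: "s \<in> last_row_index N \<Longrightarrow> integrable M (last_row_term N s)"
  by (erule last_row_indexE) (simp add: H_integrable)

lemma last_row_mean_measurable [measurable]: "last_row_mean N \<in> borel_measurable M"
  unfolding last_row_mean_def[abs_def]
  by (intro borel_measurable_divide borel_measurable_sum last_row_term_measurable) auto

lemma last_row_mean_square_integrable: "integrable M (\<lambda>x. (last_row_mean N x)\<^sup>2)"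
  unfolding last_row_mean_def
  by (rule expectation_convex_average_le(1)[where g="\<lambda>x. x\<^sup>2" and b=kappa])
     (simp_all add: convex_power2 last_row_term_square last_row_term_measurable)

lemma cond_last_row_mean: "AE x in M. CE N (last_row_mean N) x = U N x"
  unfolding last_row_mean_def[abs_def]
proof (rule F.real_cond_exp_average_eq)
  fix s assume s: "s \<in> last_row_index N"
  show "integrable M (last_row_term N s)" by (rule last_row_term_integrable[OF s])
  have "AE x in M. CE N (last_row_term N s) x = CE N (H 1 2 1 2) x"
    using s
  proof (rule last_row_indexE)
    fix i j1 j2
    assume *: "last_row_term N s = H (row_dim c N) i j1 j2" "row_dim c N \<noteq> i" "j1 \<noteq> j2"
      "{row_dim c N, i} \<subseteq> {1..row_dim c N}" "{j1, j2} \<subseteq> {1..col_dim c N}"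
    show ?thesis unfolding *(1) by (rule cond_H[OF *(2,4,3,5)])
  qed
  then show "AE x in M. CE N (last_row_term N s) x = U N x"
    using U_eq_cond_exp[of N] by eventually_elim simp
qed auto

lemma HH_integrable: "integrable M (\<lambda>x. H 1 2 1 2 x * H 1 3 3 4 x)"
  by (rule H_mult_integrable(1)) auto

text \<open>The square of the mean is an average over pairs of quadruplets. Pairs that share only the last row all have the
same conditional expectation, and the others form the overlap fraction.\<close>

lemma cond_last_row_mean_square_approx:
  "expectation (\<lambda>x. \<bar>CE N (\<lambda>x. (last_row_mean N x)\<^sup>2) x
       - CE N (\<lambda>x. H 1 2 1 2 x * H 1 3 3 4 x) x\<bar>)
    \<le> 2 * kappa * overlap_fraction (row_dim c N - 1) (col_dim c N)"
proof -
  let ?S = "last_row_index N"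
  define f2 where "f2 p x = last_row_term N (fst p) x * last_row_term N (snd p) x" for p x
  let ?D = "disjoint_row_terms (row_dim c N - 1) (col_dim c N)"
  let ?g = "CE N (\<lambda>x. H 1 2 1 2 x * H 1 3 3 4 x)"
  have sq: "(\<lambda>x. (last_row_mean N x)\<^sup>2) = (\<lambda>x. (\<Sum>p\<in>?S \<times> ?S. f2 p x) / real (card (?S \<times> ?S)))"
    unfolding last_row_mean_def
    by (simp add: power2_eq_square sum_product sum.cartesian_product card_cartesian_product f2_def case_prod_beta)
  have f2i: "integrable M (f2 p)" "expectation (\<lambda>x. \<bar>f2 p x\<bar>) \<le> kappa" if p: "p \<in> ?S \<times> ?S" for p
  proof -
    have s: "fst p \<in> ?S" "snd p \<in> ?S" using p by auto
    show "integrable M (f2 p)"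
      unfolding f2_def[abs_def]
      by (rule integrable_mult_of_square) (use s in \<open>simp_all add: last_row_term_measurable last_row_term_square\<close>)
    have "expectation (\<lambda>x. \<bar>f2 p x\<bar>) \<le> sqrt (expectation (\<lambda>x. (last_row_term N (fst p) x)\<^sup>2))
        * sqrt (expectation (\<lambda>x. (last_row_term N (snd p) x)\<^sup>2))"
      unfolding f2_def
      by (rule expectation_abs_mult_le) (use s in \<open>simp_all add: last_row_term_measurable last_row_term_square\<close>)
    then show "expectation (\<lambda>x. \<bar>f2 p x\<bar>) \<le> kappa"
      using s kappa_nonneg by (simp add: last_row_term_square)
  qed
  have "expectation (\<lambda>x. \<bar>CE N (\<lambda>x. (\<Sum>p\<in>?S \<times> ?S. f2 p x) / real (card (?S \<times> ?S))) x - ?g x\<bar>)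
      \<le> 2 * kappa * (1 - real (card ?D) / real (card (?S \<times> ?S)))"
  proof (rule F.real_cond_exp_average_approx)
    show "finite (?S \<times> ?S)" by simp
    show "?S \<times> ?S \<noteq> {}" by simp
    show "integrable M ?g" by (rule F.real_cond_exp_int(1)[OF HH_integrable])
    show "?D \<subseteq> ?S \<times> ?S" unfolding last_row_index_def by (rule disjoint_row_terms_subset)
    show "integrable M (f2 p)" if "p \<in> ?S \<times> ?S" for p by (rule f2i(1)[OF that])
    show "expectation (\<lambda>x. \<bar>f2 p x\<bar>) + expectation (\<lambda>x. \<bar>?g x\<bar>) \<le> 2 * kappa" if "p \<in> ?S \<times> ?S" for p
    proof -
      have "expectation (\<lambda>x. \<bar>?g x\<bar>) \<le> kappa"
        by (rule order_trans[OF F.real_cond_exp_L1_contraction[OF HH_integrable] H_mult_integrable(2)]) simp_all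
      then show ?thesis using f2i(2)[OF that] by linarith
    qed
    fix p assume "p \<in> ?D"
    then obtain i i' a b c' d where p: "p = ((i, a, b), (i', c', d))" "(i, i') \<in> ordered_pairs (row_dim c N - 1)"
      "(a, b, c', d) \<in> distinct_quads (col_dim c N)"
      unfolding disjoint_row_terms_def by (elim imageE) (auto split: prod.splits)
    have "AE x in M. CE N (\<lambda>x. H (row_dim c N) i a b x * H (row_dim c N) i' c' d x) x = ?g x"
    proof (rule cond_H_mult_H)
      show "distinct [row_dim c N, i, i']" "{row_dim c N, i, i'} \<subseteq> {1..row_dim c N}"
        using p(2) dims_ge_2[of N] by (auto simp: ordered_pairs_def)
      show "distinct [a, b, c', d]" "{a, b, c', d} \<subseteq> {1..col_dim c N}"
        using p(3) by (auto simp: distinct_quads_def)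
    qed
    then show "AE x in M. CE N (f2 p) x = ?g x"
      by (simp add: p(1) f2_def[abs_def] last_row_term_def)
  qed
  then show ?thesis unfolding sq by (simp add: overlap_fraction_def last_row_index_def)
qed

text \<open>The cut at 0 makes the variance proxy nonnegative at every point rather than almost everywhere; by
\<open>row_cov_eq\<close> it changes the conditional covariance on a null set only.\<close>

definition row_cov :: "'a \<Rightarrow> real" where
  "row_cov x = max 0 (cond_cov M T (H 1 2 1 2) (H 1 3 3 4) x)"

definition row_cov_raw :: "'a \<Rightarrow> real" where
  "row_cov_raw x = real_cond_exp M T (\<lambda>x. H 1 2 1 2 x * H 1 3 3 4 x) x - (Uinf x)\<^sup>2"

lemma row_cov_raw_measurable [measurable]: "row_cov_raw \<in> borel_measurable M"
  unfolding row_cov_raw_def[abs_def] by measurable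

lemma row_cov_raw_integrable: "integrable M row_cov_raw"
  unfolding row_cov_raw_def[abs_def]
  by (intro Bochner_Integration.integrable_diff T.real_cond_exp_int(1) HH_integrable Uinf_square_integrable)

text \<open>Both kernel values in the covariance lie in the leading block once it has four rows and columns, and then have the
same conditional expectation given \<open>\<F>\<^sub>N\<close>, hence given \<open>\<F>\<^sub>\<infinity>\<close>.\<close>

lemma cond_cov_eq_row_cov_raw: "AE x in M. cond_cov M T (H 1 2 1 2) (H 1 3 3 4) x = row_cov_raw x"
proof -
  obtain N where N: "4 \<le> row_dim c N" "4 \<le> col_dim c N"
  proof -
    have "\<forall>\<^sub>F N in sequentially. 4 \<le> row_dim c N" "\<forall>\<^sub>F N in sequentially. 4 \<le> col_dim c N"
      using row_dim_at_top[OF c_pos] row_dim_at_top[of "1 - c"] c_less_1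
      by (auto simp: filterlim_at_top col_dim_eq_row_dim)
    then have "\<forall>\<^sub>F N in sequentially. 4 \<le> row_dim c N \<and> 4 \<le> col_dim c N" by eventually_elim auto
    then show ?thesis using that by (auto simp: eventually_sequentially)
  qed
  have i: "integrable M (H 1 2 1 2)" "integrable M (H 1 3 3 4)" by (rule H_integrable; simp)+
  have "AE x in M. CE N (H 1 3 3 4) x = CE N (H 1 2 1 2) x"
    by (rule cond_H) (use N in auto)
  then have "AE x in M. real_cond_exp M T (CE N (H 1 3 3 4)) x
      = real_cond_exp M T (CE N (H 1 2 1 2)) x"
    by (rule T.real_cond_exp_cong) auto
  moreover have "AE x in M. real_cond_exp M T (CE N (H 1 3 3 4)) x = real_cond_exp M T (H 1 3 3 4) x"
    by (rule T.real_cond_exp_nested_subalg[OF subalgebra_F subalgebra_F_T i(2)])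
  moreover have "AE x in M. real_cond_exp M T (CE N (H 1 2 1 2)) x = real_cond_exp M T (H 1 2 1 2) x"
    by (rule T.real_cond_exp_nested_subalg[OF subalgebra_F subalgebra_F_T i(1)])
  ultimately show ?thesis
    by eventually_elim (simp add: cond_cov_def row_cov_raw_def Uinf_eq power2_eq_square)
qed

definition level_error :: "nat \<Rightarrow> real" where
  "level_error N = expectation (\<lambda>x. \<bar>CE N (\<lambda>x. (last_row_mean N x)\<^sup>2) x - (U N x)\<^sup>2 - row_cov_raw x\<bar>)"

lemma level_error_tendsto: "level_error \<longlonglongrightarrow> 0"
proof (rule Lim_null_comparison)
  let ?HH = "\<lambda>x. H 1 2 1 2 x * H 1 3 3 4 x"
  let ?C = "\<lambda>N. CE N ?HH" and ?C' = "real_cond_exp M T ?HH"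
  let ?b = "\<lambda>N. 2 * kappa * overlap_fraction (row_dim c N - 1) (col_dim c N)
    + expectation (\<lambda>x. \<bar>?C N x - ?C' x\<bar>) + expectation (\<lambda>x. \<bar>(U N x)\<^sup>2 - (Uinf x)\<^sup>2\<bar>)"
  have "filterlim (\<lambda>N. row_dim c N - 1) at_top sequentially"
    using filterlim_compose[OF filterlim_minus_const_nat_at_top[of 1] row_dim_at_top[OF c_pos]] .
  moreover have "filterlim (\<lambda>N. col_dim c N) at_top sequentially"
    unfolding col_dim_eq_row_dim using c_less_1 by (intro row_dim_at_top) auto
  ultimately have "(\<lambda>N. overlap_fraction (row_dim c N - 1) (col_dim c N)) \<longlonglongrightarrow> 0"
    by (rule overlap_fraction_tendsto)
  then have "?b \<longlonglongrightarrow> 2 * kappa * 0 + 0 + 0"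
    by (intro tendsto_add tendsto_mult tendsto_const U_square_L1_convergence
        backward_martingale_L1[OF subalgebra_F F_decreasing space_T sets_T HH_integrable])
  then show "?b \<longlonglongrightarrow> 0" by simp
  have "level_error N \<le> ?b N" for N
  proof -
    let ?W = "CE N (\<lambda>x. (last_row_mean N x)\<^sup>2)"
    have i: "integrable M ?W" "integrable M (?C N)" "integrable M ?C'" "integrable M (\<lambda>x. (U N x)\<^sup>2)"
      "integrable M (\<lambda>x. (Uinf x)\<^sup>2)" "integrable M row_cov_raw"
      by (intro F.real_cond_exp_int(1) T.real_cond_exp_int(1) last_row_mean_square_integrable HH_integrable
          U_square_integrable Uinf_square_integrable row_cov_raw_integrable)+
    have "level_error N \<le> expectation (\<lambda>x. \<bar>?W x - ?C N x\<bar> + \<bar>?C N x - ?C' x\<bar> + \<bar>(U N x)\<^sup>2 - (Uinf x)\<^sup>2\<bar>)"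
      unfolding level_error_def
    proof (rule integral_mono)
      fix x
      show "\<bar>?W x - (U N x)\<^sup>2 - row_cov_raw x\<bar> \<le> \<bar>?W x - ?C N x\<bar> + \<bar>?C N x - ?C' x\<bar> + \<bar>(U N x)\<^sup>2 - (Uinf x)\<^sup>2\<bar>"
        unfolding row_cov_raw_def by linarith
    qed (use i in auto)
    also have "\<dots> = expectation (\<lambda>x. \<bar>?W x - ?C N x\<bar>) + expectation (\<lambda>x. \<bar>?C N x - ?C' x\<bar>) + expectation (\<lambda>x. \<bar>(U N x)\<^sup>2 - (Uinf x)\<^sup>2\<bar>)"
      using i by simp
    also have "\<dots> \<le> ?b N" using cond_last_row_mean_square_approx[of N] by simp
    finally show ?thesis .
  qed
  then show "\<forall>\<^sub>F N in sequentially. norm (level_error N) \<le> ?b N"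
    by (intro always_eventually allI) (simp add: level_error_def integral_nonneg_AE)
qed

lemma cond_deviation_square:
  "AE x in M. CE N (\<lambda>x. (U N x - last_row_mean N x)\<^sup>2) x
    = CE N (\<lambda>x. (last_row_mean N x)\<^sup>2) x - (U N x)\<^sup>2"
proof -
  let ?W = "last_row_mean N"
  have i: "integrable M (\<lambda>x. U N x * ?W x)"
    by (rule integrable_mult_of_square[OF U_measurable last_row_mean_measurable U_square_integrable last_row_mean_square_integrable])
  have UF: "(\<lambda>x. (U N x)\<^sup>2) \<in> borel_measurable (F N)" using U_measurable_F[of N] by measurable
  have "AE x in M. CE N (\<lambda>x. (?W x)\<^sup>2 + (U N x)\<^sup>2 - 2 * (U N x * ?W x)) x
      = CE N (\<lambda>x. (?W x)\<^sup>2 + (U N x)\<^sup>2) x - CE N (\<lambda>x. 2 * (U N x * ?W x)) x"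
    by (rule F.real_cond_exp_diff)
       (use i last_row_mean_square_integrable U_square_integrable in auto)
  moreover have "AE x in M. CE N (\<lambda>x. (?W x)\<^sup>2 + (U N x)\<^sup>2) x
      = CE N (\<lambda>x. (?W x)\<^sup>2) x + CE N (\<lambda>x. (U N x)\<^sup>2) x"
    by (rule F.real_cond_exp_add[OF last_row_mean_square_integrable U_square_integrable])
  moreover have "AE x in M. CE N (\<lambda>x. (U N x)\<^sup>2) x = (U N x)\<^sup>2"
    by (rule F.real_cond_exp_F_meas[OF U_square_integrable UF])
  moreover have "AE x in M. CE N (\<lambda>x. 2 * (U N x * ?W x)) x
      = 2 * CE N (\<lambda>x. U N x * ?W x) x"
    by (rule F.real_cond_exp_cmult[OF i])
  moreover have "AE x in M. CE N (\<lambda>x. U N x * ?W x) x = U N x * CE N ?W x"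
    by (rule F.real_cond_exp_mult[OF U_measurable_F _ i]) simp
  moreover have "(\<lambda>x. (U N x - ?W x)\<^sup>2) = (\<lambda>x. (?W x)\<^sup>2 + (U N x)\<^sup>2 - 2 * (U N x * ?W x))"
    by (simp add: power2_diff fun_eq_iff)
  ultimately show ?thesis using cond_last_row_mean[of N]
    by (elim AE_mp) (auto intro!: AE_I2 simp: power2_eq_square)
qed

lemma deviation_square_integrable: "integrable M (\<lambda>x. (U N x - last_row_mean N x)\<^sup>2)"
  by (rule integrable_square_diff[OF U_measurable last_row_mean_measurable U_square_integrable last_row_mean_square_integrable])

text \<open>The conditional covariance is an \<open>L\<^sup>1\<close> limit of conditional expectations of the squares
\<open>(U\<^sub>N - last_row_mean N)\<^sup>2\<close>, hence nonnegative.\<close>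

lemma row_cov_eq: "AE x in M. row_cov x = row_cov_raw x"
proof -
  have neg: "expectation (\<lambda>x. max 0 (- row_cov_raw x)) \<le> level_error N" for N
    unfolding level_error_def
  proof (rule integral_mono_AE)
    have "AE x in M. 0 \<le> CE N (\<lambda>x. (U N x - last_row_mean N x)\<^sup>2) x"
      by (rule F.real_cond_exp_pos) auto
    with cond_deviation_square[of N]
    show "AE x in M. max 0 (- row_cov_raw x)
        \<le> \<bar>CE N (\<lambda>x. (last_row_mean N x)\<^sup>2) x - (U N x)\<^sup>2 - row_cov_raw x\<bar>"
      by eventually_elim auto
    show "integrable M (\<lambda>x. max 0 (- row_cov_raw x))"
      by (intro integrable_max) (use row_cov_raw_integrable in auto)
    show "integrable M (\<lambda>x. \<bar>CE N (\<lambda>x. (last_row_mean N x)\<^sup>2) x - (U N x)\<^sup>2 - row_cov_raw x\<bar>)"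
      by (intro integrable_abs Bochner_Integration.integrable_diff F.real_cond_exp_int(1)
          last_row_mean_square_integrable U_square_integrable row_cov_raw_integrable)
  qed
  have "expectation (\<lambda>x. max 0 (- row_cov_raw x)) \<le> 0"
    by (rule LIMSEQ_le_const[OF level_error_tendsto]) (use neg in auto)
  then have "expectation (\<lambda>x. max 0 (- row_cov_raw x)) = 0"
    by (intro antisym integral_nonneg_AE) auto
  then have "AE x in M. max 0 (- row_cov_raw x) = 0"
    by (subst (asm) integral_nonneg_eq_0_iff_AE) (use row_cov_raw_integrable in auto)
  then show ?thesis using cond_cov_eq_row_cov_raw
    by eventually_elim (auto simp: row_cov_def)
qed

text \<open>With \<open>m\<close> old rows, the old quadruplets have weight \<open>(m - 1)/(m + 1)\<close> in the new U-statistic and those that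
contain the new row have weight \<open>2/(m + 1)\<close>.\<close>

lemma row_step_increment:
  assumes "row_dim c (Suc N) = Suc (row_dim c N)" "col_dim c (Suc N) = col_dim c N"
  shows "U N x - U (Suc N) x = 2 / (real (row_dim c N) - 1) * (U (Suc N) x - last_row_mean (Suc N) x)"
proof -
  define m where "m = row_dim c N"
  define n where "n = col_dim c N"
  define q where "q = real (card (ordered_pairs n))"
  define f where "f a b = (\<Sum>(j1, j2)\<in>ordered_pairs n. H a b j1 j2 x)" for a b
  define SU where "SU = (\<Sum>(a, b)\<in>ordered_pairs m. f a b)"
  define SW where "SW = (\<Sum>a\<in>{1..m}. f (Suc m) a)"
  have m: "2 \<le> m" and n: "2 \<le> n" using dims_ge_2[of N] by (simp_all add: m_def n_def)
  have q: "0 < q" using n by (simp add: q_def card_ordered_pairs)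
  have "U N x = SU / (real m * (real m - 1) * q)"
    unfolding U_seq_def U_stat_eq_ordered_mean[OF kernel] m_def[symmetric] n_def[symmetric] SU_def f_def q_def H_def
      real_card_ordered_pairs[of m] ..
  moreover have "U (Suc N) x = (SU + 2 * SW) / ((real m + 1) * real m * q)"
  proof -
    have "f a b = f b a" for a b unfolding f_def by (simp add: H_swap_rows[of a b])
    then have "(\<Sum>(a, b)\<in>ordered_pairs (Suc m). f a b) = SU + 2 * SW"
      unfolding SU_def SW_def by (rule sum_ordered_pairs_Suc)
    then show ?thesis
      unfolding U_seq_def U_stat_eq_ordered_mean[OF kernel] assms m_def[symmetric] n_def[symmetric] f_def q_def H_def
        real_card_ordered_pairs[of "Suc m"] by (simp add: add.commute)
  qed
  moreover have "last_row_mean (Suc N) x = SW / (real m * q)"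
    unfolding last_row_mean_def last_row_index_def last_row_term_def assms m_def[symmetric] n_def[symmetric]
      SW_def f_def q_def row_terms_def
    by (simp add: card_cartesian_product sum.cartesian_product case_prod_beta)
  moreover have "SU / (real m * (real m - 1) * q) - (SU + 2 * SW) / ((real m + 1) * real m * q)
     = 2 / (real m - 1) * ((SU + 2 * SW) / ((real m + 1) * real m * q) - SW / (real m * q))"
  proof -
    define r where "r = real m"
    have r: "r - 1 > 0" "r > 0" "r + 1 > 0" using m by (auto simp: r_def)
    show ?thesis unfolding r_def[symmetric] using r q
      by (simp add: divide_simps) (simp add: algebra_simps)
  qed
  ultimately show ?thesis by (simp add: m_def)
qed

end

context rce_statistic
begin

lemma lindeberg_H_integrable:
  assumes "i1 \<noteq> i2" "j1 \<noteq> j2" "1 \<le> i1" "1 \<le> i2" "1 \<le> j1" "1 \<le> j2"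
  shows "integrable M (\<lambda>x. lindeberg_fun (a * H i1 i2 j1 j2 x))"
    and "expectation (\<lambda>x. lindeberg_fun (a * H i1 i2 j1 j2 x)) = expectation (\<lambda>x. lindeberg_fun (a * H 1 2 1 2 x))"
proof -
  have m: "(\<lambda>x. lindeberg_fun (a * H i1 i2 j1 j2 x)) \<in> borel_measurable M"
    using H_measurable[OF assms(3-6)] by measurable
  have "integrable M (\<lambda>x. (a * H i1 i2 j1 j2 x)\<^sup>2)"
    using H_square(1)[OF assms] by (simp add: power_mult_distrib)
  then show "integrable M (\<lambda>x. lindeberg_fun (a * H i1 i2 j1 j2 x))"
    by (rule Bochner_Integration.integrable_bound[OF _ m]) (simp add: lindeberg_fun_le_square)
  show "expectation (\<lambda>x. lindeberg_fun (a * H i1 i2 j1 j2 x)) = expectation (\<lambda>x. lindeberg_fun (a * H 1 2 1 2 x))"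
    using H_identically_distributed(1)[of "\<lambda>x. lindeberg_fun (a * x)", OF _ assms] by simp
qed

lemma lindeberg_average_le:
  fixes f :: "'i \<Rightarrow> 'a \<Rightarrow> real"
  assumes S: "finite S" "S \<noteq> {}"
    and f: "\<And>s. s \<in> S \<Longrightarrow> \<exists>i1 i2 j1 j2. f s = H i1 i2 j1 j2 \<and> i1 \<noteq> i2 \<and> j1 \<noteq> j2 \<and> 1 \<le> i1 \<and> 1 \<le> i2 \<and> 1 \<le> j1 \<and> 1 \<le> j2"
  shows "integrable M (\<lambda>x. lindeberg_fun (a * ((\<Sum>s\<in>S. f s x) / real (card S))))"
    and "expectation (\<lambda>x. lindeberg_fun (a * ((\<Sum>s\<in>S. f s x) / real (card S)))) \<le> expectation (\<lambda>x. lindeberg_fun (a * H 1 2 1 2 x))"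
proof -
  have eq: "a * ((\<Sum>s\<in>S. f s x) / real (card S)) = (\<Sum>s\<in>S. a * f s x) / real (card S)" for x
    by (simp add: sum_distrib_left)
  have 1: "(\<lambda>x. a * f s x) \<in> borel_measurable M" if sS: "s \<in> S" for s
  proof -
    obtain i1 i2 j1 j2 where s: "f s = H i1 i2 j1 j2" "1 \<le> i1" "1 \<le> i2" "1 \<le> j1" "1 \<le> j2"
      using f[OF sS] by blast
    have "f s \<in> borel_measurable M" unfolding s(1) by (rule H_measurable[OF s(2-5)])
    then show ?thesis by measurable
  qed
  have 2: "integrable M (\<lambda>x. lindeberg_fun (a * f s x))"
    "expectation (\<lambda>x. lindeberg_fun (a * f s x)) \<le> expectation (\<lambda>x. lindeberg_fun (a * H 1 2 1 2 x))" if sS: "s \<in> S" for s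
  proof -
    obtain i1 i2 j1 j2 where s: "f s = H i1 i2 j1 j2" "i1 \<noteq> i2" "j1 \<noteq> j2" "1 \<le> i1" "1 \<le> i2" "1 \<le> j1" "1 \<le> j2"
      using f[OF sS] by blast
    show "integrable M (\<lambda>x. lindeberg_fun (a * f s x))"
      "expectation (\<lambda>x. lindeberg_fun (a * f s x)) \<le> expectation (\<lambda>x. lindeberg_fun (a * H 1 2 1 2 x))"
      unfolding s(1) using lindeberg_H_integrable[OF s(2-7), of a] by simp_all
  qed
  note * = expectation_convex_average_le[OF convex_on_lindeberg_fun lindeberg_fun_nonneg lindeberg_fun_measurable S 1 2]
  show "integrable M (\<lambda>x. lindeberg_fun (a * ((\<Sum>s\<in>S. f s x) / real (card S))))"
    unfolding eq by (rule *(1))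
  show "expectation (\<lambda>x. lindeberg_fun (a * ((\<Sum>s\<in>S. f s x) / real (card S)))) \<le> expectation (\<lambda>x. lindeberg_fun (a * H 1 2 1 2 x))"
    unfolding eq by (rule *(2))
qed

text \<open>The U-statistic and the last-row mean are both averages of variables distributed like \<open>H 1 2 1 2\<close>; convexity also
splits their difference, at the price of the factor 2 in the argument.\<close>

lemma lindeberg_deviation_le:
  "integrable M (\<lambda>x. lindeberg_fun (a * (U N x - last_row_mean N x)))"
  "expectation (\<lambda>x. lindeberg_fun (a * (U N x - last_row_mean N x))) \<le> expectation (\<lambda>x. lindeberg_fun (2 * a * H 1 2 1 2 x))"
proof -
  let ?b = "expectation (\<lambda>x. lindeberg_fun (2 * a * H 1 2 1 2 x))"
  have U: "integrable M (\<lambda>x. lindeberg_fun (2 * a * U N x))" "expectation (\<lambda>x. lindeberg_fun (2 * a * U N x)) \<le> ?b"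
  proof -
    have "\<exists>i1 i2 j1 j2. Hq s = H i1 i2 j1 j2 \<and> i1 \<noteq> i2 \<and> j1 \<noteq> j2 \<and> 1 \<le> i1 \<and> 1 \<le> i2 \<and> 1 \<le> j1 \<and> 1 \<le> j2"
      if "s \<in> quads (row_dim c N) (col_dim c N)" for s
      using that by (rule quads_index) blast
    note * = lindeberg_average_le[OF quads_finite quads_nonempty[OF dims_ge_2] this]
    show "integrable M (\<lambda>x. lindeberg_fun (2 * a * U N x))"
      unfolding U_eq_average by (rule *(1))
    show "expectation (\<lambda>x. lindeberg_fun (2 * a * U N x)) \<le> ?b"
      unfolding U_eq_average by (rule *(2))
  qed
  have W: "integrable M (\<lambda>x. lindeberg_fun (2 * a * last_row_mean N x))" "expectation (\<lambda>x. lindeberg_fun (2 * a * last_row_mean N x)) \<le> ?b"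
  proof -
    have "\<exists>i1 i2 j1 j2. last_row_term N s = H i1 i2 j1 j2 \<and> i1 \<noteq> i2 \<and> j1 \<noteq> j2 \<and> 1 \<le> i1 \<and> 1 \<le> i2 \<and> 1 \<le> j1 \<and> 1 \<le> j2"
      if "s \<in> last_row_index N" for s
      using that by (rule last_row_indexE) blast
    note * = lindeberg_average_le[OF last_row_index_finite last_row_index_nonempty this]
    show "integrable M (\<lambda>x. lindeberg_fun (2 * a * last_row_mean N x))"
      unfolding last_row_mean_def by (rule *(1))
    show "expectation (\<lambda>x. lindeberg_fun (2 * a * last_row_mean N x)) \<le> ?b"
      unfolding last_row_mean_def by (rule *(2))
  qed
  have le: "lindeberg_fun (a * (U N x - last_row_mean N x))
      \<le> (lindeberg_fun (2 * a * U N x) + lindeberg_fun (2 * a * last_row_mean N x)) / 2" for x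
  proof -
    have "lindeberg_fun ((1 - 1/2) *\<^sub>R (2 * a * U N x) + (1/2) *\<^sub>R (- (2 * a * last_row_mean N x)))
        \<le> (1 - 1/2) * lindeberg_fun (2 * a * U N x) + (1/2) * lindeberg_fun (- (2 * a * last_row_mean N x))"
      by (rule convex_onD[OF convex_on_lindeberg_fun]) auto
    moreover have "(1 - 1/2) *\<^sub>R (2 * a * U N x) + (1/2) *\<^sub>R (- (2 * a * last_row_mean N x)) = a * (U N x - last_row_mean N x)"
      by (simp add: algebra_simps)
    ultimately show ?thesis by simp
  qed
  have avg: "integrable M (\<lambda>x. (lindeberg_fun (2 * a * U N x) + lindeberg_fun (2 * a * last_row_mean N x)) / 2)"
    using U(1) W(1) by simp
  show i: "integrable M (\<lambda>x. lindeberg_fun (a * (U N x - last_row_mean N x)))"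
  proof (rule Bochner_Integration.integrable_bound[OF avg])
    show "AE x in M. norm (lindeberg_fun (a * (U N x - last_row_mean N x)))
        \<le> norm ((lindeberg_fun (2 * a * U N x) + lindeberg_fun (2 * a * last_row_mean N x)) / 2)"
      using le by (intro AE_I2) (simp add: abs_of_nonneg)
  qed measurable
  have "expectation (\<lambda>x. lindeberg_fun (a * (U N x - last_row_mean N x)))
      \<le> expectation (\<lambda>x. (lindeberg_fun (2 * a * U N x) + lindeberg_fun (2 * a * last_row_mean N x)) / 2)"
    by (rule integral_mono[OF i avg le])
  also have "\<dots> = (expectation (\<lambda>x. lindeberg_fun (2 * a * U N x)) + expectation (\<lambda>x. lindeberg_fun (2 * a * last_row_mean N x))) / 2"
    using U(1) W(1) by simp
  also have "\<dots> \<le> (?b + ?b) / 2" by (intro divide_right_mono add_mono U(2) W(2)) simp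
  also have "\<dots> = ?b" by simp
  finally show "expectation (\<lambda>x. lindeberg_fun (a * (U N x - last_row_mean N x))) \<le> ?b" .
qed

text \<open>With \<open>a = 4/(c \<surd>N)\<close> the factor \<open>N a\<^sup>2\<close> is constant, and what is left is the second moment of \<open>H\<close> damped by
\<open>a \<bar>H\<bar>/(1 + a \<bar>H\<bar>)\<close>, which vanishes by dominated convergence.\<close>

lemma lindeberg_H_tendsto:
  "(\<lambda>N. 2 * real N * expectation (\<lambda>x. lindeberg_fun (4 / (c * sqrt (real N)) * H 1 2 1 2 x))) \<longlonglongrightarrow> 0"
proof -
  define a where "a N = 4 / (c * sqrt (real N))" for N
  have a0: "0 \<le> a N" for N using c_pos by (simp add: a_def)
  have alim: "a \<longlonglongrightarrow> 0" unfolding a_def[abs_def] using c_pos by real_asymp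
  let ?H = "H 1 2 1 2"
  define k where "k N x = a N * \<bar>?H x\<bar> / (1 + a N * \<bar>?H x\<bar>)" for N x
  have Hm [measurable]: "?H \<in> borel_measurable M" by (rule H_measurable) simp_all
  have k01: "0 \<le> k N x" "k N x \<le> 1" for N x
    using a0[of N] by (auto simp: k_def pos_divide_le_eq add_pos_nonneg)
  have "(\<lambda>N. expectation (\<lambda>x. (?H x)\<^sup>2 * k N x)) \<longlonglongrightarrow> expectation (\<lambda>x. 0)"
  proof (rule integral_dominated_convergence[where w="\<lambda>x. (?H x)\<^sup>2"])
    show "integrable M (\<lambda>x. (?H x)\<^sup>2)" by (rule H_square) simp_all
    show "AE x in M. (\<lambda>N. (?H x)\<^sup>2 * k N x) \<longlonglongrightarrow> 0"
    proof (rule AE_I2)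
      fix x
      have "(\<lambda>N. (?H x)\<^sup>2 * k N x) \<longlonglongrightarrow> (?H x)\<^sup>2 * (0 * \<bar>?H x\<bar> / (1 + 0 * \<bar>?H x\<bar>))"
        unfolding k_def by (intro tendsto_intros alim) auto
      then show "(\<lambda>N. (?H x)\<^sup>2 * k N x) \<longlonglongrightarrow> 0" by simp
    qed
    show "AE x in M. norm ((?H x)\<^sup>2 * k N x) \<le> (?H x)\<^sup>2" for N
      using k01 by (intro AE_I2) (simp add: abs_mult mult_left_le)
    show "(\<lambda>x. (?H x)\<^sup>2 * k N x) \<in> borel_measurable M" for N
      unfolding k_def by measurable
  qed simp
  then have "(\<lambda>N. 32 / c\<^sup>2 * expectation (\<lambda>x. (?H x)\<^sup>2 * k N x)) \<longlonglongrightarrow> 0"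
    by (intro tendsto_mult_right_zero) simp
  moreover have "\<forall>\<^sub>F N in sequentially. 32 / c\<^sup>2 * expectation (\<lambda>x. (?H x)\<^sup>2 * k N x)
      = 2 * real N * expectation (\<lambda>x. lindeberg_fun (4 / (c * sqrt (real N)) * ?H x))"
    using eventually_ge_at_top[of 1]
  proof eventually_elim
    case (elim N)
    have "2 * real N * expectation (\<lambda>x. lindeberg_fun (a N * ?H x))
        = 2 * real N * expectation (\<lambda>x. (a N)\<^sup>2 * ((?H x)\<^sup>2 * k N x))"
      using a0[of N] by (simp add: lindeberg_fun_eq k_def power_mult_distrib abs_mult mult.assoc)
    also have "\<dots> = (2 * real N * (a N)\<^sup>2) * expectation (\<lambda>x. (?H x)\<^sup>2 * k N x)" by simp
    also have "2 * real N * (a N)\<^sup>2 = 32 / c\<^sup>2"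
      using elim by (simp add: a_def power_divide power_mult_distrib)
    finally show ?case by (simp add: a_def)
  qed
  ultimately show ?thesis by (rule Lim_transform_eventually)
qed

definition row_step :: "nat \<Rightarrow> bool" where
  "row_step N \<longleftrightarrow> row_dim c (Suc N) = Suc (row_dim c N) \<and> col_dim c (Suc N) = col_dim c N"

text \<open>One vanishing sequence that bounds both error terms of a row step: the first summand serves the conditional
variance, the second one the Lindeberg condition.\<close>

definition row_step_error :: "nat \<Rightarrow> real" where
  "row_step_error N =
     4 / c\<^sup>2 * (level_error (Suc N) +
       (1 - (real (row_dim c N) - 1)\<^sup>2 / (real (row_dim c N) * (real (row_dim c N) + 1))) * expectation (\<lambda>x. \<bar>row_cov_raw x\<bar>))
     + 2 * real N * expectation (\<lambda>x. lindeberg_fun (4 / (c * sqrt (real N)) * H 1 2 1 2 x))"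

lemma row_step_error_tendsto: "row_step_error \<longlonglongrightarrow> 0"
proof -
  have "(\<lambda>m. 1 - (real m - 1)\<^sup>2 / (real m * (real m + 1))) \<longlonglongrightarrow> 0" by real_asymp
  from filterlim_compose[OF this row_dim_at_top[OF c_pos]]
  have "row_step_error \<longlonglongrightarrow> 4 / c\<^sup>2 * (0 + 0 * expectation (\<lambda>x. \<bar>row_cov_raw x\<bar>)) + 0"
    unfolding row_step_error_def[abs_def]
    by (intro tendsto_add tendsto_mult tendsto_const lindeberg_H_tendsto filterlim_compose[OF level_error_tendsto filterlim_Suc])
  then show ?thesis by simp
qed

lemma row_excess_bounds:
  assumes "2 \<le> m"
  shows "0 \<le> 1 - (real m - 1)\<^sup>2 / (real m * (real m + 1))"
proof -
  have "(real m - 1)\<^sup>2 \<le> real m * (real m + 1)"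
    using assms by (simp add: power2_eq_square algebra_simps)
  then show ?thesis using assms by (simp add: pos_divide_le_eq)
qed

lemma row_dim_minus_1_ge: "c * real N \<le> real (row_dim c N) - 1"
  using row_dim_bounds(1)[OF c_pos, of N] c_pos by (simp add: algebra_simps)

lemma row_step_lindeberg:
  assumes "row_step N"
  shows "(real N)\<^sup>2 * expectation (\<lambda>x. (U N x - U (Suc N) x)\<^sup>2 * min 1 (sqrt (real N) * \<bar>U N x - U (Suc N) x\<bar>))
    \<le> row_step_error N"
proof -
  let ?m = "real (row_dim c N)"
  let ?R = "\<lambda>x. U (Suc N) x - last_row_mean (Suc N) x"
  define Z where "Z x = U N x - U (Suc N) x" for x
  define a where "a = 2 / (c * sqrt (real N))"
  have [measurable]: "Z \<in> borel_measurable M" unfolding Z_def by measurable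
  have Z: "Z x = 2 / (?m - 1) * ?R x" for x
    unfolding Z_def using assms by (intro row_step_increment) (auto simp: row_step_def)
  have Z2: "integrable M (\<lambda>x. (Z x)\<^sup>2)"
    unfolding Z_def by (rule integrable_square_diff[OF U_measurable U_measurable U_square_integrable U_square_integrable])
  have le: "(real N)\<^sup>2 * ((Z x)\<^sup>2 * min 1 (sqrt (real N) * \<bar>Z x\<bar>)) \<le> 2 * real N * lindeberg_fun (a * ?R x)" for x
  proof (cases "N = 0")
    case False
    have "\<bar>sqrt (real N) * Z x\<bar> \<le> \<bar>a * ?R x\<bar>"
    proof -
      have "sqrt (real N) * (2 / (?m - 1)) \<le> sqrt (real N) * (2 / (c * real N))"
        using row_dim_minus_1_ge[of N] c_pos False dims_ge_2(1)[of N]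
        by (intro mult_left_mono divide_left_mono mult_pos_pos) (auto intro: less_le_trans[of 0 "c * real N"])
      also have "\<dots> = a"
      proof -
        define r where "r = sqrt (real N)"
        have "0 < r" "real N = r * r" using False by (simp_all add: r_def)
        then show ?thesis using c_pos by (simp add: a_def r_def[symmetric] field_simps)
      qed
      finally have "sqrt (real N) * (2 / (?m - 1)) * \<bar>?R x\<bar> \<le> a * \<bar>?R x\<bar>" by (rule mult_right_mono) simp
      moreover have "0 \<le> ?m - 1" using dims_ge_2(1)[of N] by simp
      moreover have "0 \<le> a" using c_pos by (simp add: a_def)
      ultimately show ?thesis unfolding Z abs_mult abs_divide by (simp only: abs_of_nonneg abs_numeral real_sqrt_ge_zero of_nat_0_le_iff mult.assoc)
    qed
    then have "lindeberg_fun (sqrt (real N) * Z x) \<le> lindeberg_fun (a * ?R x)" by (rule lindeberg_fun_mono)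
    with square_min_le_lindeberg_fun[of "sqrt (real N) * Z x"]
    have "(sqrt (real N) * Z x)\<^sup>2 * min 1 \<bar>sqrt (real N) * Z x\<bar> \<le> 2 * lindeberg_fun (a * ?R x)" by linarith
    then have "real N * ((sqrt (real N) * Z x)\<^sup>2 * min 1 \<bar>sqrt (real N) * Z x\<bar>) \<le> real N * (2 * lindeberg_fun (a * ?R x))"
      by (rule mult_left_mono) simp
    then show ?thesis by (simp add: power_mult_distrib abs_mult power2_eq_square mult_ac)
  qed simp
  have i: "integrable M (\<lambda>x. (Z x)\<^sup>2 * min 1 (sqrt (real N) * \<bar>Z x\<bar>))"
    by (rule Bochner_Integration.integrable_bound[OF Z2]) (auto intro!: mult_left_le simp: abs_mult)
  have "(real N)\<^sup>2 * expectation (\<lambda>x. (Z x)\<^sup>2 * min 1 (sqrt (real N) * \<bar>Z x\<bar>))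
      = expectation (\<lambda>x. (real N)\<^sup>2 * ((Z x)\<^sup>2 * min 1 (sqrt (real N) * \<bar>Z x\<bar>)))" by simp
  also have "\<dots> \<le> expectation (\<lambda>x. 2 * real N * lindeberg_fun (a * ?R x))"
    by (rule integral_mono[OF _ _ le]) (intro integrable_mult_right i lindeberg_deviation_le(1))+
  also have "\<dots> = 2 * real N * expectation (\<lambda>x. lindeberg_fun (a * ?R x))" by simp
  also have "\<dots> \<le> 2 * real N * expectation (\<lambda>x. lindeberg_fun (2 * a * H 1 2 1 2 x))"
    by (intro mult_left_mono lindeberg_deviation_le(2)) auto
  also have "2 * a = 4 / (c * sqrt (real N))" by (simp add: a_def)
  also have "2 * real N * expectation (\<lambda>x. lindeberg_fun (4 / (c * sqrt (real N)) * H 1 2 1 2 x)) \<le> row_step_error N"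
    unfolding row_step_error_def using row_excess_bounds[OF dims_ge_2(1)[of N]] c_pos
    by (auto simp: level_error_def integral_nonneg_AE intro!: add_nonneg_nonneg mult_nonneg_nonneg)
  finally show ?thesis by (simp add: Z_def)
qed

lemma row_cov_nonneg: "0 \<le> row_cov x"
  by (simp add: row_cov_def)

lemma row_cov_measurable_T: "row_cov \<in> borel_measurable T"
  unfolding row_cov_def[abs_def] cond_cov_def by measurable

lemma row_cov_measurable [measurable]: "row_cov \<in> borel_measurable M"
  by (rule measurable_from_subalg[OF subalgebra_T row_cov_measurable_T])

lemma row_cov_integrable: "integrable M row_cov"
  using integrable_cong_AE[OF row_cov_measurable row_cov_raw_measurable row_cov_eq] row_cov_raw_integrable by simp

text \<open>The exact coefficient is \<open>4/(m - 1)\<^sup>2\<close>. It is exchanged for \<open>4/m - 4/(m + 1)\<close>, whose sum telescopes; the relative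
error of this exchange is the second contribution to the error sequence.\<close>

lemma row_step_conditional_variance:
  assumes "row_step N"
  shows "(real N)\<^sup>2 * expectation (\<lambda>x. \<bar>CE (Suc N) (\<lambda>x. (U N x - U (Suc N) x)\<^sup>2) x
       - 4 * row_cov x * (1 / real (row_dim c N) - 1 / real (row_dim c (Suc N)))\<bar>) \<le> row_step_error N"
proof -
  let ?q = "\<lambda>x. 4 * row_cov x * (1 / real (row_dim c N) - 1 / real (row_dim c (Suc N)))"
  define m where "m = real (row_dim c N)"
  have m: "2 \<le> m" using dims_ge_2(1)[of N] by (simp add: m_def)
  define k where "k = 4 / (m - 1)\<^sup>2"
  define b where "b = 1 - (m - 1)\<^sup>2 / (m * (m + 1))"
  have k0: "0 \<le> k" by (simp add: k_def)
  have b0: "0 \<le> b" using row_excess_bounds[OF dims_ge_2(1)[of N]] by (simp add: b_def m_def)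
  have kb: "4 * (1 / m - 1 / (m + 1)) = k - k * b"
    using m by (simp add: k_def b_def divide_simps)
  let ?R = "\<lambda>x. U (Suc N) x - last_row_mean (Suc N) x"
  let ?D = "\<lambda>x. CE (Suc N) (\<lambda>x. (last_row_mean (Suc N) x)\<^sup>2) x - (U (Suc N) x)\<^sup>2"
  let ?E = "CE (Suc N) (\<lambda>x. (U N x - U (Suc N) x)\<^sup>2)"
  have step: "row_dim c (Suc N) = Suc (row_dim c N)" "col_dim c (Suc N) = col_dim c N"
    using assms by (simp_all add: row_step_def)
  have "(U N x - U (Suc N) x)\<^sup>2 = k * (?R x)\<^sup>2" for x
    unfolding row_step_increment[OF step] power_mult_distrib power_divide k_def m_def by simp
  then have "(\<lambda>x. (U N x - U (Suc N) x)\<^sup>2) = (\<lambda>x. k * (?R x)\<^sup>2)"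
    by (simp only:)
  then have "AE x in M. ?E x = k * CE (Suc N) (\<lambda>x. (?R x)\<^sup>2) x"
    using F.real_cond_exp_cmult[OF deviation_square_integrable[of "Suc N"], of "Suc N" k] by simp
  then have E: "AE x in M. ?E x = k * ?D x"
    using cond_deviation_square[of "Suc N"] by eventually_elim simp
  have i: "integrable M ?E" "integrable M ?D"
    by (intro F.real_cond_exp_int(1) Bochner_Integration.integrable_diff last_row_mean_square_integrable U_square_integrable
        integrable_square_diff[OF U_measurable U_measurable U_square_integrable U_square_integrable])+
  have "expectation (\<lambda>x. \<bar>?E x - ?q x\<bar>)
      \<le> expectation (\<lambda>x. k * \<bar>?D x - row_cov_raw x\<bar> + k * b * \<bar>row_cov_raw x\<bar>)"
  proof (rule integral_mono_AE)
    show "AE x in M. \<bar>?E x - ?q x\<bar>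
        \<le> k * \<bar>?D x - row_cov_raw x\<bar> + k * b * \<bar>row_cov_raw x\<bar>"
      using E row_cov_eq
    proof eventually_elim
      case (elim x)
      have "?q x = row_cov_raw x * (4 * (1 / m - 1 / (m + 1)))"
        using assms by (simp add: elim(2) row_step_def m_def add.commute)
      also have "\<dots> = k * row_cov_raw x - k * b * row_cov_raw x" unfolding kb by (simp add: algebra_simps)
      finally have "?E x - ?q x
          = k * (?D x - row_cov_raw x) + k * b * row_cov_raw x"
        unfolding elim(1) by (simp add: algebra_simps)
      then show ?case
        using abs_triangle_ineq[of "k * (?D x - row_cov_raw x)" "k * b * row_cov_raw x"] k0 b0
        by (simp add: abs_mult)
    qed
  qed (use i row_cov_integrable row_cov_raw_integrable in auto)
  also have "\<dots> = k * level_error (Suc N) + k * b * expectation (\<lambda>x. \<bar>row_cov_raw x\<bar>)"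
    using i(2) row_cov_raw_integrable by (simp add: level_error_def)
  also have "\<dots> = k * (level_error (Suc N) + b * expectation (\<lambda>x. \<bar>row_cov_raw x\<bar>))"
    by (simp add: algebra_simps)
  finally have "(real N)\<^sup>2 * expectation (\<lambda>x. \<bar>?E x - ?q x\<bar>)
      \<le> (real N)\<^sup>2 * (k * (level_error (Suc N) + b * expectation (\<lambda>x. \<bar>row_cov_raw x\<bar>)))"
    by (rule mult_left_mono) simp
  also have "\<dots> = ((real N)\<^sup>2 * k) * (level_error (Suc N) + b * expectation (\<lambda>x. \<bar>row_cov_raw x\<bar>))" by simp
  also have "\<dots> \<le> 4 / c\<^sup>2 * (level_error (Suc N) + b * expectation (\<lambda>x. \<bar>row_cov_raw x\<bar>))"
  proof (rule mult_right_mono)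
    have "(c * real N)\<^sup>2 \<le> (m - 1)\<^sup>2"
      using row_dim_minus_1_ge[of N] c_pos by (intro power_mono) (auto simp: m_def)
    then show "(real N)\<^sup>2 * k \<le> 4 / c\<^sup>2"
      using m c_pos by (simp add: k_def power_mult_distrib divide_simps mult_ac)
    show "0 \<le> level_error (Suc N) + b * expectation (\<lambda>x. \<bar>row_cov_raw x\<bar>)"
      using b0 by (simp add: level_error_def integral_nonneg_AE)
  qed
  also have "\<dots> \<le> row_step_error N"
    unfolding row_step_error_def b_def m_def by (simp add: integral_nonneg_AE)
  finally show ?thesis .
qed

lemma inverse_row_dim_decrement:
  assumes "1 \<le> N"
  shows "0 \<le> 1 / real (row_dim c N) - 1 / real (row_dim c (Suc N))"
    and "1 / real (row_dim c N) - 1 / real (row_dim c (Suc N)) \<le> 1 / (c * real N)\<^sup>2"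
proof -
  define m where "m = real (row_dim c N)"
  have m: "2 \<le> m" using dims_ge_2(1)[of N] by (simp add: m_def)
  consider "row_dim c (Suc N) = row_dim c N" | "row_dim c (Suc N) = Suc (row_dim c N)"
    using dim_step[OF c_pos c_less_1 c_irrational, of N] by auto
  then have "0 \<le> 1 / m - 1 / real (row_dim c (Suc N)) \<and> 1 / m - 1 / real (row_dim c (Suc N)) \<le> 1 / (c * real N)\<^sup>2"
  proof cases
    case 2
    have "1 / m - 1 / real (row_dim c (Suc N)) = 1 / (m * (m + 1))"
      using m 2 by (simp add: m_def field_simps)
    moreover have "(c * real N)\<^sup>2 \<le> m * (m + 1)"
      unfolding power2_eq_square using row_dim_minus_1_ge[of N] c_pos m by (intro mult_mono) (auto simp: m_def)
    moreover have "0 < (c * real N)\<^sup>2" using assms c_pos by simp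
    ultimately show ?thesis using m by (auto intro!: divide_left_mono)
  qed (simp add: m_def)
  then show "0 \<le> 1 / real (row_dim c N) - 1 / real (row_dim c (Suc N))"
    "1 / real (row_dim c N) - 1 / real (row_dim c (Suc N)) \<le> 1 / (c * real N)\<^sup>2"
    by (simp_all add: m_def)
qed

end

section \<open>Exchanging rows and columns\<close>

lemma RCE_transpose:
  assumes "RCE M Y"
  shows "RCE M (\<lambda>i j. Y j i)"
  unfolding RCE_def
proof (intro conjI allI impI)
  show "Y j i \<in> borel_measurable M" if "1 \<le> i" "1 \<le> j" for i j
    using assms that by (auto simp: RCE_def)
  fix \<sigma>1 \<sigma>2 assume \<sigma>: "finite_permutation \<sigma>1" "finite_permutation \<sigma>2"
  define tr :: "(nat \<times> nat \<Rightarrow> real) \<Rightarrow> nat \<times> nat \<Rightarrow> real"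
    where "tr y = (\<lambda>(i, j)\<in>{1..} \<times> {1..}. y (j, i))" for y
  have tr: "tr \<in> measurable matrix_space matrix_space"
    unfolding tr_def by (rule measurable_restrict) (auto intro!: measurable_component_singleton)
  have law: "matrix_law M (\<lambda>i j. X j i) = distr (matrix_law M X) matrix_space tr"
    if "\<And>i j. 1 \<le> i \<Longrightarrow> 1 \<le> j \<Longrightarrow> X i j \<in> borel_measurable M" for X :: "'a random_matrix"
  proof -
    have "(\<lambda>x. \<lambda>(i, j)\<in>{1..} \<times> {1..}. X j i x) = tr \<circ> (\<lambda>x. \<lambda>(i, j)\<in>{1..} \<times> {1..}. X i j x)"
      by (auto simp: tr_def fun_eq_iff)
    then show ?thesis
      unfolding matrix_law_def
      using distr_distr[OF tr matrix_of_measurable[OF that]] by (simp add: matrix_of_def[abs_def])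
  qed
  have Y: "Y i j \<in> borel_measurable M" if "1 \<le> i" "1 \<le> j" for i j
    using assms that by (auto simp: RCE_def)
  have perm_ge_1: "1 \<le> \<sigma> i" if perm: "finite_permutation \<sigma>" and i: "1 \<le> i" for \<sigma> :: "nat \<Rightarrow> nat" and i
  proof -
    obtain S where S: "S \<subseteq> {1..}" "\<sigma> permutes S" using perm by (auto simp: finite_permutation_def)
    then show ?thesis using i permutes_in_image[OF S(2), of i] permutes_not_in[OF S(2), of i]
      by (cases "i \<in> S") auto
  qed
  have "matrix_law M (\<lambda>i j. Y (\<sigma>2 j) (\<sigma>1 i)) = distr (matrix_law M (\<lambda>i j. Y (\<sigma>2 i) (\<sigma>1 j))) matrix_space tr"
  proof (rule law)
    show "Y (\<sigma>2 i) (\<sigma>1 j) \<in> borel_measurable M" if "1 \<le> i" "1 \<le> j" for i j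
      by (rule Y[OF perm_ge_1[OF \<sigma>(2) that(1)] perm_ge_1[OF \<sigma>(1) that(2)]])
  qed
  also have "\<dots> = distr (matrix_law M Y) matrix_space tr"
    using assms \<sigma> by (simp add: RCE_def)
  also have "\<dots> = matrix_law M (\<lambda>i j. Y j i)"
    by (rule law[OF Y, symmetric])
  finally show "matrix_law M (\<lambda>i j. Y (\<sigma>2 j) (\<sigma>1 i)) = matrix_law M (\<lambda>i j. Y j i)" .
qed

lemma transpose_2x2_nth: "transpose A $ i $ j = A $ j $ i"
  by (simp add: transpose_def)

lemma quadruplet_transpose:
  "transpose (quadruplet (\<lambda>i j. Y j i) j1 j2 i1 i2 x) = quadruplet Y i1 i2 j1 j2 x"
  by (simp add: quadruplet_def vec_eq_iff forall_2 transpose_2x2_nth)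

lemma quadruplet_kernel_transpose:
  assumes "quadruplet_kernel h"
  shows "quadruplet_kernel (\<lambda>A. h (transpose A))"
proof -
  have h: "h \<in> borel_measurable borel" and r: "\<And>A. h (vector [A $ 2, A $ 1]) = h A"
    and c: "\<And>A. h (\<chi> i. vector [A $ i $ 2, A $ i $ 1]) = h A"
    using assms by (auto simp: quadruplet_kernel_def)
  have "continuous_on UNIV (transpose :: real^2^2 \<Rightarrow> real^2^2)"
    unfolding transpose_def by (intro continuous_intros)
  then have "(\<lambda>A. h (transpose A)) \<in> borel_measurable borel"
    by (intro measurable_compose[OF borel_measurable_continuous_onI h])
  moreover have "h (transpose (vector [A $ 2, A $ 1] :: real^2^2)) = h (transpose A)" for A :: "real^2^2"
  proof -
    have "transpose (vector [A $ 2, A $ 1] :: real^2^2) = (\<chi> i. vector [transpose A $ i $ 2, transpose A $ i $ 1])"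
      unfolding vec_eq_iff forall_2 by (simp add: transpose_2x2_nth)
    then show ?thesis using c by simp
  qed
  moreover have "h (transpose (\<chi> i. vector [A $ i $ 2, A $ i $ 1] :: real^2^2)) = h (transpose A)" for A :: "real^2^2"
  proof -
    have "transpose (\<chi> i. vector [A $ i $ 2, A $ i $ 1] :: real^2^2) = vector [transpose A $ 2, transpose A $ 1]"
      unfolding vec_eq_iff forall_2 by (simp add: transpose_2x2_nth)
    then show ?thesis using r by simp
  qed
  ultimately show ?thesis by (simp add: quadruplet_kernel_def)
qed

lemma U_stat_transpose: "U_stat (\<lambda>A. h (transpose A)) (\<lambda>i j. Y j i) l k = U_stat h Y k l"
proof
  fix x
  have "(\<Sum>(i1, i2, j1, j2)\<in>{(i1, i2, j1, j2). 1 \<le> i1 \<and> i1 < i2 \<and> i2 \<le> l \<and> 1 \<le> j1 \<and> j1 < j2 \<and> j2 \<le> k}.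
        h (transpose (quadruplet (\<lambda>i j. Y j i) i1 i2 j1 j2 x)))
     = (\<Sum>(i1, i2, j1, j2)\<in>{(i1, i2, j1, j2). 1 \<le> i1 \<and> i1 < i2 \<and> i2 \<le> k \<and> 1 \<le> j1 \<and> j1 < j2 \<and> j2 \<le> l}.
        h (quadruplet Y i1 i2 j1 j2 x))"
    by (rule sum.reindex_bij_witness[of _ "\<lambda>(a, b, c, d). (c, d, a, b)" "\<lambda>(a, b, c, d). (c, d, a, b)"])
       (auto simp: quadruplet_transpose)
  then show "U_stat (\<lambda>A. h (transpose A)) (\<lambda>i j. Y j i) l k x = U_stat h Y k l x"
    by (simp add: U_stat_def)
qed

lemma row_dim_one_minus: "row_dim (1 - c) N = col_dim c N"
  and col_dim_one_minus: "col_dim (1 - c) N = row_dim c N"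
  by (simp_all add: col_dim_eq_row_dim)

text \<open>Together with the preceding lemmas this shows that transposition preserves the filtration and the U-statistics and
exchanges \<open>c\<close> with \<open>1 - c\<close>, so that adding a column becomes adding a row.\<close>

lemma U_filtration_transpose:
  "U_filtration M (\<lambda>A. h (transpose A)) (\<lambda>i j. Y j i) (1 - c) N = U_filtration M h Y c N"
  unfolding U_filtration_def U_stat_transpose row_dim_one_minus col_dim_one_minus
  by (rule arg_cong[where f="sigma (space M)"]) blast

lemma U_tail_transpose: "U_tail M (\<lambda>A. h (transpose A)) (\<lambda>i j. Y j i) (1 - c) = U_tail M h Y c"
  by (simp add: U_tail_def U_filtration_transpose)

lemma U_seq_transpose: "U_seq (\<lambda>A. h (transpose A)) (\<lambda>i j. Y j i) (1 - c) N = U_seq h Y c N"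
  by (simp add: U_seq_def U_stat_transpose row_dim_one_minus col_dim_one_minus)

section \<open>The central limit theorem for the U-statistics\<close>

text \<open>The law of \<open>\<surd>V\<close> times an independent standard normal variable.\<close>

lemma (in prob_space) gaussian_mixture_char:
  fixes V :: "'a \<Rightarrow> real"
  assumes V [measurable]: "V \<in> borel_measurable M" and V0: "\<And>x. 0 \<le> V x"
  shows "\<exists>\<nu>. real_distribution \<nu> \<and>
    (\<forall>t. char \<nu> t = complex_of_real (expectation (\<lambda>x. exp (- (1 / 2) * t\<^sup>2 * V x))))"
proof -
  interpret N: real_distribution std_normal_distribution by (rule real_dist_normal_dist)
  interpret P: pair_prob_space M std_normal_distribution ..
  define f where "f = (\<lambda>(x, z). sqrt (V x) * z)"
  have f [measurable]: "f \<in> borel_measurable (M \<Otimes>\<^sub>M std_normal_distribution)"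
    unfolding f_def by measurable
  let ?\<nu> = "distr (M \<Otimes>\<^sub>M std_normal_distribution) borel f"
  have "char ?\<nu> t = complex_of_real (expectation (\<lambda>x. exp (- (1 / 2) * t\<^sup>2 * V x)))" for t
  proof -
    have "char ?\<nu> t = (CLINT p|M \<Otimes>\<^sub>M std_normal_distribution. iexp (t * f p))"
      unfolding char_def by (subst integral_distr) auto
    also have "\<dots> = (CLINT x|M. CLINT z|std_normal_distribution. iexp (t * f (x, z)))"
      by (rule P.integral_fst'[symmetric], rule P.integrable_const_bound[of _ 1]) auto
    also have "\<dots> = (CLINT x|M. char std_normal_distribution (t * sqrt (V x)))"
      by (simp add: char_def f_def mult.assoc)
    also have "\<dots> = (CLINT x|M. complex_of_real (exp (- (1 / 2) * t\<^sup>2 * V x)))"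
      by (intro Bochner_Integration.integral_cong)
         (simp_all add: char_std_normal_distribution power_mult_distrib V0)
    finally show ?thesis by simp
  qed
  moreover have "real_distribution ?\<nu>"
    by (intro P.real_distribution_distr f)
  ultimately show ?thesis by blast
qed

text \<open>The conditional variance of a step is described by one formula for rows and columns: of its two summands, the one
belonging to the dimension that stays constant vanishes. The partial sums telescope to \<open>4 A/m\<^sub>N + 4 B/n\<^sub>N\<close>, where \<open>A\<close> and \<open>B\<close>
are the row and the column covariance, and \<open>N/m\<^sub>N\<close>
and \<open>N/n\<^sub>N\<close> tend to \<open>1/c\<close> and \<open>1/(1 - c)\<close>.\<close>

lemma (in rce_statistic) U_stat_clt_char:
  fixes t :: real
  defines "V \<equiv> \<lambda>x. 4 / c * row_cov x + 4 / (1 - c) *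
      rce_statistic.row_cov M (\<lambda>i j. Y j i) (\<lambda>A. h (transpose A)) (1 - c) x"
  shows "(\<lambda>N. char (distr M borel (\<lambda>x. sqrt (real N) * (U N x - Uinf x))) t)
      \<longlonglongrightarrow> complex_of_real (expectation (\<lambda>x. exp (- (1 / 2) * t\<^sup>2 * V x)))"
    and "V \<in> borel_measurable M" and "\<And>x. 0 \<le> V x"
    and "AE x in M. V x = asymptotic_variance M h Y c x"
proof -
  interpret tr: rce_statistic M "\<lambda>i j. Y j i" "\<lambda>A. h (transpose A)" "1 - c"
  proof
    show "1 - c \<notin> \<rat>" using c_irrational Rats_diff[OF Rats_1, of "1 - c"] by auto
    have "integrable M (\<lambda>x. (H 1 2 1 2 x)\<^sup>2)" by (rule H_square) simp_all
    then show "integrable M (\<lambda>x. (h (transpose (quadruplet (\<lambda>i j. Y j i) 1 2 1 2 x)))\<^sup>2)"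
      by (simp add: quadruplet_transpose H_def)
  qed (use c_pos c_less_1 RCE_transpose[OF rce] quadruplet_kernel_transpose[OF kernel] in auto)
  have trF: "tr.F N = F N" for N by (rule U_filtration_transpose)
  have trT: "tr.T = T" by (rule U_tail_transpose)
  have trU: "tr.U N = U N" for N by (rule U_seq_transpose)
  have trH: "tr.H j1 j2 i1 i2 = H i1 i2 j1 j2" for i1 i2 j1 j2
    by (simp add: tr.H_def H_def quadruplet_transpose fun_eq_iff)
  note tr_dims = row_dim_one_minus col_dim_one_minus
  define A where "A x = row_cov x" for x
  define B where "B x = tr.row_cov x" for x
  have A: "\<And>x. 0 \<le> A x" "A \<in> borel_measurable T" "integrable M A"
    unfolding A_def using row_cov_nonneg row_cov_measurable_T row_cov_integrable by auto
  have B: "\<And>x. 0 \<le> B x" "B \<in> borel_measurable T" "integrable M B"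
    unfolding B_def using tr.row_cov_nonneg tr.row_cov_measurable_T tr.row_cov_integrable trT by auto
  have [measurable]: "A \<in> borel_measurable M" "B \<in> borel_measurable M" using A(3) B(3) by auto
  have V: "V = (\<lambda>x. 4 / c * A x + 4 / (1 - c) * B x)" by (simp add: V_def A_def B_def)
  show V0: "0 \<le> V x" for x using A(1) B(1) c_pos c_less_1 by (simp add: V)
  show Vm: "V \<in> borel_measurable M" unfolding V by measurable
  have "AE x in M. A x = cond_cov M T (H 1 2 1 2) (H 1 3 3 4) x"
    using row_cov_eq cond_cov_eq_row_cov_raw by eventually_elim (simp add: A_def)
  moreover have "AE x in M. B x = cond_cov M T (H 1 2 1 2) (H 3 4 1 3) x"
    using tr.row_cov_eq tr.cond_cov_eq_row_cov_raw unfolding trT trH by eventually_elim (simp add: B_def)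
  ultimately show "AE x in M. V x = asymptotic_variance M h Y c x"
    by eventually_elim (simp add: V asymptotic_variance_def H_def[abs_def])

  define m where "m N = real (row_dim c N)" for N
  define n where "n N = real (col_dim c N)" for N
  have mn: "0 < m N" "0 < n N" for N using dims_ge_2[of N] by (simp_all add: m_def n_def)
  define Q where "Q j x = 4 * A x * (1 / m j - 1 / m (Suc j)) + 4 * B x * (1 / n j - 1 / n (Suc j))" for j x
  define S where "S N x = 4 * A x / m N + 4 * B x / n N" for N x
  have dec: "0 \<le> 1 / m N - 1 / m (Suc N)" "0 \<le> 1 / n N - 1 / n (Suc N)" for N
  proof -
    have "m N \<le> m (Suc N)" "n N \<le> n (Suc N)"
      using row_dim_mono[OF c_pos, of N "Suc N"] row_dim_mono[of "1 - c" N "Suc N"] c_less_1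
      by (simp_all add: m_def n_def col_dim_eq_row_dim)
    then show "0 \<le> 1 / m N - 1 / m (Suc N)" "0 \<le> 1 / n N - 1 / n (Suc N)"
      using mn[of N] by (simp_all add: frac_le)
  qed
  have Q0: "0 \<le> Q j x" for j x
    unfolding Q_def using A(1) B(1) dec by (intro add_nonneg_nonneg mult_nonneg_nonneg) auto
  have QT: "Q j \<in> borel_measurable T" for j unfolding Q_def[abs_def] using A(2) B(2) by measurable
  have QF: "Q j \<in> borel_measurable (F k)" for j k by (rule measurable_from_subalg[OF subalgebra_F_T QT])
  have [measurable]: "Q j \<in> borel_measurable M" for j by (rule measurable_from_subalg[OF subalgebra_T QT])
  have Qi: "integrable M (Q j)" for j unfolding Q_def[abs_def] using A(3) B(3) by simp
  have Uinf_F: "Uinf \<in> borel_measurable (F k)" for k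
    by (rule measurable_from_subalg[OF subalgebra_F_T Uinf_measurable_T])
  have step: "row_step j \<and> n (Suc j) = n j \<or> tr.row_step j \<and> m (Suc j) = m j" for j
    using dim_step[OF c_pos c_less_1 c_irrational, of j]
    by (auto simp: row_step_def tr.row_step_def tr_dims m_def n_def)
  let ?err = "\<lambda>j. \<bar>row_step_error j\<bar> + \<bar>tr.row_step_error j\<bar>"
  have err: "?err \<longlonglongrightarrow> 0"
    using tendsto_add[OF tendsto_rabs[OF row_step_error_tendsto] tendsto_rabs[OF tr.row_step_error_tendsto]] by simp

  let ?cv = "\<lambda>j. (real j)\<^sup>2 * expectation (\<lambda>x. \<bar>CE (Suc j) (\<lambda>x. (U j x - U (Suc j) x)\<^sup>2) x - Q j x\<bar>)"
  have cond_var: "?cv \<longlonglongrightarrow> 0"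
  proof (rule Lim_null_comparison[OF _ err], intro always_eventually allI)
    fix j
    have "?cv j \<le> ?err j"
      using step[of j]
    proof
      assume s: "row_step j \<and> n (Suc j) = n j"
      have "Q j = (\<lambda>x. 4 * row_cov x * (1 / real (row_dim c j) - 1 / real (row_dim c (Suc j))))"
        using s by (simp add: Q_def fun_eq_iff A_def m_def)
      then show ?thesis using row_step_conditional_variance[of j] s by simp
    next
      assume s: "tr.row_step j \<and> m (Suc j) = m j"
      have "Q j = (\<lambda>x. 4 * tr.row_cov x * (1 / real (col_dim c j) - 1 / real (col_dim c (Suc j))))"
        using s by (simp add: Q_def fun_eq_iff B_def n_def)
      then show ?thesis using tr.row_step_conditional_variance[of j] s unfolding trF trU tr_dims by simp
    qed
    then show "norm (?cv j) \<le> ?err j"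
      by (simp add: integral_nonneg_AE abs_mult)
  qed
  let ?ln = "\<lambda>j. (real j)\<^sup>2 * expectation (\<lambda>x. (U j x - U (Suc j) x)\<^sup>2 * min 1 (sqrt (real j) * \<bar>U j x - U (Suc j) x\<bar>))"
  have lindeberg: "?ln \<longlonglongrightarrow> 0"
  proof (rule Lim_null_comparison[OF _ err], intro always_eventually allI)
    fix j
    have "?ln j \<le> ?err j"
      using step[of j]
    proof
      assume "row_step j \<and> n (Suc j) = n j"
      then show ?thesis using row_step_lindeberg[of j] by linarith
    next
      assume "tr.row_step j \<and> m (Suc j) = m j"
      then show ?thesis using tr.row_step_lindeberg[of j] unfolding trU by linarith
    qed
    then show "norm (?ln j) \<le> ?err j"
      by (simp add: integral_nonneg_AE abs_mult)
  qed
  have Qsmall: "(\<lambda>j. (real j)\<^sup>2 * expectation (\<lambda>x. Q j x * min 1 (real j * Q j x))) \<longlonglongrightarrow> 0"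
  proof -
    \<comment> \<open>An integrable bound of \<open>j\<^sup>2 Q j\<close> that does not depend on \<open>j\<close>.\<close>
    define D where "D x = 4 / c\<^sup>2 * A x + 4 / (1 - c)\<^sup>2 * B x" for x
    have D0: "0 \<le> D x" for x using A(1) B(1) by (simp add: D_def)
    have [measurable]: "D \<in> borel_measurable M" unfolding D_def[abs_def] by measurable
    have Di: "integrable M D" unfolding D_def[abs_def] using A(3) B(3) by simp
    have QD: "(real j)\<^sup>2 * Q j x \<le> D x" if j: "1 \<le> j" for j x
    proof -
      have "Q j x \<le> 4 * A x * (1 / (c * real j)\<^sup>2) + 4 * B x * (1 / ((1 - c) * real j)\<^sup>2)"
        unfolding Q_def using A(1) B(1) inverse_row_dim_decrement(2)[OF j] tr.inverse_row_dim_decrement(2)[OF j]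
        by (intro add_mono mult_left_mono) (auto simp: m_def n_def tr_dims)
      then have "(real j)\<^sup>2 * Q j x \<le> (real j)\<^sup>2 * (4 * A x * (1 / (c * real j)\<^sup>2) + 4 * B x * (1 / ((1 - c) * real j)\<^sup>2))"
        by (rule mult_left_mono) simp
      also have "\<dots> = D x" using j by (simp add: D_def power_mult_distrib distrib_left)
      finally show ?thesis .
    qed
    have lim: "(\<lambda>j. expectation (\<lambda>x. D x * min 1 (D x / real j))) \<longlonglongrightarrow> expectation (\<lambda>x. 0)"
    proof (rule integral_dominated_convergence[where w=D])
      show "AE x in M. (\<lambda>j. D x * min 1 (D x / real j)) \<longlonglongrightarrow> 0"
      proof (rule AE_I2)
        fix x
        have "(\<lambda>j. D x * min 1 (D x / real j)) \<longlonglongrightarrow> D x * min 1 0"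
          by (intro tendsto_intros lim_const_over_n)
        then show "(\<lambda>j. D x * min 1 (D x / real j)) \<longlonglongrightarrow> 0" by simp
      qed
      show "AE x in M. norm (D x * min 1 (D x / real j)) \<le> D x" for j
        using D0 by (intro AE_I2) (simp add: abs_mult mult_left_le)
    qed (use Di in auto)
    show ?thesis
    proof (rule Lim_null_comparison)
      show "(\<lambda>j. expectation (\<lambda>x. D x * min 1 (D x / real j))) \<longlonglongrightarrow> 0" using lim by simp
      show "\<forall>\<^sub>F j in sequentially. norm ((real j)\<^sup>2 * expectation (\<lambda>x. Q j x * min 1 (real j * Q j x)))
          \<le> expectation (\<lambda>x. D x * min 1 (D x / real j))"
        using eventually_ge_at_top[of 1]
      proof eventually_elim
        case (elim j)
        have "(real j)\<^sup>2 * expectation (\<lambda>x. Q j x * min 1 (real j * Q j x))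
            = expectation (\<lambda>x. ((real j)\<^sup>2 * Q j x) * min 1 (real j * Q j x))"
          by (simp add: mult.assoc)
        also have "\<dots> \<le> expectation (\<lambda>x. D x * min 1 (D x / real j))"
        proof (rule integral_mono)
          show "integrable M (\<lambda>x. D x * min 1 (D x / real j))"
            by (rule Bochner_Integration.integrable_bound[OF Di]) (auto simp: abs_mult D0 intro!: mult_left_le)
          show "integrable M (\<lambda>x. ((real j)\<^sup>2 * Q j x) * min 1 (real j * Q j x))"
            by (rule Bochner_Integration.integrable_bound[OF integrable_mult_right[OF Qi[of j], of "(real j)\<^sup>2"]])
               (auto simp: abs_mult Q0 intro!: mult_left_le)
          fix x
          have "real j * Q j x \<le> D x / real j"
            using QD[OF elim, of x] elim by (simp add: pos_le_divide_eq power2_eq_square mult_ac)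
          then show "((real j)\<^sup>2 * Q j x) * min 1 (real j * Q j x) \<le> D x * min 1 (D x / real j)"
            using QD[OF elim, of x] Q0[of j x] D0[of x] by (intro mult_mono min.mono) auto
        qed
        finally show ?case by (simp add: integral_nonneg_AE Q0)
      qed
    qed
  qed
  have inv_lim: "(\<lambda>L. 1 / m L) \<longlonglongrightarrow> 0" "(\<lambda>L. 1 / n L) \<longlonglongrightarrow> 0"
    unfolding m_def n_def col_dim_eq_row_dim
    by (rule filterlim_compose[OF lim_1_over_n row_dim_at_top]; simp add: c_pos c_less_1)+
  show "(\<lambda>N. char (distr M borel (\<lambda>x. sqrt (real N) * (U N x - Uinf x))) t)
      \<longlonglongrightarrow> complex_of_real (expectation (\<lambda>x. exp (- (1 / 2) * t\<^sup>2 * V x)))"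
  proof (rule backward_martingale_clt[where F=F and Q=Q and S=S, OF subalgebra_F F_decreasing U_measurable_F U_square_integrable
        U_backward_martingale Uinf_F Uinf_integrable U_L1_convergence QF Q0 Qi cond_var lindeberg Qsmall])
    fix N x
    have sum: "(\<Sum>j\<in>{N..<L}. Q j x) = 4 * A x * (1 / m N - 1 / m L) + 4 * B x * (1 / n N - 1 / n L)" if "N \<le> L" for L
      using that by (induction rule: dec_induct) (simp_all add: Q_def algebra_simps)
    have "(\<lambda>L. 4 * A x * (1 / m N - 1 / m L) + 4 * B x * (1 / n N - 1 / n L))
        \<longlonglongrightarrow> 4 * A x * (1 / m N - 0) + 4 * B x * (1 / n N - 0)"
      by (intro tendsto_intros inv_lim)
    then have "(\<lambda>L. 4 * A x * (1 / m N - 1 / m L) + 4 * B x * (1 / n N - 1 / n L)) \<longlonglongrightarrow> S N x"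
      by (simp add: S_def)
    then show "(\<lambda>L. \<Sum>j\<in>{N..<L}. Q j x) \<longlonglongrightarrow> S N x"
      by (rule Lim_transform_eventually) (rule eventually_sequentiallyI[of N], rule sum[symmetric])
  next
    fix x
    have "(\<lambda>N. 4 * A x * (real N / m N) + 4 * B x * (real N / n N)) \<longlonglongrightarrow> 4 * A x * (1 / c) + 4 * B x * (1 / (1 - c))"
      unfolding m_def n_def col_dim_eq_row_dim using c_pos c_less_1
      by (intro tendsto_intros row_dim_ratio) auto
    then show "(\<lambda>N. real N * S N x) \<longlonglongrightarrow> V x"
      by (simp add: S_def V algebra_simps)
  next
    show "S N \<in> borel_measurable M" for N unfolding S_def[abs_def] by measurable
    show "V \<in> borel_measurable M" by (rule Vm)
  qed
qed

theorem theorem2p5: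
  fixes M :: "'a measure" and Y :: "nat \<Rightarrow> nat \<Rightarrow> 'a \<Rightarrow> real"
    and h :: "real^2^2 \<Rightarrow> real" and c :: real
  assumes "prob_space M"
    and "0 < c" and "c < 1" and "c \<notin> \<rat>"
    and "RCE M Y"
    and "quadruplet_kernel h"
    and "integrable M (\<lambda>\<omega>. (h (quadruplet Y 1 2 1 2 \<omega>))\<^sup>2)"
    and "\<P>(\<omega> in M. asymptotic_variance M h Y c \<omega> > 0) > 0"
  shows "\<exists>(\<Omega> :: real measure) (W :: real \<Rightarrow> real).
    prob_space \<Omega> \<and> W \<in> borel_measurable \<Omega> \<and>
    (\<forall>t. char (distr \<Omega> borel W) t =
       complex_of_real (\<integral>\<omega>. exp (- (1 / 2) * t\<^sup>2 * asymptotic_variance M h Y c \<omega>) \<partial>M)) \<and>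
    weak_conv_m
      (\<lambda>N. distr M borel (\<lambda>\<omega>. sqrt (real N) * (U_seq h Y c N \<omega> - U_infinity M h Y c \<omega>)))
      (distr \<Omega> borel W)"
proof -
  interpret rce_statistic M Y h c
    using assms by (simp add: rce_statistic_def rce_statistic_axioms_def)
  define V where "V x = 4 / c * row_cov x + 4 / (1 - c) *
      rce_statistic.row_cov M (\<lambda>i j. Y j i) (\<lambda>A. h (transpose A)) (1 - c) x" for x
  note clt = U_stat_clt_char[folded V_def]
  obtain \<nu> where \<nu>: "real_distribution \<nu>"
    "\<And>t. char \<nu> t = complex_of_real (expectation (\<lambda>x. exp (- (1 / 2) * t\<^sup>2 * V x)))"
    using gaussian_mixture_char[OF clt(2,3)] by blast
  interpret \<nu>: real_distribution \<nu> by (rule \<nu>(1))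
  have id: "distr \<nu> borel (\<lambda>x. x) = \<nu>" by (rule distr_id2) simp
  have V_eq: "expectation (\<lambda>x. exp (- (1 / 2) * t\<^sup>2 * V x))
      = expectation (\<lambda>x. exp (- (1 / 2) * t\<^sup>2 * asymptotic_variance M h Y c x))" for t
  proof (rule integral_cong_AE)
    show "(\<lambda>x. exp (- (1 / 2) * t\<^sup>2 * V x)) \<in> borel_measurable M" using clt(2) by measurable
    show "(\<lambda>x. exp (- (1 / 2) * t\<^sup>2 * asymptotic_variance M h Y c x)) \<in> borel_measurable M"
      unfolding asymptotic_variance_def cond_cov_def by measurable
    show "AE x in M. exp (- (1 / 2) * t\<^sup>2 * V x) = exp (- (1 / 2) * t\<^sup>2 * asymptotic_variance M h Y c x)"
      using clt(4) by eventually_elim simp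
  qed
  have "weak_conv_m (\<lambda>N. distr M borel (\<lambda>x. sqrt (real N) * (U N x - Uinf x))) \<nu>"
  proof (rule levy_continuity)
    show "real_distribution (distr M borel (\<lambda>x. sqrt (real N) * (U N x - Uinf x)))" for N
      by (rule real_distribution_distr) measurable
  qed (use \<nu> clt(1) in auto)
  then show ?thesis
    using \<nu>(2) V_eq \<nu>.prob_space_axioms
    by (intro exI[of _ \<nu>] exI[of _ "\<lambda>x. x"]) (simp add: id)
qed

end
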